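(* Let $a=(a_1,\dots,a_n)$ be a list of positive integers. If $f\in\mathbb{R}[x_1,\dots,x_n]$ has Newton polytope $B(a)=[0,a_1]\times\cdots\times[0,a_n]$, then \[ \mathrm{EDD}(f)\ \le\ \sum_{k=1}^n k!\,e_k(a). \] There is a dense open subset $U$ of the space of polynomials with Newton polytope $B(a)$ such that for $f\in U$ this inequality is an equality.
   Context: The Newton polytope of a polynomial is the convex hull of the set of exponents of the monomials appearing in it. For $1\le k\le n$, $e_k(a)=\sum_{1\le i_1<\cdots<i_k\le n}a_{i_1}\cdots a_{i_k}$ is the $k$-th elementary symmetric polynomial in $n$ variables evaluated at $a$. For a polynomial $f$ in $x_1,\dots,x_n$ and a point $u=(u_1,\dots,u_n)$, the Lagrange multiplier equations are the system of $n+1$ polynomial equations in the $n+1$ variables $(\lambda,x_1,\dots,x_n)$ \[ \mathcal{L}_{f,u}(\lambda,x):=\begin{bmatrix} f(x)\\ \nabla f(x)-\lambda(u-x)\end{bmatrix}=0 , \] where $\nabla f=(\partial f/\partial x_1,\dots,\partial f/\partial x_n)$ and $\lambda$ is an auxiliary variable (the Lagrange multiplier). The Euclidean Distance Degree $\mathrm{EDD}(f)$ is the number of solutions to $\mathcal{L}_{f,u}(\lambda,x)=0$ in $\mathbb{C}^{n+1}$ for general $u$, where "general" means for all $u$ in the complement of a proper algebraic subvariety of $\mathbb{R}^n$.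
   Formalization: The inequality is stated only for f whose EDD(f) is finite; otherwise it fails, e.g. f=(1+x)^2(1+y)^2, where every zero of f with λ=0 solves the Lagrange equations for all u, so the number of solutions is infinite. *)

theory Defs
  imports "HOL-Analysis.Analysis" "HOL-Library.Poly_Mapping"
begin

text \<open>Polynomials over the reals in variables indexed by \<open>'v\<close> (possibly infinitely many), as finitely
  supported maps from exponent vectors to coefficients.\<close>

type_synonym 'v rpoly = "('v \<Rightarrow>\<^sub>0 nat) \<Rightarrow>\<^sub>0 real"

definition eval_rpoly :: "'v rpoly \<Rightarrow> ('v \<Rightarrow> 'a::real_field) \<Rightarrow> 'a" where
  "eval_rpoly f x =
     (\<Sum>\<alpha>\<in>Poly_Mapping.keys f. of_real (Poly_Mapping.lookup f \<alpha>) *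
       (\<Prod>i\<in>Poly_Mapping.keys \<alpha>. x i ^ Poly_Mapping.lookup \<alpha> i))"

text \<open>Truncated subtraction of exponents only occurs where \<open>\<alpha>\<close> does not involve \<open>i\<close>, and there the
  coefficient \<open>real (lookup \<alpha> i) * lookup f \<alpha>\<close> is zero.\<close>

definition partial_deriv :: "'v \<Rightarrow> 'v rpoly \<Rightarrow> 'v rpoly" where
  "partial_deriv i f =
     (\<Sum>\<alpha>\<in>Poly_Mapping.keys f. Poly_Mapping.single (\<alpha> - Poly_Mapping.single i 1)
       (real (Poly_Mapping.lookup \<alpha> i) * Poly_Mapping.lookup f \<alpha>))"

definition newton_polytope :: "('n::finite) rpoly \<Rightarrow> (real ^ 'n) set" where
  "newton_polytope f = convex hull ((\<lambda>\<alpha>. \<chi> i. real (Poly_Mapping.lookup \<alpha> i)) ` Poly_Mapping.keys f)"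

definition box_polytope :: "nat ^ 'n \<Rightarrow> (real ^ 'n) set" where
  "box_polytope a = {x. \<forall>i. 0 \<le> x $ i \<and> x $ i \<le> real (a $ i)}"

definition elem_sym :: "nat \<Rightarrow> nat ^ 'n::finite \<Rightarrow> nat" where
  "elem_sym k a = (\<Sum>S | card S = k. \<Prod>i\<in>S. a $ i)"

definition lagrange ::
  "('n::finite) rpoly \<Rightarrow> real ^ 'n \<Rightarrow> complex \<times> (complex ^ 'n) \<Rightarrow> complex \<times> (complex ^ 'n)" where
  "lagrange f u = (\<lambda>(l, x).
     (eval_rpoly f (\<lambda>j. x $ j),
      \<chi> i. eval_rpoly (partial_deriv i f) (\<lambda>j. x $ j) - l * (of_real (u $ i) - x $ i)))"

definition algebraic_subvariety :: "(real ^ 'n::finite) set \<Rightarrow> bool" where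
  "algebraic_subvariety V \<longleftrightarrow>
     (\<exists>P :: 'n rpoly set. V = {u. \<forall>p\<in>P. eval_rpoly p (\<lambda>j. u $ j) = 0})"

text \<open>\<open>has_EDD f d\<close> says that the Euclidean distance degree of \<open>f\<close> is the natural number \<open>d\<close>. No \<open>d\<close>
  qualifies when the number of solutions for general \<open>u\<close> is infinite: for instance, if \<open>f\<close> is
  the square of a nonconstant polynomial in at least two variables, then each of the infinitely many
  complex zeros of \<open>f\<close> gives a solution with multiplier 0, whatever \<open>u\<close> is.\<close>

definition has_EDD :: "('n::finite) rpoly \<Rightarrow> nat \<Rightarrow> bool" where
  "has_EDD f d \<longleftrightarrow>
     (\<exists>V. algebraic_subvariety V \<and> V \<noteq> UNIV \<and>
        (\<forall>u. u \<notin> V \<longrightarrow> finite {z. lagrange f u z = 0} \<and> card {z. lagrange f u z = 0} = d))"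

definition polys_with_polytope :: "nat ^ 'n::finite \<Rightarrow> 'n rpoly set" where
  "polys_with_polytope a = {f. newton_polytope f = box_polytope a}"

text \<open>The polynomials with Newton polytope \<open>B(a)\<close> are identified with their coefficient vectors. These
  are supported on the finitely many lattice points of \<open>B(a)\<close>, so both topologies below are the usual
  ones of a subset of a finite-dimensional real coefficient space. The first is induced by the product
  topology on functions; the second has as a basis the nonvanishing loci of polynomials in the
  coefficients.\<close>

definition euclidean_coeff_topology :: "nat ^ 'n::finite \<Rightarrow> 'n rpoly topology" where
  "euclidean_coeff_topology a = pullback_topology (polys_with_polytope a) Poly_Mapping.lookup euclidean"

definition zariski_coeff_topology :: "nat ^ 'n::finite \<Rightarrow> 'n rpoly topology" where
  "zariski_coeff_topology a =
     pullback_topology (polys_with_polytope a) Poly_Mapping.lookup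
       (topology_generated_by (range (\<lambda>p :: ('n \<Rightarrow>\<^sub>0 nat) rpoly. {c. eval_rpoly p c \<noteq> 0})))"

definition dense_open_in :: "'a topology \<Rightarrow> 'a set \<Rightarrow> bool" where
  "dense_open_in T U \<longleftrightarrow> openin T U \<and> T closure_of U = topspace T"

end

theory Submission
  imports Defs
    "HOL-Complex_Analysis.Conformal_Mappings"
    "HOL-Computational_Algebra.Fundamental_Theorem_Algebra"
    "HOL-Combinatorics.Permutations"
    "HOL-Library.Countable"
begin

text \<open>Put \<open>N = (\<Sum>k=1..n. k! e\<^sub>k(a))\<close>. The number \<open>N + 1\<close> is the permanent of the matrix with entries
  \<open>a\<^sub>j + \<delta>\<^sub>i\<^sub>j\<close>, hence the number of zeros of the system of products of linear forms
  \<open>\<Pi>\<^sub>i = (\<Prod>j. \<Prod>m < a\<^sub>j + \<delta>\<^sub>i\<^sub>j. x\<^sub>j - r\<^sub>i\<^sub>j\<^sub>m)\<close> with distinct \<open>r\<^sub>i\<^sub>j\<^sub>m\<close>. It is joined to the critical equations by the family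
  \<open>(1 - \<tau>\<^sup>2) (f (x\<^sub>i - u\<^sub>i) + \<tau> \<partial>\<^sub>i f) + \<tau>\<^sup>2 \<Pi>\<^sub>i\<close>, which is homogeneous of multidegree \<open>a + e\<^sub>i\<close> on \<open>(P\<^sup>1)\<^sup>n\<close>;
  since the degenerate parameters form a constructible set that avoids a neighbourhood of 1, they are
  finitely many, and the family has \<open>N + 1\<close> zeros for all small \<open>\<tau> \<noteq> 0\<close>.

  For \<open>\<tau> \<noteq> 0\<close> the substitution \<open>f = \<tau> l\<close> turns the family into a deformation of the Lagrange
  equations with multiplier \<open>l\<close>. Isolated zeros persist under deformation, so the isolated solutions
  of the Lagrange equations and, if \<open>f(u) \<noteq> 0\<close>, the zero near \<open>u\<close> give at most \<open>N + 1\<close> zeros. Conversely,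
  if the closure of the hypersurface in \<open>(P\<^sup>1)\<^sup>n\<close> is smooth along all faces and every solution is
  nondegenerate, then each of the \<open>N + 1\<close> zeros tends to \<open>u\<close> or to a solution, and no two to the same
  one. These conditions hold off the zeros of a nonzero real polynomial in the coefficients and \<open>u\<close>: a
  constructible set contains or misses a nonempty Zariski-open set, and the exceptional coefficients
  are, on suitable slices, images of negligible sets.\<close>

text \<open>At \<tau> = 0 the family degenerates: its affine zeros are \<open>u\<close> together
  with the whole hypersurface f = 0. The count therefore cannot be carried to \<tau> = 0; it is made
  for small \<tau> \<noteq> 0, and only the limit of the zeros is compared with the Lagrange system.
  The powers of \<tau> separate the scales: after f = \<tau> l a common factor \<tau> splits off,
  the gradient term survives at \<tau> = 0, and the product term, weighted by the square of \<tau>,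
  disappears there. The zero in excess of N is the one near \<open>u\<close>: it solves the deformed
  equations, while \<open>u\<close> satisfies no Lagrange system when f(u) \<noteq> 0. The upper
  bound must also cover degenerate solutions, so persistence of zeros is proved from isolation
  instead of from a nonvanishing Jacobian. For the equality, elimination is carried out with real
  constants only, so that the exceptional locus is cut out by a real polynomial in coefficients and
  data point, which serves both for the dense open set and for the exceptional
  \<open>u\<close>.\<close>

section \<open>Polynomial functions with real or complex coefficients\<close>

inductive polyfn :: "complex set \<Rightarrow> (('v \<Rightarrow> complex) \<Rightarrow> complex) \<Rightarrow> bool" for C where
  const: "c \<in> \<real> \<union> C \<Longrightarrow> polyfn C (\<lambda>x. c)"
| var: "polyfn C (\<lambda>x. x v)"
| add: "polyfn C p \<Longrightarrow> polyfn C q \<Longrightarrow> polyfn C (\<lambda>x. p x + q x)"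
| mult: "polyfn C p \<Longrightarrow> polyfn C q \<Longrightarrow> polyfn C (\<lambda>x. p x * q x)"

named_theorems polyfn_intros

declare polyfn.var [polyfn_intros] polyfn.add [polyfn_intros] polyfn.mult [polyfn_intros]

lemma polyfn_real [polyfn_intros]: "c \<in> \<real> \<Longrightarrow> polyfn C (\<lambda>x. c)"
  by (simp add: polyfn.const)

lemma polyfn_UNIV_const [polyfn_intros]: "polyfn UNIV (\<lambda>x. c)"
  by (simp add: polyfn.const)

lemma polyfn_0 [polyfn_intros]: "polyfn C (\<lambda>x. 0)"
  and polyfn_1 [polyfn_intros]: "polyfn C (\<lambda>x. 1)"
  and polyfn_numeral [polyfn_intros]: "polyfn C (\<lambda>x. numeral k)"
  and polyfn_of_nat [polyfn_intros]: "polyfn C (\<lambda>x. of_nat n)"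
  and polyfn_of_real [polyfn_intros]: "polyfn C (\<lambda>x. of_real r)"
  by (simp_all add: polyfn.const)

lemma polyfn_uminus [polyfn_intros]: "polyfn C p \<Longrightarrow> polyfn C (\<lambda>x. - p x)"
  using polyfn.mult[OF polyfn_real[of "-1"], of C p] by simp

lemma polyfn_diff [polyfn_intros]:
  "polyfn C p \<Longrightarrow> polyfn C q \<Longrightarrow> polyfn C (\<lambda>x. p x - q x)"
  using polyfn.add[OF _ polyfn_uminus, of C p q] by simp

lemma polyfn_sum [polyfn_intros]:
  "(\<And>i. i \<in> I \<Longrightarrow> polyfn C (p i)) \<Longrightarrow> polyfn C (\<lambda>x. \<Sum>i\<in>I. p i x)"
  by (induction I rule: infinite_finite_induct) (auto intro: polyfn_intros)

lemma polyfn_prod [polyfn_intros]: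
  "(\<And>i. i \<in> I \<Longrightarrow> polyfn C (p i)) \<Longrightarrow> polyfn C (\<lambda>x. \<Prod>i\<in>I. p i x)"
  by (induction I rule: infinite_finite_induct) (auto intro: polyfn_intros)

lemma polyfn_power [polyfn_intros]: "polyfn C p \<Longrightarrow> polyfn C (\<lambda>x. p x ^ n)"
  by (induction n) (auto intro: polyfn_intros)

lemma polyfn_if [polyfn_intros]:
  "(b \<Longrightarrow> polyfn C p) \<Longrightarrow> (\<not> b \<Longrightarrow> polyfn C q) \<Longrightarrow> polyfn C (\<lambda>x. if b then p x else q x)"
  by (cases b) auto

lemma polyfn_subst:
  assumes "polyfn C p" "\<And>v. polyfn C (\<lambda>y. s y v)"
  shows "polyfn C (\<lambda>y. p (s y))"
  using assms(1) by (induction rule: polyfn.induct) (auto intro: polyfn.intros assms(2))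

lemma polyfn_det [polyfn_intros]:
  fixes A :: "('v \<Rightarrow> complex) \<Rightarrow> complex^'k^'k"
  assumes "\<And>i j. polyfn C (\<lambda>x. A x $ i $ j)"
  shows "polyfn C (\<lambda>x. det (A x))"
  unfolding det_def by (intro polyfn_intros assms) auto

section \<open>Elimination of an existential quantifier\<close>

text \<open>A polynomial in the variable to be eliminated, with coefficients polynomial in the
  parameters. \<open>n\<close> is a formal length: the true degree drops wherever leading
  coefficients vanish.\<close>

definition poly_family :: "complex set \<Rightarrow> (('v \<Rightarrow> complex) \<Rightarrow> complex poly) \<Rightarrow> nat \<Rightarrow> bool" where
  "poly_family C P n \<longleftrightarrow> (\<forall>x i. n \<le> i \<longrightarrow> coeff (P x) i = 0) \<and> (\<forall>i. polyfn C (\<lambda>x. coeff (P x) i))"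

lemma poly_family_mult:
  assumes P: "poly_family C P n" and Q: "poly_family C Q m"
  shows "poly_family C (\<lambda>x. P x * Q x) (n + m)"
proof -
  have "coeff (P x * Q x) i = 0" if "n + m \<le> i" for x i
  proof -
    have "coeff (P x) k * coeff (Q x) (i - k) = 0" if "k \<le> i" for k
      using P Q \<open>n + m \<le> i\<close> that by (cases "n \<le> k") (auto simp: poly_family_def)
    then show ?thesis unfolding coeff_mult by (intro sum.neutral) auto
  qed
  then show ?thesis
    using P Q unfolding poly_family_def by (auto simp: coeff_mult[abs_def] intro!: polyfn_intros)
qed

lemma polyfn_poly_family:
  assumes "polyfn C p"
  shows "\<exists>P n. poly_family C P n \<and> (\<forall>x z. p (x(v := z)) = poly (P x) z)"
  using assms
proof (induction rule: polyfn.induct)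
  case (const c)
  have "poly_family C (\<lambda>x. [:c:]) 1"
    using const by (auto simp: poly_family_def coeff_pCons split: nat.splits intro: polyfn.const polyfn_0)
  then show ?case by (intro exI[of _ "\<lambda>x. [:c:]"]) auto
next
  case (var w)
  show ?case
  proof (cases "w = v")
    case True
    have "poly_family C (\<lambda>x. [:0, 1:]) 2"
      by (auto simp: poly_family_def coeff_pCons split: nat.splits intro: polyfn_intros)
    then show ?thesis using True by (intro exI[of _ "\<lambda>x. [:0, 1:]"]) auto
  next
    case False
    have "polyfn C (\<lambda>x. coeff [:x w:] i)" for i
      by (cases i) (auto intro: polyfn_intros)
    then have "poly_family C (\<lambda>x. [:x w:]) 1"
      by (auto simp: poly_family_def coeff_pCons split: nat.splits)
    then show ?thesis using False by (intro exI[of _ "\<lambda>x. [:x w:]"]) auto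
  qed
next
  case (add p q)
  then obtain P n Q m where "poly_family C P n" "\<forall>x z. p (x(v := z)) = poly (P x) z"
    "poly_family C Q m" "\<forall>x z. q (x(v := z)) = poly (Q x) z" by blast
  then have "poly_family C (\<lambda>x. P x + Q x) (max n m)"
    "\<forall>x z. p (x(v := z)) + q (x(v := z)) = poly (P x + Q x) z"
    by (auto simp: poly_family_def intro: polyfn_intros)
  then show ?case by blast
next
  case (mult p q)
  then obtain P n Q m where P: "poly_family C P n" "\<forall>x z. p (x(v := z)) = poly (P x) z"
    and Q: "poly_family C Q m" "\<forall>x z. q (x(v := z)) = poly (Q x) z" by blast
  have "poly_family C (\<lambda>x. P x * Q x) (n + m)"
    using P Q by (intro poly_family_mult) auto
  moreover have "\<forall>x z. p (x(v := z)) * q (x(v := z)) = poly (P x * Q x) z"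
    using P Q by auto
  ultimately show ?case by blast
qed

section \<open>Constructible sets and pseudo-division\<close>

inductive constructible :: "complex set \<Rightarrow> ('v \<Rightarrow> complex) set \<Rightarrow> bool" for C where
  zeros: "polyfn C p \<Longrightarrow> constructible C {x. p x = 0}"
| compl: "constructible C S \<Longrightarrow> constructible C (- S)"
| inter: "constructible C S \<Longrightarrow> constructible C T \<Longrightarrow> constructible C (S \<inter> T)"

lemma constructible_Collect_eq [polyfn_intros]:
  "polyfn C p \<Longrightarrow> polyfn C q \<Longrightarrow> constructible C {x. p x = q x}"
  using constructible.zeros[OF polyfn_diff, of C p q] by simp

lemma constructible_Collect_not [polyfn_intros]:
  "constructible C {x. P x} \<Longrightarrow> constructible C {x. \<not> P x}"
  using constructible.compl[of C "{x. P x}"] by (simp add: Compl_eq)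

lemma constructible_Collect_conj [polyfn_intros]:
  "constructible C {x. P x} \<Longrightarrow> constructible C {x. Q x} \<Longrightarrow> constructible C {x. P x \<and> Q x}"
  using constructible.inter[of C "{x. P x}" "{x. Q x}"] by (simp add: Int_def)

lemma constructible_Collect_disj [polyfn_intros]:
  "constructible C {x. P x} \<Longrightarrow> constructible C {x. Q x} \<Longrightarrow> constructible C {x. P x \<or> Q x}"
  using constructible_Collect_not[OF constructible_Collect_conj[OF constructible_Collect_not constructible_Collect_not], of C P Q]
  by simp

lemma constructible_cases:
  assumes "constructible C {x. b x}" "constructible C S" "constructible C T"
    and "\<And>x. b x \<Longrightarrow> x \<in> A \<longleftrightarrow> x \<in> S" "\<And>x. \<not> b x \<Longrightarrow> x \<in> A \<longleftrightarrow> x \<in> T"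
  shows "constructible C A"
proof -
  have "A = {x. b x \<and> x \<in> S \<or> \<not> b x \<and> x \<in> T}" using assms(4,5) by blast
  moreover have "constructible C {x. b x \<and> x \<in> S \<or> \<not> b x \<and> x \<in> T}"
    using assms by (intro polyfn_intros) auto
  ultimately show ?thesis by simp
qed

lemma constructible_Collect_const [polyfn_intros]: "constructible C {x. b}"
  using constructible_Collect_eq[OF polyfn_0 polyfn_0, of C] constructible_Collect_eq[OF polyfn_0 polyfn_1, of C]
  by (cases b) auto

lemma constructible_Collect_all [polyfn_intros]:
  "finite I \<Longrightarrow> (\<And>i. i \<in> I \<Longrightarrow> constructible C {x. P i x}) \<Longrightarrow> constructible C {x. \<forall>i\<in>I. P i x}"
  by (induction I rule: finite_induct)
    (auto intro: constructible_Collect_conj simp: constructible_Collect_const[of _ True, simplified])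

lemma constructible_Collect_ex [polyfn_intros]:
  "finite I \<Longrightarrow> (\<And>i. i \<in> I \<Longrightarrow> constructible C {x. P i x}) \<Longrightarrow> constructible C {x. \<exists>i\<in>I. P i x}"
  by (induction I rule: finite_induct)
    (auto intro: constructible_Collect_disj simp: constructible_Collect_const[of _ False, simplified])

lemma constructible_Collect_all_UNIV [polyfn_intros]:
  "(\<And>i. constructible C {x. P i x}) \<Longrightarrow> constructible C {x. \<forall>i::'i::finite. P i x}"
  using constructible_Collect_all[of UNIV C P] by simp

lemma constructible_Collect_ex_UNIV [polyfn_intros]:
  "(\<And>i. constructible C {x. P i x}) \<Longrightarrow> constructible C {x. \<exists>i::'i::finite. P i x}"
  using constructible_Collect_ex[of UNIV C P] by simp

lemma constructible_family_eq_0 [polyfn_intros]: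
  assumes "poly_family C P n"
  shows "constructible C {x. P x = 0}"
proof -
  have "P x = 0 \<longleftrightarrow> (\<forall>i\<in>{..<n}. coeff (P x) i = 0)" for x
    using assms by (auto simp: poly_eq_iff poly_family_def) (metis lessThan_iff not_le)
  moreover have "constructible C {x. \<forall>i\<in>{..<n}. coeff (P x) i = 0}"
    using assms by (intro polyfn_intros) (auto simp: poly_family_def)
  ultimately show ?thesis by simp
qed

text \<open>One step of pseudo-division: the coefficients of degree \<open>m\<close> cancel, and
  cross-multiplication in place of division keeps the new coefficients polynomial in the
  parameters.\<close>

definition pseudo_reduce ::
  "(('v \<Rightarrow> complex) \<Rightarrow> complex poly) \<Rightarrow> nat \<Rightarrow> (('v \<Rightarrow> complex) \<Rightarrow> complex poly) \<Rightarrow> nat \<Rightarrow> ('v \<Rightarrow> complex) \<Rightarrow> complex poly"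
  where "pseudo_reduce P k Q m = (\<lambda>x. smult (coeff (P x) k) (Q x) - smult (coeff (Q x) m) (monom 1 (m - k) * P x))"

lemma poly_family_pseudo_reduce:
  assumes "poly_family C P (Suc k)" "poly_family C Q (Suc m)" "k \<le> m"
  shows "poly_family C (pseudo_reduce P k Q m) m"
  unfolding poly_family_def
proof (intro conjI allI impI)
  fix x i assume "m \<le> i"
  then consider "i = m" | "Suc m \<le> i" by linarith
  then show "coeff (pseudo_reduce P k Q m x) i = 0"
    using assms by cases (auto simp: pseudo_reduce_def poly_family_def coeff_monom_mult)
next
  fix i
  show "polyfn C (\<lambda>x. coeff (pseudo_reduce P k Q m x) i)"
    using assms by (cases "m - k \<le> i") (auto simp: pseudo_reduce_def poly_family_def coeff_monom_mult intro!: polyfn_intros)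
qed

definition drop_lead :: "(('v \<Rightarrow> complex) \<Rightarrow> complex poly) \<Rightarrow> nat \<Rightarrow> ('v \<Rightarrow> complex) \<Rightarrow> complex poly" where
  "drop_lead P k = (\<lambda>x. P x - monom (coeff (P x) k) k)"

lemma poly_family_drop_lead:
  assumes "poly_family C P (Suc k)"
  shows "poly_family C (drop_lead P k) k"
  unfolding poly_family_def
proof (intro conjI allI impI)
  fix x i assume "k \<le> i"
  then consider "i = k" | "Suc k \<le> i" by linarith
  then show "coeff (drop_lead P k x) i = 0"
    using assms by cases (auto simp: drop_lead_def poly_family_def)
next
  fix i
  show "polyfn C (\<lambda>x. coeff (drop_lead P k x) i)"
    using assms by (cases "k = i") (auto simp: drop_lead_def poly_family_def intro!: polyfn_intros)
qed

lemma drop_lead_eq: "coeff (P x) k = 0 \<Longrightarrow> drop_lead P k x = P x"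
  by (simp add: drop_lead_def)

text \<open>Multiplying \<open>R\<close> by the nonzero leading coefficient of \<open>P\<close> does
  not affect divisibility, so pseudo-reduction shortens \<open>R\<close> until its length is at most
  \<open>k\<close>; from then on divisibility means that \<open>R\<close> vanishes.\<close>

lemma constructible_family_dvd:
  assumes P: "poly_family C P (Suc k)" and "poly_family C R m"
  shows "constructible C {x. coeff (P x) k \<noteq> 0 \<and> P x dvd R x}"
  using assms(2)
proof (induction m arbitrary: R)
  case 0
  then have "R x = 0" for x by (auto simp: poly_family_def poly_eq_iff)
  then have "{x. coeff (P x) k \<noteq> 0 \<and> P x dvd R x} = {x. coeff (P x) k \<noteq> 0}" by simp
  moreover have "constructible C {x. coeff (P x) k \<noteq> 0}"
    using P by (intro polyfn_intros) (auto simp: poly_family_def)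
  ultimately show ?case by simp
next
  case (Suc m)
  have lead: "constructible C {x. coeff (P x) k \<noteq> 0}"
    using P by (intro polyfn_intros) (auto simp: poly_family_def)
  show ?case
  proof (cases "k \<le> m")
    case True
    have "P x dvd R x \<longleftrightarrow> P x dvd pseudo_reduce P k R m x" if "coeff (P x) k \<noteq> 0" for x
    proof -
      have "P x dvd pseudo_reduce P k R m x \<longleftrightarrow> P x dvd smult (coeff (P x) k) (R x)"
        unfolding pseudo_reduce_def by (rule dvd_diff_left_iff) (simp add: dvd_smult)
      then show ?thesis using that by (simp add: dvd_smult_iff)
    qed
    then have "{x. coeff (P x) k \<noteq> 0 \<and> P x dvd R x}
        = {x. coeff (P x) k \<noteq> 0 \<and> P x dvd pseudo_reduce P k R m x}" by blast
    then show ?thesis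
      using Suc.IH[OF poly_family_pseudo_reduce[OF P Suc.prems True]] by simp
  next
    case False
    have "P x dvd R x \<longleftrightarrow> R x = 0" if "coeff (P x) k \<noteq> 0" for x
    proof
      assume "P x dvd R x"
      moreover have "degree (R x) < k"
        using Suc.prems False by (auto simp: poly_family_def intro!: degree_lessI)
      moreover have "k \<le> degree (P x)" using that by (rule le_degree)
      ultimately show "R x = 0" using dvd_imp_degree_le[of "P x" "R x"] by linarith
    qed simp
    then have "{x. coeff (P x) k \<noteq> 0 \<and> P x dvd R x} = {x. coeff (P x) k \<noteq> 0 \<and> R x = 0}" by blast
    moreover have "constructible C {x. coeff (P x) k \<noteq> 0 \<and> R x = 0}"
      using lead constructible_family_eq_0[OF Suc.prems] by (rule constructible_Collect_conj)
    ultimately show ?thesis by simp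
  qed
qed

lemma poly_family_power:
  assumes "poly_family C P n" shows "\<exists>m. poly_family C (\<lambda>x. P x ^ k) m"
proof (induction k)
  case 0
  have "poly_family C (\<lambda>x. 1) 1" by (auto simp: poly_family_def coeff_eq_0 intro: polyfn_intros)
  then show ?case by auto
next
  case (Suc k) then show ?case using poly_family_mult[OF assms] by auto
qed

text \<open>The induction is on the total length of the families: a vanishing leading coefficient is dropped,
  a nonvanishing one allows pseudo-reduction of another member, and a single equation \<open>P = 0\<close> of
  degree \<open>k\<close> has a root outside the zeros of \<open>Q\<close> iff \<open>P\<close> does not divide \<open>Q ^ k\<close>.\<close>

lemma constructible_family_ex_zero:
  assumes "\<And>P n. (P, n) \<in> set Ps \<Longrightarrow> poly_family C P n" and "poly_family C Q m"
  shows "constructible C {x. \<exists>z. (\<forall>(P, n)\<in>set Ps. poly (P x) z = 0) \<and> poly (Q x) z \<noteq> 0}"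
  using assms(1)
proof (induction "\<Sum>(P, n)\<leftarrow>Ps. Suc n" arbitrary: Ps rule: less_induct)
  case less
  let ?E = "\<lambda>Ps. {x. \<exists>z. (\<forall>(P, n)\<in>set Ps. poly (P x) z = 0) \<and> poly (Q x) z \<noteq> 0}"
  have lead: "constructible C {x. coeff (P x) k = 0}" "constructible C {x. coeff (P x) k \<noteq> 0}"
    if "(P, n) \<in> set Ps" for P n k
    using less.prems[OF that] by (auto simp: poly_family_def intro!: polyfn_intros)
  have zero: "constructible C (?E Ps)" if "Ps = (P, 0) # Ps'" for P Ps'
  proof -
    have "P x = 0" for x using less.prems[of P 0] that by (auto simp: poly_family_def poly_eq_iff)
    then have "?E Ps = ?E Ps'" using that by auto
    moreover have "constructible C (?E Ps')"
      by (rule less.hyps) (use that less.prems in auto)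
    ultimately show ?thesis by simp
  qed
  have split: "constructible C (?E Ps)"
    if Ps: "Ps = (P, Suc k) # Ps'" and c: "constructible C {x. coeff (P x) k \<noteq> 0 \<and> x \<in> ?E Ps}" for P k Ps'
  proof -
    let ?Ps = "(drop_lead P k, k) # Ps'"
    have d: "constructible C (?E ?Ps)"
    proof (rule less.hyps)
      fix P' n assume "(P', n) \<in> set ?Ps"
      then show "poly_family C P' n"
        using poly_family_drop_lead[of C P k] less.prems Ps by auto
    qed (use Ps in auto)
    have "(P, Suc k) \<in> set Ps" using Ps by simp
    from constructible_cases[OF lead(1)[OF this, of k] d c] show ?thesis
      unfolding Ps by (simp add: drop_lead_eq)
  qed
  \<comment> \<open>The longer of two polynomials is reduced modulo the shorter one. Prescribing
    \<open>Ps\<close> only up to its set and total length makes this usable for either order of the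
    first two entries.\<close>
  have two: "constructible C (?E Ps)" if Ps: "set Ps = set ((P, Suc k) # (R, Suc l) # Ps')"
    "(\<Sum>(P, n)\<leftarrow>Ps. Suc n) = (\<Sum>(P, n)\<leftarrow>((P, Suc k) # (R, Suc l) # Ps'). Suc n)" and "k \<le> l" for P k R l Ps'
  proof -
    let ?Ps = "(P, Suc k) # (pseudo_reduce P k R l, l) # Ps'"
    let ?Pd = "(drop_lead P k, k) # (R, Suc l) # Ps'"
    have mem: "(P, Suc k) \<in> set Ps" "(R, Suc l) \<in> set Ps" using Ps by auto
    have 1: "constructible C (?E ?Ps)"
    proof (rule less.hyps)
      fix P' n assume "(P', n) \<in> set ?Ps"
      then show "poly_family C P' n"
        using poly_family_pseudo_reduce[OF less.prems[OF mem(1)] less.prems[OF mem(2)] \<open>k \<le> l\<close>] less.prems Ps by auto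
    qed (use Ps in auto)
    have 2: "constructible C (?E ?Pd)"
    proof (rule less.hyps)
      fix P' n assume "(P', n) \<in> set ?Pd"
      then show "poly_family C P' n"
        using poly_family_drop_lead[of C P k] less.prems Ps by auto
    qed (use Ps in auto)
    have red: "poly (P x) z = 0 \<Longrightarrow> coeff (P x) k \<noteq> 0 \<Longrightarrow>
        poly (pseudo_reduce P k R l x) z = 0 \<longleftrightarrow> poly (R x) z = 0" for x z
      by (simp add: pseudo_reduce_def)
    show ?thesis
    proof (rule constructible_cases[OF lead(1)[OF mem(1), of k] 2 1])
      show "x \<in> ?E Ps \<longleftrightarrow> x \<in> ?E ?Pd" if "coeff (P x) k = 0" for x
        using that by (simp add: Ps(1) drop_lead_eq)
      show "x \<in> ?E Ps \<longleftrightarrow> x \<in> ?E ?Ps" if "coeff (P x) k \<noteq> 0" for x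
        using red[OF _ that] by (simp add: Ps(1) cong: conj_cong)
    qed
  qed
  show ?case
  proof (cases Ps)
    case Nil
    have "(\<exists>z. poly (Q x) z \<noteq> 0) \<longleftrightarrow> Q x \<noteq> 0" for x
      using poly_all_0_iff_0 by blast
    then show ?thesis using constructible_Collect_not[OF constructible_family_eq_0[OF assms(2)]] by (simp add: Nil)
  next
    case (Cons A Ps1)
    obtain P n where A: "A = (P, n)" by (cases A)
    show ?thesis
    proof (cases n)
      case 0 then show ?thesis using zero Cons A by auto
    next
      case (Suc k)
      note P = Cons[unfolded A Suc]
      show ?thesis
      proof (cases Ps1)
        case Nil
        have fam: "poly_family C P (Suc k)" using less.prems P by auto
        have "x \<in> ?E Ps \<longleftrightarrow> \<not> (P x dvd Q x ^ k)" if "coeff (P x) k \<noteq> 0" for x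
        proof -
          have "\<forall>i>k. coeff (P x) i = 0" using fam by (auto simp: poly_family_def)
          then have "degree (P x) = k"
            using le_degree[OF that] degree_le[of k "P x"] by simp
          moreover have "P x \<noteq> 0" using that by auto
          ultimately show ?thesis using nullstellensatz_univariate[of "P x" "Q x"] by (auto simp: P Nil)
        qed
        then have eq: "{x. coeff (P x) k \<noteq> 0 \<and> x \<in> ?E Ps}
            = {x. coeff (P x) k \<noteq> 0 \<and> \<not> (coeff (P x) k \<noteq> 0 \<and> P x dvd Q x ^ k)}" by blast
        obtain l where "poly_family C (\<lambda>x. Q x ^ k) l" using poly_family_power[OF assms(2)] by blast
        note pow = this
        have "(P, Suc k) \<in> set Ps" using P by simp
        then have "constructible C {x. coeff (P x) k \<noteq> 0 \<and> x \<in> ?E Ps}"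
          unfolding eq by (intro constructible_Collect_conj[OF lead(2)]
            constructible_Collect_not[OF constructible_family_dvd[OF fam pow]])
        then show ?thesis using split[OF P] by simp
      next
        case (Cons B Ps')
        obtain R l' where B: "B = (R, l')" by (cases B)
        show ?thesis
        proof (cases l')
          case 0
          have R: "R x = 0" for x using less.prems[of R 0] P Cons B 0 by (auto simp: poly_family_def poly_eq_iff)
          have "?E Ps = ?E ((P, n) # Ps')" by (simp add: P Cons B R)
          moreover have "constructible C (?E ((P, n) # Ps'))"
            by (rule less.hyps) (use P Cons B 0 Suc less.prems in auto)
          ultimately show ?thesis by simp
        next
          case (Suc l)
          show ?thesis
          proof (cases "k \<le> l")
            case True then show ?thesis using two[of P k R l Ps'] P Cons B Suc by simp
          next
            case False
            moreover have "set Ps = set ((R, Suc l) # (P, Suc k) # Ps')" using P Cons B Suc by auto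
            ultimately show ?thesis using two[of R l P k Ps'] P Cons B Suc by simp
          qed
        qed
      qed
    qed
  qed
qed

section \<open>Projections of constructible sets\<close>

text \<open>An existential quantifier passes through a union but not through a complement, hence a
  normal form. One inequation per term suffices because inequations can be multiplied
  together.\<close>

inductive dnf :: "complex set \<Rightarrow> ('v \<Rightarrow> complex) set \<Rightarrow> bool" for C where
  empty: "dnf C {}"
| union: "dnf C S \<Longrightarrow> (\<And>p. p \<in> set ps \<Longrightarrow> polyfn C p) \<Longrightarrow> polyfn C q \<Longrightarrow>
    dnf C ({x. (\<forall>p\<in>set ps. p x = 0) \<and> q x \<noteq> 0} \<union> S)"

lemma dnf_basic:
  assumes "\<And>p. p \<in> set ps \<Longrightarrow> polyfn C p" "polyfn C q"
  shows "dnf C {x. (\<forall>p\<in>set ps. p x = 0) \<and> q x \<noteq> 0}"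
  using dnf.union[OF dnf.empty assms] by simp

lemma dnf_Un: "dnf C S \<Longrightarrow> dnf C T \<Longrightarrow> dnf C (S \<union> T)"
  by (induction rule: dnf.induct) (auto simp: Un_assoc intro: dnf.union)

lemma dnf_basic_Int:
  assumes "dnf C T" "\<And>p. p \<in> set ps \<Longrightarrow> polyfn C p" "polyfn C q"
  shows "dnf C ({x. (\<forall>p\<in>set ps. p x = 0) \<and> q x \<noteq> 0} \<inter> T)"
  using assms(1)
proof (induction rule: dnf.induct)
  case empty
  then show ?case by (simp add: dnf.empty)
next
  case (union S ps' q')
  have "dnf C ({x. (\<forall>p\<in>set (ps @ ps'). p x = 0) \<and> q x * q' x \<noteq> 0} \<union>
      ({x. (\<forall>p\<in>set ps. p x = 0) \<and> q x \<noteq> 0} \<inter> S))"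
    using union assms(2,3) by (intro dnf.union polyfn.mult) auto
  moreover have "{x. (\<forall>p\<in>set (ps @ ps'). p x = 0) \<and> q x * q' x \<noteq> 0} =
      {x. (\<forall>p\<in>set ps. p x = 0) \<and> q x \<noteq> 0} \<inter> {x. (\<forall>p\<in>set ps'. p x = 0) \<and> q' x \<noteq> 0}" by auto
  ultimately show ?case by (simp add: Int_Un_distrib)
qed

lemma dnf_Int: "dnf C S \<Longrightarrow> dnf C T \<Longrightarrow> dnf C (S \<inter> T)"
  by (induction rule: dnf.induct) (auto simp: Int_Un_distrib2 intro: dnf.empty dnf_Un dnf_basic_Int)

lemma dnf_Collect_neq: "polyfn C q \<Longrightarrow> dnf C {x. q x \<noteq> 0}"
  using dnf_basic[of "[]" C q] by simp

lemma dnf_Collect_eq: "polyfn C q \<Longrightarrow> dnf C {x. q x = 0}"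
  using dnf_basic[of "[q]" C "\<lambda>x. 1"] by (simp add: polyfn_1)

lemma dnf_Compl: "dnf C S \<Longrightarrow> dnf C (- S)"
proof (induction rule: dnf.induct)
  case empty
  then show ?case using dnf_Collect_neq[OF polyfn_1] by simp
next
  case (union S ps q)
  have "dnf C {x. \<exists>p\<in>set ps. p x \<noteq> 0}"
    using union.hyps(2)
  proof (induction ps)
    case (Cons p ps)
    then have "dnf C ({x. p x \<noteq> 0} \<union> {x. \<exists>p\<in>set ps. p x \<noteq> 0})"
      by (intro dnf_Un dnf_Collect_neq) auto
    then show ?case by (simp add: Un_def)
  qed (simp add: dnf.empty)
  moreover have "dnf C {x. q x = 0}" using union by (intro dnf_Collect_eq)
  moreover have "- ({x. (\<forall>p\<in>set ps. p x = 0) \<and> q x \<noteq> 0} \<union> S) =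
      ({x. \<exists>p\<in>set ps. p x \<noteq> 0} \<union> {x. q x = 0}) \<inter> (- S)" by auto
  ultimately show ?case using union.IH by (auto intro: dnf_Un dnf_Int)
qed

lemma constructible_imp_dnf: "constructible C S \<Longrightarrow> dnf C S"
  by (induction rule: constructible.induct) (auto intro: dnf_Compl dnf_Int dnf_Collect_eq)

text \<open>Chevalley's theorem for one coordinate: each term of the normal form is a system of
  equations and one inequation in the quantified variable, which univariate elimination
  handles.\<close>

lemma constructible_Collect_ex_upd:
  assumes "constructible C {x. P x}"
  shows "constructible C {x. \<exists>z. P (x(v := z))}"
proof -
  have "constructible C {x. \<exists>z. x(v := z) \<in> S}" if "dnf C S" for S
    using that
  proof (induction rule: dnf.induct)
    case empty
    then show ?case using constructible_Collect_const[of C False] by simp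
  next
    case (union S ps q)
    have "\<forall>p\<in>set ps. \<exists>Pn. poly_family C (fst Pn) (snd Pn) \<and> (\<forall>x z. p (x(v := z)) = poly (fst Pn x) z)"
      using polyfn_poly_family[OF union.hyps(2), of _ v] by auto
    from bchoice[OF this] obtain G where G: "\<forall>p\<in>set ps. poly_family C (fst (G p)) (snd (G p)) \<and>
      (\<forall>x z. p (x(v := z)) = poly (fst (G p) x) z)" ..
    define F N where "F = (\<lambda>p. fst (G p))" and "N = (\<lambda>p. snd (G p))"
    have F: "poly_family C (F p) (N p)" "p (x(v := z)) = poly (F p x) z" if "p \<in> set ps" for p x z
      using G that by (auto simp: F_def N_def)
    obtain Q m where Q: "poly_family C Q m" "\<And>x z. q (x(v := z)) = poly (Q x) z"
      using polyfn_poly_family[OF union.hyps(3)] by blast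
    let ?Ps = "map (\<lambda>p. (F p, N p)) ps"
    have "constructible C {x. \<exists>z. (\<forall>(P, n)\<in>set ?Ps. poly (P x) z = 0) \<and> poly (Q x) z \<noteq> 0}"
      by (rule constructible_family_ex_zero[OF _ Q(1)]) (auto simp: F)
    moreover have "(\<forall>(P, n)\<in>set ?Ps. poly (P x) z = 0) \<longleftrightarrow> (\<forall>p\<in>set ps. p (x(v := z)) = 0)" for x z
      using F(2) by auto
    ultimately have "constructible C {x. \<exists>z. (\<forall>p\<in>set ps. p (x(v := z)) = 0) \<and> q (x(v := z)) \<noteq> 0}"
      using Q(2) by simp
    from constructible_Collect_disj[OF this union.IH]
    have "constructible C {x. (\<exists>z. (\<forall>p\<in>set ps. p (x(v := z)) = 0) \<and> q (x(v := z)) \<noteq> 0) \<or> (\<exists>z. x(v := z) \<in> S)}" .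
    also have "{x. (\<exists>z. (\<forall>p\<in>set ps. p (x(v := z)) = 0) \<and> q (x(v := z)) \<noteq> 0) \<or> (\<exists>z. x(v := z) \<in> S)} =
        {x. \<exists>z. x(v := z) \<in> {x. (\<forall>p\<in>set ps. p x = 0) \<and> q x \<noteq> 0} \<union> S}"
      unfolding Un_iff mem_Collect_eq ex_disj_distrib ..
    finally show ?case .
  qed
  from this[OF constructible_imp_dnf[OF assms]] show ?thesis by simp
qed

text \<open>The projection is kept as a cylinder in the same space, \<open>y\<close> agreeing with
  \<open>x\<close> off \<open>W\<close>; thus the index type stays fixed under iteration.\<close>

lemma constructible_Collect_ex_off:
  assumes "finite W" "constructible C {x. P x}"
  shows "constructible C {x. \<exists>y. (\<forall>v. v \<notin> W \<longrightarrow> y v = x v) \<and> P y}"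
  using assms
proof (induction W arbitrary: P rule: finite_induct)
  case empty
  have "(\<forall>v. y v = x v) \<longleftrightarrow> y = x" for x y :: "'a \<Rightarrow> complex" by auto
  then show ?case using empty by simp
next
  case (insert w W)
  have "(\<exists>y. (\<forall>v. v \<notin> insert w W \<longrightarrow> y v = x v) \<and> P y) \<longleftrightarrow>
      (\<exists>y. (\<forall>v. v \<notin> W \<longrightarrow> y v = x v) \<and> (\<exists>z. P (y(w := z))))" for x
  proof
    assume "\<exists>y. (\<forall>v. v \<notin> insert w W \<longrightarrow> y v = x v) \<and> P y"
    then obtain y where "\<forall>v. v \<notin> insert w W \<longrightarrow> y v = x v" "P y" by blast
    then show "\<exists>y. (\<forall>v. v \<notin> W \<longrightarrow> y v = x v) \<and> (\<exists>z. P (y(w := z)))"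
      using insert.hyps by (intro exI[of _ "y(w := x w)"]) (auto intro!: exI[of _ "y w"])
  next
    assume "\<exists>y. (\<forall>v. v \<notin> W \<longrightarrow> y v = x v) \<and> (\<exists>z. P (y(w := z)))"
    then obtain y z where "\<forall>v. v \<notin> W \<longrightarrow> y v = x v" "P (y(w := z))" by blast
    then show "\<exists>y. (\<forall>v. v \<notin> insert w W \<longrightarrow> y v = x v) \<and> P y"
      by (intro exI[of _ "y(w := z)"]) auto
  qed
  then show ?case using insert.IH[OF constructible_Collect_ex_upd[OF insert.prems, of w]] by (simp only: not_False_eq_True)
qed

section \<open>Generic points\<close>

lemma polyfn_line:
  assumes "polyfn C p"
  shows "\<exists>P. \<forall>t. p (\<lambda>v. x v + t * y v) = poly P t"
  using assms
proof (induction rule: polyfn.induct)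
  case (const c) then show ?case by (intro exI[of _ "[:c:]"]) simp
next
  case (var v) then show ?case by (intro exI[of _ "[:x v, y v:]"]) (simp add: algebra_simps)
next
  case (add p q) then show ?case by (metis poly_add)
next
  case (mult p q) then show ?case by (metis poly_mult)
qed

text \<open>On the line joining the two points both restrictions are nonzero univariate polynomials,
  so their product has a nonroot. This is the irreducibility of affine space.\<close>

lemma polyfn_common_nonzero:
  assumes "polyfn C p" "polyfn C q" "p x \<noteq> 0" "q y \<noteq> 0"
  shows "\<exists>z. p z * q z \<noteq> 0"
proof -
  obtain P where P: "\<And>t. p (\<lambda>v. x v + t * (y v - x v)) = poly P t"
    using polyfn_line[OF assms(1), of x "\<lambda>v. y v - x v"] by blast
  obtain Q where Q: "\<And>t. q (\<lambda>v. x v + t * (y v - x v)) = poly Q t"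
    using polyfn_line[OF assms(2), of x "\<lambda>v. y v - x v"] by blast
  have "poly P 0 \<noteq> 0" "poly Q 1 \<noteq> 0" using P[of 0] Q[of 1] assms(3,4) by auto
  then have "P * Q \<noteq> 0" by auto
  then obtain t where "poly (P * Q) t \<noteq> 0" using poly_all_0_iff_0 by blast
  then show ?thesis using P Q by (metis poly_mult)
qed

text \<open>The line through the real part of \<open>x\<close> in the direction of its imaginary
  part reaches \<open>x\<close> at the parameter \<i>. So the restriction is not zero, and some real
  parameter avoids its finitely many roots.\<close>

lemma polyfn_real_nonzero:
  assumes "polyfn C p" "p x \<noteq> 0"
  shows "\<exists>y :: 'v \<Rightarrow> real. p (\<lambda>v. of_real (y v)) \<noteq> 0"
proof -
  obtain P where P: "\<And>t. p (\<lambda>v. of_real (Re (x v)) + t * of_real (Im (x v))) = poly P t"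
    using polyfn_line[OF assms(1), of "\<lambda>v. of_real (Re (x v))" "\<lambda>v. of_real (Im (x v))"] by blast
  have "poly P \<i> = p x" using P[of \<i>] by (simp flip: complex_eq)
  then have "P \<noteq> 0" using assms(2) by auto
  then have "finite {t. poly P t = 0}" by (rule poly_roots_finite)
  then have "finite (complex_of_real -` {t. poly P t = 0})"
    by (rule finite_vimageI) (simp add: inj_on_def)
  then have "complex_of_real -` {t. poly P t = 0} \<noteq> UNIV"
    using infinite_UNIV_char_0[where 'a = real] by metis
  then obtain t :: real where "poly P (of_real t) \<noteq> 0" by auto
  then show ?thesis using P[of "of_real t"]
    by (intro exI[of _ "\<lambda>v. Re (x v) + t * Im (x v)"]) simp
qed

text \<open>Irreducibility makes two nonempty principal open sets meet, so the dichotomy survives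
  intersections. \<open>D\<close> uses the same constants \<open>C\<close>, which keeps it real when
  \<open>S\<close> is defined over the reals.\<close>

lemma constructible_dichotomy:
  assumes "constructible C S"
  shows "\<exists>D. polyfn C D \<and> (\<exists>x. D x \<noteq> 0) \<and> ({x. D x \<noteq> 0} \<subseteq> S \<or> {x. D x \<noteq> 0} \<subseteq> - S)"
  using assms
proof (induction rule: constructible.induct)
  case (zeros p)
  show ?case
  proof (cases "\<exists>x. p x \<noteq> 0")
    case True then show ?thesis using zeros by (intro exI[of _ p]) auto
  next
    case False then show ?thesis by (intro exI[of _ "\<lambda>x. 1"]) (auto intro: polyfn_1)
  qed
next
  case (compl S) then show ?case by auto
next
  case (inter S T)
  then obtain D E x y where DE: "polyfn C D" "D x \<noteq> 0" "{x. D x \<noteq> 0} \<subseteq> S \<or> {x. D x \<noteq> 0} \<subseteq> - S"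
    "polyfn C E" "E y \<noteq> 0" "{x. E x \<noteq> 0} \<subseteq> T \<or> {x. E x \<noteq> 0} \<subseteq> - T" by auto
  have "{x. D x * E x \<noteq> 0} \<subseteq> S \<inter> T \<or> {x. D x * E x \<noteq> 0} \<subseteq> - (S \<inter> T)"
    using DE(3,6) by (auto simp: subset_iff)
  then show ?case
    using polyfn_common_nonzero[of C D E x y] polyfn.mult[of C D E] DE(1,2,4,5)
    by (intro exI[of _ "\<lambda>x. D x * E x"] conjI) simp_all
qed

text \<open>On a line every zero set of a polynomial is finite or everything, and being finite or
  cofinite is stable under Boolean operations.\<close>

lemma constructible_line_finite:
  fixes S :: "('v \<Rightarrow> complex) set"
  assumes "constructible C S" "infinite {t. x(v := t) \<notin> S}"
  shows "finite {t. x(v := t) \<in> S}"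
proof -
  have "finite {t. x(v := t) \<in> S} \<or> finite {t. x(v := t) \<notin> S}"
    using assms(1)
  proof (induction rule: constructible.induct)
    case (zeros p)
    obtain P n where P: "\<And>t. p (x(v := t)) = poly (P x) t"
      using polyfn_poly_family[OF zeros, of v] by blast
    show ?case
    proof (cases "P x = 0")
      case True then show ?thesis using P by (simp del: fun_upd_apply)
    next
      case False then show ?thesis using P poly_roots_finite[of "P x"] by (simp del: fun_upd_apply)
    qed
  next
    case (compl S) then show ?case by auto
  next
    case (inter S T)
    have "{t. x(v := t) \<notin> S \<inter> T} = {t. x(v := t) \<notin> S} \<union> {t. x(v := t) \<notin> T}"
      "{t. x(v := t) \<in> S \<inter> T} = {t. x(v := t) \<in> S} \<inter> {t. x(v := t) \<in> T}" by auto
    then show ?case using inter.IH by (metis finite_Int finite_UnI inf_commute)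
  qed
  then show ?thesis using assms(2) by blast
qed

section \<open>Polynomial systems depending on a parameter\<close>

definition pd :: "'v \<Rightarrow> (('v \<Rightarrow> complex) \<Rightarrow> complex) \<Rightarrow> ('v \<Rightarrow> complex) \<Rightarrow> complex" where
  "pd v p x = deriv (\<lambda>t. p (x(v := t))) (x v)"

lemma polyfn_poly_line:
  assumes "polyfn C p"
  obtains P where "\<And>t. p (x(v := t)) = poly P t"
  using polyfn_poly_family[OF assms, of v] by blast

lemma DERIV_pd:
  assumes "polyfn C p"
  shows "((\<lambda>t. p (x(v := t))) has_field_derivative pd v p (x(v := s))) (at s)"
proof -
  obtain P where P: "\<And>t. p (x(v := t)) = poly P t" using polyfn_poly_line[OF assms] by blast
  then have "(\<lambda>t. p (x(v := t))) field_differentiable at s"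
    using poly_DERIV[of P s] by (simp only: field_differentiable_def) blast
  then show ?thesis unfolding pd_def by (simp add: DERIV_deriv_iff_field_differentiable)
qed

lemma DERIV_pd': "polyfn C p \<Longrightarrow> ((\<lambda>t. p (x(v := t))) has_field_derivative pd v p x) (at (x v))"
  using DERIV_pd[of C p x v "x v"] by simp

lemma pd_eqI: "((\<lambda>t. p (x(v := t))) has_field_derivative d) (at (x v)) \<Longrightarrow> pd v p x = d"
  unfolding pd_def by (rule DERIV_imp_deriv)

lemma pd_const [simp]: "pd v (\<lambda>x. c) = (\<lambda>x. 0)"
  by (simp add: pd_def fun_eq_iff)

lemma pd_var: "pd v (\<lambda>x. x w) = (\<lambda>x. if v = w then 1 else 0)"
  by (auto simp: pd_def fun_eq_iff)

lemma pd_add: "polyfn C p \<Longrightarrow> polyfn C q \<Longrightarrow> pd v (\<lambda>x. p x + q x) = (\<lambda>x. pd v p x + pd v q x)"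
  by (intro ext pd_eqI derivative_intros DERIV_pd')

lemma pd_diff: "polyfn C p \<Longrightarrow> polyfn C q \<Longrightarrow> pd v (\<lambda>x. p x - q x) = (\<lambda>x. pd v p x - pd v q x)"
  by (intro ext pd_eqI derivative_intros DERIV_pd')

lemma pd_mult:
  assumes "polyfn C p" "polyfn C q"
  shows "pd v (\<lambda>x. p x * q x) = (\<lambda>x. pd v p x * q x + p x * pd v q x)"
proof (intro ext pd_eqI)
  fix x
  show "((\<lambda>t. p (x(v := t)) * q (x(v := t))) has_field_derivative pd v p x * q x + p x * pd v q x) (at (x v))"
    using DERIV_mult[OF DERIV_pd'[OF assms(1), of x v] DERIV_pd'[OF assms(2), of x v]]
    by (simp add: mult.commute add.commute)
qed

lemma polyfn_pd [polyfn_intros]: "polyfn C p \<Longrightarrow> polyfn C (pd v p)"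
proof (induction rule: polyfn.induct)
  case (add p q) then show ?case by (simp add: pd_add[OF add(1,2)] polyfn.add)
next
  case (mult p q) then show ?case
    by (simp add: pd_mult[OF mult(1,2)] polyfn.add polyfn.mult)
qed (auto simp: pd_var intro: polyfn_intros)

lemma tendsto_polyfn:
  assumes "polyfn C p" "\<And>v. ((\<lambda>t. g t v) \<longlongrightarrow> l v) F"
  shows "((\<lambda>t. p (g t)) \<longlongrightarrow> p l) F"
  using assms(1) by (induction rule: polyfn.induct) (auto intro: tendsto_intros assms(2))

lemma continuous_on_polyfn:
  assumes "polyfn C p" "\<And>v. continuous_on S (\<lambda>t. g t v)"
  shows "continuous_on S (\<lambda>t. p (g t))"
  using assms(1) by (induction rule: polyfn.induct) (auto intro: continuous_intros assms(2))

lemma holomorphic_on_polyfn: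
  assumes "polyfn C p" "\<And>v. (\<lambda>t. g t v) holomorphic_on S"
  shows "(\<lambda>t. p (g t)) holomorphic_on S"
  using assms(1) by (induction rule: polyfn.induct) (auto intro: holomorphic_intros assms(2))

text \<open>Systems in unknowns indexed by \<open>'m\<close> that depend on one parameter live on
  \<open>'m option\<close>, with \<open>None\<close> as the parameter.\<close>

abbreviation pt :: "complex \<Rightarrow> complex^'m \<Rightarrow> 'm option \<Rightarrow> complex" where
  "pt t x \<equiv> case_option t (($) x)"

lemma continuous_on_pt_fst_snd: "continuous_on S (\<lambda>tx. pt (fst tx) (snd tx) o')"
  by (cases o') (simp_all add: continuous_on_fst continuous_on_component continuous_on_snd)

lemma has_derivative_polyfn:
  fixes z :: "complex^'k"
  assumes "polyfn C p"
  shows "((\<lambda>z. p (($) z)) has_derivative (\<lambda>h. \<Sum>k\<in>UNIV. pd k p (($) z) * h $ k)) (at z)"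
  using assms
proof (induction rule: polyfn.induct)
  case (var v)
  have "(\<Sum>k\<in>UNIV. pd k (\<lambda>x. x v) (($) z) * h $ k) = h $ v" for h :: "complex^'k"
    by (simp add: pd_var if_distrib[of "\<lambda>c. c * _"] cong: if_cong)
  then show ?case using bounded_linear_imp_has_derivative[OF bounded_linear_vec_nth[of v]] by simp
next
  case (add p q)
  have "(\<Sum>k\<in>UNIV. pd k (\<lambda>x. p x + q x) (($) z) * h $ k) =
      (\<Sum>k\<in>UNIV. pd k p (($) z) * h $ k) + (\<Sum>k\<in>UNIV. pd k q (($) z) * h $ k)" for h :: "complex^'k"
    by (simp add: pd_add[OF add(1,2)] distrib_right sum.distrib)
  then show ?case using has_derivative_add[OF add.IH] by simp
next
  case (mult p q)
  have "(\<Sum>k\<in>UNIV. pd k (\<lambda>x. p x * q x) (($) z) * h $ k) =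
      p (($) z) * (\<Sum>k\<in>UNIV. pd k q (($) z) * h $ k) + (\<Sum>k\<in>UNIV. pd k p (($) z) * h $ k) * q (($) z)"
    for h :: "complex^'k"
    by (simp add: pd_mult[OF mult(1,2)] sum_distrib_left sum_distrib_right flip: sum.distrib) (simp add: algebra_simps)
  then show ?case using has_derivative_mult[OF mult.IH] by simp
qed auto

lemma has_derivative_vec_lambda:
  fixes f :: "'a::euclidean_space \<Rightarrow> 'i::finite \<Rightarrow> 'b::euclidean_space"
  assumes "\<And>i. ((\<lambda>x. f x i) has_derivative (\<lambda>h. f' h i)) (at a)"
  shows "((\<lambda>x. \<chi> i. f x i) has_derivative (\<lambda>h. \<chi> i. f' h i)) (at a)"
  unfolding has_derivative_def
proof
  have "linear (\<lambda>h. f' h i)" for i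
    using has_derivative_bounded_linear[OF assms] by (rule bounded_linear.linear)
  then show "bounded_linear (\<lambda>h. \<chi> i. f' h i)"
    by (auto simp: linear_iff vec_eq_iff simp flip: linear_conv_bounded_linear)
  show "((\<lambda>y. ((\<chi> i. f y i) - (\<chi> i. f (Lim (at a) (\<lambda>x. x)) i) - (\<chi> i. f' (y - Lim (at a) (\<lambda>x. x)) i)) /\<^sub>R
      norm (y - Lim (at a) (\<lambda>x. x))) \<longlongrightarrow> 0) (at a)"
    using assms by (intro vec_tendstoI) (simp add: has_derivative_def)
qed

section \<open>Jacobians and the implicit function theorem\<close>

definition jac :: "('m::finite \<Rightarrow> ('m option \<Rightarrow> complex) \<Rightarrow> complex) \<Rightarrow> ('m option \<Rightarrow> complex) \<Rightarrow> complex^'m^'m" where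
  "jac G v = (\<chi> i j. pd (Some j) (G i) v)"

lemma polyfn_det_jac: "(\<And>i. polyfn C (G i)) \<Longrightarrow> polyfn C (\<lambda>v. det (jac G v))"
  unfolding jac_def by (intro polyfn_intros) (auto intro: polyfn_intros)

lemma det_nonzero_iff_kernel:
  fixes A :: "complex^'m^'m"
  shows "det A \<noteq> 0 \<longleftrightarrow> (\<forall>h. (\<forall>i. (\<Sum>j\<in>UNIV. A $ i $ j * h $ j) = 0) \<longrightarrow> h = 0)"
  unfolding invertible_det_nz[symmetric] invertible_left_inverse matrix_left_invertible_ker
  by (auto simp: matrix_vector_mult_def vec_eq_iff)

text \<open>The inverse function theorem is applied to the map sending (t, x) to (t, G(t, x)). It is
  a real theorem; holomorphy of the curve follows from complex linearity of the derivative. The open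
  set \<open>X\<close> records local uniqueness of the zero.\<close>

lemma implicit_curve:
  fixes G :: "'m::finite \<Rightarrow> ('m option \<Rightarrow> complex) \<Rightarrow> complex" and x0 :: "complex^'m"
  assumes G: "\<And>i. polyfn UNIV (G i)" and zero: "\<And>i. G i (pt t0 x0) = 0"
    and det: "det (jac G (pt t0 x0)) \<noteq> 0" and S: "open S" "x0 \<in> S"
  obtains T X \<xi> where "open T" "t0 \<in> T" "open X" "x0 \<in> X" "X \<subseteq> S" "\<xi> t0 = x0"
    "\<And>t. t \<in> T \<Longrightarrow> \<xi> t \<in> X" "\<And>t i. t \<in> T \<Longrightarrow> G i (pt t (\<xi> t)) = 0"
    "\<And>t x. t \<in> T \<Longrightarrow> x \<in> X \<Longrightarrow> (\<And>i. G i (pt t x) = 0) \<Longrightarrow> x = \<xi> t"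
    "\<And>i. (\<lambda>t. \<xi> t $ i) holomorphic_on T"
proof -
  define \<Phi> :: "complex^('m option) \<Rightarrow> complex^('m option)" where
    "\<Phi> = (\<lambda>v. \<chi> o'. case o' of None \<Rightarrow> v $ None | Some i \<Rightarrow> G i (($) v))"
  define D :: "complex^('m option) \<Rightarrow> complex^('m option) \<Rightarrow> complex^('m option)" where
    "D = (\<lambda>v h. \<chi> o'. case o' of None \<Rightarrow> h $ None | Some i \<Rightarrow> (\<Sum>k\<in>UNIV. pd k (G i) (($) v) * h $ k))"
  define v0 :: "complex^('m option)" where "v0 = (\<chi> o'. pt t0 x0 o')"
  have v0: "($) v0 = pt t0 x0" by (simp add: v0_def fun_eq_iff)
  have der: "(\<Phi> has_derivative D v) (at v)" for v
  proof -
    have "((\<lambda>v. case o' of None \<Rightarrow> v $ None | Some i \<Rightarrow> G i (($) v)) has_derivative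
       (\<lambda>h. case o' of None \<Rightarrow> h $ None | Some i \<Rightarrow> (\<Sum>k\<in>UNIV. pd k (G i) (($) v) * h $ k))) (at v)" for o'
      by (cases o') (auto intro: has_derivative_polyfn[OF G] bounded_linear_imp_has_derivative bounded_linear_vec_nth)
    then show ?thesis unfolding \<Phi>_def D_def by (rule has_derivative_vec_lambda)
  qed
  have bl: "bounded_linear (D v)" for v using der by (rule has_derivative_bounded_linear)
  \<comment> \<open>Complex homogeneity of the derivative passes to its inverse and later turns the
    real derivative of \<open>\<xi>\<close> into a complex one.\<close>
  have scale: "D v (\<chi> k. c * h $ k) = (\<chi> k. c * D v h $ k)" for v c h
    by (auto simp: D_def vec_eq_iff sum_distrib_left mult.left_commute split: option.splits)
  define D' where "D' = (\<lambda>v. Blinfun (D v))"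
  have D': "blinfun_apply (D' v) = D v" for v by (simp add: D'_def bounded_linear_Blinfun_apply bl)
  have cont: "continuous_on UNIV D'"
  proof (rule continuous_on_blinfun_componentwise)
    fix h :: "complex^('m option)"
    have "continuous_on UNIV (\<lambda>v. D v h)"
      unfolding D_def
    proof (rule continuous_on_vec_lambda)
      fix o' :: "'m option"
      show "continuous_on UNIV (\<lambda>v. case o' of None \<Rightarrow> h $ None | Some i \<Rightarrow> \<Sum>k\<in>UNIV. pd k (G i) (($) v) * h $ k)"
        by (cases o') (auto intro!: continuous_on_sum continuous_on_mult continuous_on_const
            continuous_on_polyfn[OF polyfn_pd[OF G]] continuous_on_component continuous_on_id)
    qed
    then show "continuous_on UNIV (\<lambda>v. blinfun_apply (D' v) h)" by (simp add: D')
  qed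
  have ker: "h = 0" if "D v0 h = 0" for h
  proof -
    have n: "h $ None = 0" using that by (auto simp: D_def vec_eq_iff split: option.splits)
    have "(\<Sum>j\<in>UNIV. jac G (pt t0 x0) $ i $ j * (\<chi> j. h $ Some j) $ j) = 0" for i
    proof -
      have "0 = D v0 h $ Some i" using that by simp
      also have "\<dots> = (\<Sum>k\<in>UNIV. pd k (G i) (pt t0 x0) * h $ k)" by (simp add: D_def v0)
      also have "\<dots> = (\<Sum>j\<in>UNIV. pd (Some j) (G i) (pt t0 x0) * h $ Some j)"
        using n by (simp add: UNIV_option_conv sum.reindex)
      finally show ?thesis by (simp add: jac_def)
    qed
    then have "(\<chi> j. h $ Some j) = 0" using det unfolding det_nonzero_iff_kernel by blast
    then show "h = 0" using n by (simp add: vec_eq_iff) (metis option.exhaust)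
  qed
  have "inj (D v0)"
    using ker bl[of v0] by (simp add: linear_injective_0 bounded_linear.linear)
  then obtain g where "linear g" "g \<circ> D v0 = id"
    using linear_injective_left_inverse[of "D v0"] bl[of v0] bounded_linear.linear by blast
  then have inv: "Blinfun g o\<^sub>L D' v0 = id_blinfun"
    by (intro blinfun_eqI) (simp add: D' bounded_linear_Blinfun_apply linear_conv_bounded_linear fun_eq_iff)
  define U where "U = {v::complex^('m option). (\<chi> i. v $ Some i) \<in> S}"
  have "open ((\<lambda>v::complex^('m option). \<chi> i. v $ Some i) -` S)"
    by (intro open_vimage[OF S(1)] continuous_on_vec_lambda continuous_on_component continuous_on_id)
  then have "open U" by (simp add: U_def vimage_def)
  have "v0 \<in> U" using S by (simp add: U_def v0_def)
  have der': "(\<Phi> has_derivative blinfun_apply (D' v)) (at v)" if "v \<in> U" for v using der by (simp add: D')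
  have cont': "continuous_on U D'" using cont by (rule continuous_on_subset) simp
  obtain U' V g g' where U': "open U'" "U' \<subseteq> U" "v0 \<in> U'" "open V" "\<Phi> v0 \<in> V" "homeomorphism U' V \<Phi> g"
    and g'_blinfun: "\<And>y. y \<in> V \<Longrightarrow> (g has_derivative (g' y)) (at y)"
    "\<And>y. y \<in> V \<Longrightarrow> g' y = Hilbert_Choice.inv (blinfun_apply (D' (g y)))"
    "\<And>y. y \<in> V \<Longrightarrow> bij (blinfun_apply (D' (g y)))"
    by (rule inverse_function_theorem[OF \<open>open U\<close> der' cont' \<open>v0 \<in> U\<close> inv]) (assumption, blast)
  note g' = g'_blinfun[unfolded D']
  \<comment> \<open>Zeros over \<open>t\<close> are exactly the points that \<open>\<Phi>\<close>
    sends to (t, 0), which is \<open>e t\<close>.\<close>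
  define e :: "complex \<Rightarrow> complex^('m option)" where "e = (\<lambda>t. \<chi> o'. case o' of None \<Rightarrow> t | Some _ \<Rightarrow> 0)"
  have e_der: "(e has_derivative e) (at t)" for t
  proof -
    have "linear e" by (auto simp: linear_iff e_def vec_eq_iff split: option.splits)
    then show ?thesis by (simp add: linear_imp_has_derivative)
  qed
  have e_cont: "continuous_on A e" for A
    using e_der by (meson has_derivative_at_withinI has_derivative_continuous_on)
  define \<xi> :: "complex \<Rightarrow> complex^'m" where "\<xi> = (\<lambda>t. \<chi> i. g (e t) $ Some i)"
  have \<Phi>_zero: "\<Phi> (\<chi> o'. pt t x o') = e t \<longleftrightarrow> (\<forall>i. G i (pt t x) = 0)" for t x
  proof -
    have "($) (\<chi> o'. pt t x o') = pt t x" by (simp add: fun_eq_iff)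
    then show ?thesis by (auto simp: \<Phi>_def e_def vec_eq_iff split: option.splits)
  qed
  have v0_eq: "v0 = (\<chi> o'. pt t0 x0 o')" by (simp add: v0_def)
  have \<Phi>v0: "\<Phi> v0 = e t0" unfolding v0_eq \<Phi>_zero using zero by simp
  have g\<Phi>: "g (\<Phi> v) = v" if "v \<in> U'" for v using U'(6) that by (auto simp: homeomorphism_def)
  have \<Phi>g: "\<Phi> (g y) = y" "g y \<in> U'" if "y \<in> V" for y using U'(6) that by (auto simp: homeomorphism_def)
  have g_pt: "g (e t) = (\<chi> o'. pt t (\<xi> t) o')" if "e t \<in> V" for t
  proof -
    have "g (e t) $ None = t"
      using \<Phi>g(1)[OF that] by (auto simp: \<Phi>_def e_def vec_eq_iff split: option.splits)
    then show ?thesis by (auto simp: vec_eq_iff \<xi>_def split: option.splits)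
  qed
  define h :: "complex \<times> (complex^'m) \<Rightarrow> complex^('m option)" where "h = (\<lambda>(t, x). \<chi> o'. pt t x o')"
  have "continuous_on UNIV h"
    unfolding h_def case_prod_beta
    by (intro continuous_on_vec_lambda continuous_on_pt_fst_snd)
  then have "open (h -` U')" using U'(1) by (rule open_vimage[rotated])
  moreover have "(t0, x0) \<in> h -` U'" using U'(3) by (simp add: h_def v0_eq)
  ultimately obtain A X where AX: "open A" "open X" "(t0, x0) \<in> A \<times> X" "A \<times> X \<subseteq> h -` U'"
    by (rule open_prod_elim)
  define T0 where "T0 = e -` V"
  have "open T0" unfolding T0_def by (rule open_vimage[OF U'(4) e_cont])
  have \<xi>_der: "((\<lambda>t. \<xi> t $ i) has_field_derivative g' (e t) (e 1) $ Some i) (at t)" if "t \<in> T0" for t i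
  proof -
    have V: "e t \<in> V" using that by (simp add: T0_def)
    have d: "((\<lambda>t. \<xi> t $ i) has_derivative (\<lambda>s. g' (e t) (e s) $ Some i)) (at t)"
      unfolding \<xi>_def using bounded_linear.has_derivative[OF bounded_linear_vec_nth
          has_derivative_compose[OF e_der g'(1)[OF V]], of "Some i"] by simp
    have lin: "g' (e t) (e s) = (\<chi> k. s * g' (e t) (e 1) $ k)" for s
    proof -
      let ?D = "D (g (e t))"
      have b: "bij ?D" using g'(3)[OF V] .
      have "?D (\<chi> k. s * g' (e t) (e 1) $ k) = (\<chi> k. s * e 1 $ k)"
        unfolding scale g'(2)[OF V] by (simp add: surj_f_inv_f bij_is_surj b)
      also have "\<dots> = e s" by (auto simp: e_def vec_eq_iff split: option.splits)
      finally have "Hilbert_Choice.inv ?D (e s) = (\<chi> k. s * g' (e t) (e 1) $ k)"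
        by (rule inv_f_eq[OF bij_is_inj[OF b]])
      with fun_cong[OF g'(2)[OF V], of "e s"] show ?thesis by (rule trans)
    qed
    have "(\<lambda>s. g' (e t) (e s) $ Some i) = (*) (g' (e t) (e 1) $ Some i)"
    proof
      show "g' (e t) (e s) $ Some i = g' (e t) (e 1) $ Some i * s" for s
        using arg_cong[OF lin[of s], of "\<lambda>v. v $ Some i"] by (simp only: vec_lambda_beta mult.commute)
    qed
    then show ?thesis using d by (simp add: has_field_derivative_def)
  qed
  have "continuous_on T0 (\<lambda>t. \<xi> t $ i)" for i
    using \<xi>_der by (meson DERIV_continuous_on has_field_derivative_at_within)
  then have "continuous_on T0 (\<lambda>t. \<chi> i. \<xi> t $ i)" by (rule continuous_on_vec_lambda)
  then have \<xi>_cont: "continuous_on T0 \<xi>" by simp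
  define T where "T = A \<inter> (T0 \<inter> \<xi> -` X)"
  have T0: "t0 \<in> T0" using U'(5) by (simp add: T0_def \<Phi>v0)
  have \<xi>t0: "\<xi> t0 = x0"
    using g\<Phi>[OF U'(3)] unfolding \<Phi>v0 \<xi>_def by (simp add: v0_def)
  show ?thesis
  proof (rule that[of T X \<xi>])
    show "open T" unfolding T_def
      using continuous_open_preimage[OF \<xi>_cont \<open>open T0\<close> AX(2)] AX(1) by blast
    show "t0 \<in> T" using AX(3) T0 \<xi>t0 by (simp add: T_def)
    show "open X" "x0 \<in> X" using AX by auto
    show "X \<subseteq> S"
    proof
      fix x assume "x \<in> X"
      then have "h (t0, x) \<in> U" using AX U'(2) by auto
      then show "x \<in> S" by (simp add: h_def U_def)
    qed
    show "\<xi> t0 = x0" by fact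
    fix t assume t: "t \<in> T"
    then have V: "e t \<in> V" by (simp add: T_def T0_def)
    show "\<xi> t \<in> X" using t by (simp add: T_def)
    show "G i (pt t (\<xi> t)) = 0" for i
      using \<Phi>g(1)[OF V] unfolding g_pt[OF V] \<Phi>_zero by blast
    fix x assume x: "x \<in> X" "\<And>i. G i (pt t x) = 0"
    have "h (t, x) \<in> U'" using t x AX by (auto simp: T_def)
    moreover have "\<Phi> (h (t, x)) = e t" unfolding h_def prod.case \<Phi>_zero using x by blast
    ultimately have "h (t, x) = g (e t)" using g\<Phi> by metis
    from arg_cong[OF this, of "\<lambda>v. v $ Some i" for i] have "x $ i = g (e t) $ Some i" for i
      by (simp add: h_def)
    then show "x = \<xi> t" by (simp add: \<xi>_def vec_eq_iff)
  next
    show "(\<lambda>t. \<xi> t $ i) holomorphic_on T" for i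
    proof (rule holomorphic_onI)
      fix t assume "t \<in> T"
      then have "t \<in> T0" by (simp add: T_def)
      from has_field_derivative_at_within[OF \<xi>_der[OF this, of i], of T]
      show "(\<lambda>t. \<xi> t $ i) field_differentiable at t within T"
        unfolding field_differentiable_def by blast
    qed
  qed
qed

section \<open>Persistence of isolated zeros\<close>

text \<open>Diagonal dominance in the sum norm of \<open>h\<close>: adding up the estimates of all
  rows bounds norm \<open>s\<close> times this norm by a smaller multiple of it. Rows with
  \<open>h $ i = 0\<close> are exempt from the equation, since in one application such a row carries
  an additional term.\<close>

lemma kernel_dominant_diagonal:
  fixes A :: "complex^'m^'m"
  assumes "(\<Sum>i\<in>UNIV. \<Sum>j\<in>UNIV. norm (A $ i $ j)) < norm s"
    and "\<And>i. h $ i \<noteq> 0 \<Longrightarrow> (\<Sum>j\<in>UNIV. A $ i $ j * h $ j) + s * h $ i = 0"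
  shows "h = 0"
proof (rule ccontr)
  assume "h \<noteq> 0"
  define H where "H = (\<Sum>i\<in>UNIV. norm (h $ i))"
  have "H > 0"
  proof -
    obtain i where "h $ i \<noteq> 0" using \<open>h \<noteq> 0\<close> by (auto simp: vec_eq_iff)
    then show ?thesis unfolding H_def by (intro sum_pos2[of UNIV i]) auto
  qed
  have le: "norm (h $ j) \<le> H" for j unfolding H_def by (rule member_le_sum) auto
  have "norm s * norm (h $ i) \<le> (\<Sum>j\<in>UNIV. norm (A $ i $ j)) * H" for i
  proof (cases "h $ i = 0")
    case False
    have "norm s * norm (h $ i) = norm (\<Sum>j\<in>UNIV. A $ i $ j * h $ j)"
      using assms(2)[OF False] by (metis add_eq_0_iff norm_minus_cancel norm_mult)
    also have "\<dots> \<le> (\<Sum>j\<in>UNIV. norm (A $ i $ j) * norm (h $ j))"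
      by (rule order_trans[OF norm_sum]) (simp add: norm_mult)
    also have "\<dots> \<le> (\<Sum>j\<in>UNIV. norm (A $ i $ j) * H)"
      by (intro sum_mono mult_left_mono le) auto
    finally show ?thesis by (simp add: sum_distrib_right)
  qed (use \<open>H > 0\<close> in \<open>auto intro!: mult_nonneg_nonneg sum_nonneg\<close>)
  then have "(\<Sum>i\<in>UNIV. norm s * norm (h $ i)) \<le> (\<Sum>i\<in>UNIV. (\<Sum>j\<in>UNIV. norm (A $ i $ j)) * H)"
    by (rule sum_mono)
  then have "norm s * H \<le> (\<Sum>i\<in>UNIV. \<Sum>j\<in>UNIV. norm (A $ i $ j)) * H"
    unfolding sum_distrib_left[symmetric] sum_distrib_right[symmetric] H_def[symmetric] .
  then show False using assms(1) \<open>H > 0\<close> by simp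
qed

text \<open>The determinant is a polynomial in \<open>s\<close>, nonzero for a large
  \<open>s\<close> by diagonal dominance, so its roots are finite in number and do not fill a ball
  around 0.\<close>

lemma det_shift_nonzero:
  fixes A :: "complex^'m^'m"
  assumes "e > 0"
  obtains s :: complex where "s \<noteq> 0" "norm s < e" "det (\<chi> i j. A $ i $ j + (if i = j then s else 0)) \<noteq> 0"
proof -
  let ?d = "\<lambda>s. det (\<chi> i j. A $ i $ j + (if i = j then s else 0))"
  have "polyfn UNIV (\<lambda>v::unit \<Rightarrow> complex. ?d (v ()))"
    by (intro polyfn_intros) (auto intro!: polyfn_intros)
  from polyfn_poly_family[OF this, of "()"] obtain F where "\<forall>x s. ?d ((x(() := s)) ()) = poly (F x) s"
    by blast
  then obtain P where P: "\<And>s. ?d s = poly P s" unfolding fun_upd_same by blast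
  define B where "B = (\<Sum>i\<in>UNIV. \<Sum>j\<in>UNIV. norm (A $ i $ j)) + 1"
  have "B > 0" unfolding B_def by (intro add_nonneg_pos sum_nonneg) auto
  have "?d (of_real B) \<noteq> 0"
    unfolding det_nonzero_iff_kernel
  proof (intro allI impI)
    fix h :: "complex^'m"
    assume h: "\<forall>i. (\<Sum>j\<in>UNIV. (\<chi> i j. A $ i $ j + (if i = j then of_real B else 0)) $ i $ j * h $ j) = 0"
    show "h = 0"
    proof (rule kernel_dominant_diagonal)
      show "(\<Sum>i\<in>UNIV. \<Sum>j\<in>UNIV. norm (A $ i $ j)) < norm (of_real B :: complex)"
      proof -
        have "(\<Sum>i\<in>UNIV. \<Sum>j\<in>UNIV. norm (A $ i $ j)) < B" by (simp add: B_def)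
        then show ?thesis using \<open>B > 0\<close> by simp
      qed
      fix i
      have "(\<Sum>j\<in>UNIV. (A $ i $ j + (if i = j then of_real B else 0)) * h $ j) =
          (\<Sum>j\<in>UNIV. A $ i $ j * h $ j) + of_real B * h $ i"
        by (simp add: distrib_right sum.distrib if_distrib[of "\<lambda>c. c * _"] cong: if_cong)
      then show "(\<Sum>j\<in>UNIV. A $ i $ j * h $ j) + of_real B * h $ i = 0" using h by simp
    qed
  qed
  then have "P \<noteq> 0" using P by force
  then have "finite (insert 0 {s. poly P s = 0})" using poly_roots_finite by simp
  moreover have "infinite (ball (0::complex) e)"
    using assms uncountable_ball uncountable_infinite by blast
  ultimately have "\<not> ball 0 e \<subseteq> insert 0 {s. poly P s = 0}" using finite_subset by blast
  then obtain s where "s \<in> ball 0 e" "s \<noteq> 0" "poly P s \<noteq> 0" by blast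
  then show ?thesis using P by (intro that[of s]) auto
qed

lemma compact_zeros:
  fixes G :: "'m::finite \<Rightarrow> ('m option \<Rightarrow> complex) \<Rightarrow> complex"
  assumes G: "\<And>i. polyfn UNIV (G i)" and "compact A" "compact B"
  shows "compact {(t, x). t \<in> A \<and> x \<in> B \<and> (\<forall>i. G i (pt t x) = 0)}"
proof -
  have "closed {tx. \<forall>i. G i (pt (fst tx) (snd tx)) = 0}"
    by (intro closed_Collect_all closed_Collect_eq continuous_on_polyfn[OF G] continuous_on_const
      continuous_on_pt_fst_snd)
  moreover have "{(t, x). t \<in> A \<and> x \<in> B \<and> (\<forall>i. G i (pt t x) = 0)} =
      A \<times> B \<inter> {tx. \<forall>i. G i (pt (fst tx) (snd tx)) = 0}" by auto
  ultimately show ?thesis using assms(2,3) by (simp add: compact_Int_closed compact_Times)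
qed

lemma continuous_on_pt:
  assumes "polyfn UNIV p"
  shows "continuous_on S (\<lambda>(t, x). p (pt t x))"
  unfolding case_prod_beta
  by (rule continuous_on_polyfn[OF assms continuous_on_pt_fst_snd])

text \<open>The absolute value of the Jacobian determinant, divided by \<open>\<bar>\<theta> - 1\<bar> ^ k\<close>, obeys the maximum principle
  along the zero set, so at \<open>(0, x0)\<close> it is at most its maximum over \<open>\<bar>\<theta> - 1\<bar> = 2\<close>; for large \<open>k\<close>
  this forces the determinant to vanish.\<close>

lemma zero_continues:
  fixes K :: "'m::finite \<Rightarrow> ('m option \<Rightarrow> complex) \<Rightarrow> complex" and x0 :: "complex^'m"
  assumes K: "\<And>i. polyfn UNIV (K i)" and zero: "\<And>i. K i (pt 0 x0) = 0" and "r > 0"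
    and det: "det (jac K (pt 0 x0)) \<noteq> 0"
    and sphere: "\<And>\<theta> x. norm (\<theta> - 1) \<le> 2 \<Longrightarrow> x \<in> sphere x0 r \<Longrightarrow> \<exists>i. K i (pt \<theta> x) \<noteq> 0"
  shows "\<exists>x\<in>ball x0 r. \<forall>i. K i (pt 1 x) = 0"
proof (rule ccontr)
  assume contra: "\<not> ?thesis"
  define Z where "Z = {(\<theta>, x). \<theta> \<in> cball 1 2 \<and> x \<in> cball x0 r \<and> (\<forall>i. K i (pt \<theta> x) = 0)}"
  have "compact Z" unfolding Z_def by (rule compact_zeros[OF K]) auto
  have Z_ball: "x \<in> ball x0 r" if "(\<theta>, x) \<in> Z" for \<theta> x
  proof -
    have "x \<notin> sphere x0 r" using sphere[of \<theta> x] that by (auto simp: Z_def dist_norm norm_minus_commute)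
    then show ?thesis using that by (auto simp: Z_def)
  qed
  \<comment> \<open>Denying the conclusion keeps \<open>Z\<close> away from the parameter 1, which
    is what permits division by powers of \<theta> - 1.\<close>
  have Z1: "\<theta> \<noteq> 1" if "(\<theta>, x) \<in> Z" for \<theta> x
    using contra Z_ball[OF that] that by (auto simp: Z_def)
  have Z0: "(0, x0) \<in> Z" using zero \<open>r > 0\<close> by (simp add: Z_def)
  define J where "J = (\<lambda>(\<theta>, x). norm (det (jac K (pt \<theta> x))))"
  have contJ: "continuous_on S J" for S
    using continuous_on_norm[OF continuous_on_pt[OF polyfn_det_jac[OF K], of S]]
    by (simp add: J_def case_prod_beta)
  obtain C where C: "\<And>z. z \<in> Z \<Longrightarrow> J z \<le> C"
    using continuous_attains_sup[OF \<open>compact Z\<close> _ contJ] Z0 by (metis empty_iff)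
  have J0: "J (0, x0) > 0" using det by (simp add: J_def)
  have main: "J (0, x0) * 2 ^ k \<le> C" for k
  proof -
    define \<Phi> where "\<Phi> = (\<lambda>z. J z / norm (fst z - 1) ^ k)"
    have nz: "norm (fst z - 1) ^ k \<noteq> 0" if "z \<in> Z" for z
      using Z1[of "fst z" "snd z"] that by simp
    have cont\<Phi>: "continuous_on Z \<Phi>" unfolding \<Phi>_def
      by (intro continuous_on_divide contJ) (use nz in \<open>auto intro!: continuous_intros\<close>)
    obtain m where m: "m \<in> Z" "\<And>z. z \<in> Z \<Longrightarrow> \<Phi> z \<le> \<Phi> m"
      using continuous_attains_sup[OF \<open>compact Z\<close> _ cont\<Phi>] Z0 by (metis empty_iff)
    \<comment> \<open>Among the maximisers of \<open>\<Phi>\<close> one farthest from 1 is selected.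
      If it lay inside the disc, the maximum principle would make \<open>\<Phi>\<close> constant
      along the curve through it, and a small radial step away from 1 would give a farther
      maximiser.\<close>
    define M where "M = Z \<inter> \<Phi> -` {\<Phi> m}"
    have "closed M" unfolding M_def
      by (rule continuous_closed_preimage[OF cont\<Phi> compact_imp_closed[OF \<open>compact Z\<close>] closed_singleton])
    then have "compact (Z \<inter> M)" by (rule compact_Int_closed[OF \<open>compact Z\<close>])
    then have "compact M" by (simp add: M_def)
    moreover have "m \<in> M" using m by (simp add: M_def)
    moreover have "continuous_on M (\<lambda>z. norm (fst z - 1))" by (intro continuous_intros)
    ultimately obtain z where z: "z \<in> M" "\<And>y. y \<in> M \<Longrightarrow> norm (fst y - 1) \<le> norm (fst z - 1)"
      using continuous_attains_sup[of M "\<lambda>z. norm (fst z - 1)"] by blast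
    obtain \<theta> x where zeq: "z = (\<theta>, x)" by (cases z)
    have zZ: "(\<theta>, x) \<in> Z" and \<Phi>z: "\<Phi> (\<theta>, x) = \<Phi> m" using z(1) by (auto simp: M_def zeq)
    have "\<Phi> (0, x0) \<le> \<Phi> (\<theta>, x)" using m(2)[OF Z0] \<Phi>z by simp
    then have le: "J (0, x0) \<le> \<Phi> (\<theta>, x)" by (simp add: \<Phi>_def)
    have "norm (\<theta> - 1) = 2"
    proof (rule ccontr)
      assume "norm (\<theta> - 1) \<noteq> 2"
      then have lt: "norm (\<theta> - 1) < 2" using zZ by (auto simp: Z_def dist_norm norm_minus_commute)
      have zero': "\<And>i. K i (pt \<theta> x) = 0" using zZ by (simp add: Z_def)
      have det': "det (jac K (pt \<theta> x)) \<noteq> 0"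
        using J0 le by (auto simp: \<Phi>_def J_def)
      obtain T X \<xi> where
        T: "open T" "\<theta> \<in> T" "open X" "x \<in> X" "X \<subseteq> ball x0 r" "\<xi> \<theta> = x" "\<And>t. t \<in> T \<Longrightarrow> \<xi> t \<in> X"
        "\<And>t i. t \<in> T \<Longrightarrow> K i (pt t (\<xi> t)) = 0"
        "\<And>t x. t \<in> T \<Longrightarrow> x \<in> X \<Longrightarrow> (\<And>i. K i (pt t x) = 0) \<Longrightarrow> x = \<xi> t"
        "\<And>i. (\<lambda>t. \<xi> t $ i) holomorphic_on T"
        using implicit_curve[OF K zero' det' open_ball Z_ball[OF zZ]] by blast
      have "open (T \<inter> (ball 1 2 - {1}))" using T(1) by (intro open_Int open_Diff) auto
      moreover have "\<theta> \<in> T \<inter> (ball 1 2 - {1})"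
        using T(2) lt Z1[OF zZ] by (auto simp: dist_norm norm_minus_commute)
      ultimately obtain e where e: "e > 0" "ball \<theta> e \<subseteq> T \<inter> (ball 1 2 - {1})"
        by (meson open_contains_ball)
      define \<psi> where "\<psi> = (\<lambda>t. det (jac K (pt t (\<xi> t))) / (t - 1) ^ k)"
      have "(\<lambda>t. det (jac K (pt t (\<xi> t)))) holomorphic_on ball \<theta> e"
      proof (rule holomorphic_on_polyfn[OF polyfn_det_jac[OF K]])
        fix v show "(\<lambda>t. pt t (\<xi> t) v) holomorphic_on ball \<theta> e"
          using holomorphic_on_subset[OF T(10)] e(2) by (cases v) auto
      qed
      then have "\<psi> holomorphic_on ball \<theta> e" unfolding \<psi>_def
        using e(2) by (intro holomorphic_intros) auto
      have inZ: "(t, \<xi> t) \<in> Z" if "t \<in> ball \<theta> e" for t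
      proof -
        have "t \<in> T" "t \<in> ball 1 2" using e(2) that by auto
        then show ?thesis using T(5) T(7)[of t] T(8)[of t] by (auto simp: Z_def)
      qed
      have n\<psi>: "norm (\<psi> t) = \<Phi> (t, \<xi> t)" for t
        by (simp add: \<psi>_def \<Phi>_def J_def norm_divide norm_power)
      have "\<psi> constant_on ball \<theta> e"
      proof (rule maximum_modulus_principle[where U = "ball \<theta> e" and \<xi> = \<theta>, OF \<open>\<psi> holomorphic_on _\<close>])
        show "norm (\<psi> t) \<le> norm (\<psi> \<theta>)" if "t \<in> ball \<theta> e" for t
          using m(2)[OF inZ[OF that]] \<Phi>z T(6) by (simp add: n\<psi>)
      qed (use e in auto)
      then have const: "\<Phi> (t, \<xi> t) = \<Phi> m" if "t \<in> ball \<theta> e" for t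
        using that e(1) \<Phi>z T(6) n\<psi> unfolding constant_on_def by (metis centre_in_ball)
      define t where "t = \<theta> + of_real (e / 2 / norm (\<theta> - 1)) * (\<theta> - 1)"
      have n1: "norm (\<theta> - 1) > 0" using Z1[OF zZ] by simp
      have "dist \<theta> t = e / 2" using n1 e(1) by (simp add: t_def dist_norm norm_mult norm_divide)
      then have t: "t \<in> ball \<theta> e" using e(1) by simp
      have "t - 1 = of_real (1 + e / 2 / norm (\<theta> - 1)) * (\<theta> - 1)" by (simp add: t_def algebra_simps)
      then have "norm (t - 1) = norm (of_real (1 + e / 2 / norm (\<theta> - 1)) :: complex) * norm (\<theta> - 1)"
        by (simp only: norm_mult)
      also have "\<dots> = (1 + e / 2 / norm (\<theta> - 1)) * norm (\<theta> - 1)"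
        unfolding norm_of_real using e(1) n1 by simp
      also have "\<dots> = norm (\<theta> - 1) + e / 2" using n1 by (simp add: field_simps)
      finally have "norm (t - 1) > norm (\<theta> - 1)" using e(1) by simp
      moreover have "(t, \<xi> t) \<in> M" using inZ[OF t] const[OF t] by (simp add: M_def)
      ultimately show False using z(2)[of "(t, \<xi> t)"] by (simp add: zeq)
    qed
    then have "J (0, x0) \<le> J (\<theta>, x) / 2 ^ k" using le by (simp add: \<Phi>_def)
    then show ?thesis using C[OF zZ] by (simp add: field_simps)
  qed
  obtain k where "C / J (0, x0) < 2 ^ k" using real_arch_pow[of 2 "C / J (0, x0)"] by auto
  then show False using main[of k] J0 by (simp add: field_simps)
qed

text \<open>\<open>x0\<close> may be degenerate, so a small multiple of x - x0 is first added to
  make the Jacobian invertible there. A linear homotopy then leads to the system at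
  \<open>t\<close>. No zero crosses the sphere: the norm of the original system is at least 6
  \<delta> on it, and the homotopy alters it by at most 4 \<delta>.\<close>

lemma isolated_zero_persists:
  fixes G :: "'m::finite \<Rightarrow> ('m option \<Rightarrow> complex) \<Rightarrow> complex" and x0 :: "complex^'m"
  assumes G: "\<And>i. polyfn UNIV (G i)" and zero: "\<And>i. G i (pt t0 x0) = 0" and "r > 0"
    and isolated: "\<And>x. x \<in> cball x0 r \<Longrightarrow> (\<And>i. G i (pt t0 x) = 0) \<Longrightarrow> x = x0"
  shows "\<forall>\<^sub>F t in nhds t0. \<exists>x\<in>ball x0 r. \<forall>i. G i (pt t x) = 0"
proof -
  define g :: "complex \<times> (complex^'m) \<Rightarrow> complex^'m" where "g = (\<lambda>(t, x). \<chi> i. G i (pt t x))"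
  have cont: "continuous_on S g" for S
    using continuous_on_vec_lambda[OF continuous_on_pt[OF G], of S] by (simp add: g_def case_prod_beta)
  have g_0: "g (t, x) = 0 \<longleftrightarrow> (\<forall>i. G i (pt t x) = 0)" for t x by (simp add: g_def vec_eq_iff)
  have "\<exists>\<delta>>0. \<forall>x\<in>sphere x0 r. 6 * \<delta> \<le> norm (g (t0, x))"
  proof (cases "sphere x0 r = {}")
    case False
    have "continuous_on (sphere x0 r) (\<lambda>x. norm (g (t0, x)))"
      by (intro continuous_on_norm continuous_on_compose2[OF cont[of UNIV]]) (auto intro: continuous_intros)
    from continuous_attains_inf[OF compact_sphere False this] obtain y where
      y: "y \<in> sphere x0 r" "\<And>x. x \<in> sphere x0 r \<Longrightarrow> norm (g (t0, y)) \<le> norm (g (t0, x))" by blast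
    have "\<not> (\<forall>i. G i (pt t0 y) = 0)"
    proof
      assume "\<forall>i. G i (pt t0 y) = 0"
      then show False using isolated[of y] y(1) \<open>r > 0\<close> by simp
    qed
    then have "g (t0, y) \<noteq> 0" by (simp add: g_0)
    then show ?thesis using y(2) by (intro exI[of _ "norm (g (t0, y)) / 6"]) auto
  qed (auto intro: exI[of _ 1])
  then obtain \<delta> where \<delta>: "\<delta> > 0" "\<And>x. x \<in> sphere x0 r \<Longrightarrow> 6 * \<delta> \<le> norm (g (t0, x))" by blast
  have "uniformly_continuous_on (cball t0 1 \<times> cball x0 r) g"
    by (intro compact_uniformly_continuous cont compact_Times) auto
  then obtain \<rho> where \<rho>: "\<rho> > 0" "\<And>y z. y \<in> cball t0 1 \<times> cball x0 r \<Longrightarrow> z \<in> cball t0 1 \<times> cball x0 r \<Longrightarrow>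
      dist z y < \<rho> \<Longrightarrow> dist (g z) (g y) < \<delta>"
    using \<delta>(1) unfolding uniformly_continuous_on_def by meson
  \<comment> \<open>For norm (\<theta> - 1) at most 2 the shift then contributes at most \<delta> on
    the sphere of radius \<open>r\<close>.\<close>
  obtain s where s: "s \<noteq> 0" "norm s < \<delta> / (2 * r)"
    "det (\<chi> i j. jac G (pt t0 x0) $ i $ j + (if i = j then s else 0)) \<noteq> 0"
    using det_shift_nonzero[of "\<delta> / (2 * r)"] \<delta>(1) \<open>r > 0\<close> by auto
  have "\<exists>x\<in>ball x0 r. \<forall>i. G i (pt t x) = 0" if t: "dist t t0 < min \<rho> 1" for t
  proof -
    define G' where "G' = (\<lambda>c i (v :: 'm option \<Rightarrow> complex). G i (case_option c (\<lambda>j. v (Some j))))"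
    have G': "polyfn UNIV (G' c i)" for c i unfolding G'_def
    proof (rule polyfn_subst[OF G])
      show "polyfn UNIV (\<lambda>w. case_option c (\<lambda>j. w (Some j)) v)" for v
        by (cases v) (auto intro: polyfn_intros)
    qed
    \<comment> \<open>At parameter 0 this is the shifted system at \<open>t0\<close>, at parameter 1
      the system at \<open>t\<close>. Since norm \<theta> is at most 3, replacing \<open>t0\<close>
      by \<open>t\<close> costs at most 3 \<delta>.\<close>
    define K where "K = (\<lambda>i (v :: 'm option \<Rightarrow> complex).
      (1 - v None) * (G' t0 i v + s * (v (Some i) - x0 $ i)) + v None * G' t i v)"
    have K: "polyfn UNIV (K i)" for i
      unfolding K_def by (intro polyfn_intros G')
    have K_pt: "K i (pt \<theta> x) = (1 - \<theta>) * (G i (pt t0 x) + s * (x $ i - x0 $ i)) + \<theta> * G i (pt t x)" for i \<theta> x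
      by (simp add: K_def G'_def)
    have pdG': "pd (Some j) (G' c i) (pt 0 x0) = pd (Some j) (G i) (pt c x0)" for c i j
    proof -
      have "case_option c (\<lambda>k. ((pt 0 x0)(Some j := z)) (Some k)) = (pt c x0)(Some j := z)" for z
        by (auto simp: fun_eq_iff split: option.splits)
      then show ?thesis by (simp add: pd_def G'_def)
    qed
    have pdK: "pd (Some j) (K i) (pt 0 x0) = pd (Some j) (G i) (pt t0 x0) + (if i = j then s else 0)" for i j
    proof (rule pd_eqI)
      have 1: "((\<lambda>z. G' c i ((pt 0 x0)(Some j := z))) has_field_derivative pd (Some j) (G i) (pt c x0)) (at (pt 0 x0 (Some j)))" for c
        using DERIV_pd'[OF G', of c i "pt 0 x0" "Some j"] by (simp add: pdG')
      have 2: "((\<lambda>z. s * (((pt 0 x0)(Some j := z)) (Some i) - x0 $ i)) has_field_derivative (if i = j then s else 0)) (at (pt 0 x0 (Some j)))"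
        by (cases "i = j") (auto intro!: derivative_eq_intros)
      show "((\<lambda>z. K i ((pt 0 x0)(Some j := z))) has_field_derivative
          pd (Some j) (G i) (pt t0 x0) + (if i = j then s else 0)) (at (pt 0 x0 (Some j)))"
        unfolding K_def using DERIV_add[OF 1[of t0] 2] by simp
    qed
    have "\<exists>x\<in>ball x0 r. \<forall>i. K i (pt 1 x) = 0"
    proof (rule zero_continues[OF K _ \<open>r > 0\<close>])
      show "K i (pt 0 x0) = 0" for i using zero by (simp add: K_pt)
      show "det (jac K (pt 0 x0)) \<noteq> 0" using s(3) by (simp add: jac_def pdK)
      fix \<theta> :: complex and x :: "complex^'m"
      assume \<theta>: "norm (\<theta> - 1) \<le> 2" and x: "x \<in> sphere x0 r"
      show "\<exists>i. K i (pt \<theta> x) \<noteq> 0"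
      proof (rule ccontr)
        have nv: "norm (\<chi> i. c * y $ i) = norm c * norm y" for c and y :: "complex^'m"
          unfolding norm_vec_def L2_set_def by (simp add: norm_mult power_mult_distrib real_sqrt_mult flip: sum_distrib_left)
        assume "\<not> ?thesis"
        then have "g (t0, x) + (\<chi> i. (1 - \<theta>) * s * (x - x0) $ i) + (\<chi> i. \<theta> * (g (t, x) - g (t0, x)) $ i) = 0"
          by (simp add: vec_eq_iff g_def K_pt algebra_simps)
        then have "norm (g (t0, x)) = norm ((\<chi> i. (1 - \<theta>) * s * (x - x0) $ i) + (\<chi> i. \<theta> * (g (t, x) - g (t0, x)) $ i))"
          unfolding add.assoc by (metis add_eq_0_iff norm_minus_cancel)
        also have "\<dots> \<le> norm (\<chi> i. (1 - \<theta>) * s * (x - x0) $ i) + norm (\<chi> i. \<theta> * (g (t, x) - g (t0, x)) $ i)"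
          by (rule norm_triangle_ineq)
        also have "\<dots> = norm ((1 - \<theta>) * s) * norm (x - x0) + norm \<theta> * norm (g (t, x) - g (t0, x))"
          unfolding nv ..
        also have "\<dots> \<le> (2 * (\<delta> / (2 * r))) * r + 3 * \<delta>"
        proof (intro add_mono mult_mono)
          show "norm ((1 - \<theta>) * s) \<le> 2 * (\<delta> / (2 * r))"
            unfolding norm_mult using \<theta> s(2) by (intro mult_mono) (auto simp: norm_minus_commute)
          show "norm (x - x0) \<le> r" using x by (simp add: dist_norm norm_minus_commute)
          show "norm \<theta> \<le> 3" using \<theta> norm_triangle_ineq[of "\<theta> - 1" 1] by simp
          have "dist (g (t, x)) (g (t0, x)) < \<delta>"
            using x t \<open>r > 0\<close> by (intro \<rho>(2)) (auto simp: dist_Pair_Pair dist_commute)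
          then show "norm (g (t, x) - g (t0, x)) \<le> \<delta>" by (simp add: dist_norm)
        qed (use \<delta>(1) \<open>r > 0\<close> in auto)
        also have "\<dots> = 4 * \<delta>" using \<open>r > 0\<close> by simp
        finally show False using \<delta>(2)[OF x] \<delta>(1) by simp
      qed
    qed
    then show ?thesis by (simp add: K_pt)
  qed
  then show ?thesis unfolding eventually_nhds_metric
    using \<rho>(1) by (intro exI[of _ "min \<rho> 1"]) auto
qed

section \<open>Counting the zeros of a family of multiprojective systems\<close>

text \<open>Homogeneous coordinates of a point of \<open>(P\<^sup>1)\<^sup>n\<close>, normalised so that in each factor the larger
  one is 1.\<close>

definition proj_chart :: "((complex^'n) \<times> (complex^'n)) set" where
  "proj_chart = {pq. \<forall>j. norm (fst pq $ j) \<le> 1 \<and> norm (snd pq $ j) \<le> 1 \<and> (fst pq $ j = 1 \<or> snd pq $ j = 1)}"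

lemma compact_proj_chart: "compact (proj_chart :: ((complex^'n::finite) \<times> (complex^'n)) set)"
proof (rule compact_Int_closed[of "cball 0 (real CARD('n)) \<times> cball 0 (real CARD('n))" proj_chart, THEN back_subst[of compact]])
  have "norm x \<le> real CARD('n)" if "\<And>j. norm (x $ j) \<le> 1" for x :: "complex^'n"
  proof -
    have "norm x \<le> (\<Sum>j\<in>UNIV. norm (x $ j))"
      unfolding norm_vec_def by (rule L2_set_le_sum) auto
    also have "\<dots> \<le> (\<Sum>j\<in>(UNIV :: 'n set). 1)" by (rule sum_mono) (rule that)
    finally show ?thesis by simp
  qed
  then show "cball 0 (real CARD('n)) \<times> cball 0 (real CARD('n)) \<inter> proj_chart = (proj_chart :: ((complex^'n) \<times> (complex^'n)) set)"
    by (auto simp: proj_chart_def)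
  have c: "continuous_on UNIV (\<lambda>pq::(complex^'n) \<times> (complex^'n). fst pq $ j)"
    "continuous_on UNIV (\<lambda>pq::(complex^'n) \<times> (complex^'n). snd pq $ j)" for j
    by (intro continuous_on_component continuous_on_fst continuous_on_snd continuous_on_id)+
  show "closed (proj_chart :: ((complex^'n) \<times> (complex^'n)) set)"
    unfolding proj_chart_def
    by (intro closed_Collect_all closed_Collect_conj closed_Collect_disj closed_Collect_le closed_Collect_eq
        continuous_on_norm continuous_on_const c)
qed (intro compact_Times compact_cball)

lemma proj_chart_normalize:
  fixes p q :: "'n::finite \<Rightarrow> complex"
  assumes "\<And>j. p j \<noteq> 0 \<or> q j \<noteq> 0"
  obtains s where "\<And>j. s j \<noteq> 0" "(\<chi> j. s j * p j, \<chi> j. s j * q j) \<in> proj_chart"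
proof
  let ?s = "\<lambda>j. if norm (p j) \<le> norm (q j) then 1 / q j else 1 / p j"
  show s: "?s j \<noteq> 0" for j using assms[of j] by auto
  show "(\<chi> j. ?s j * p j, \<chi> j. ?s j * q j) \<in> proj_chart"
    using s assms by (auto simp: proj_chart_def norm_divide field_simps)
qed

lemma proj_chart_nonzero: "(p, q) \<in> proj_chart \<Longrightarrow> p $ j \<noteq> 0 \<or> q $ j \<noteq> 0"
  by (auto simp: proj_chart_def dest: spec[of _ j])

lemma proj_chart_subseq:
  fixes y :: "nat \<Rightarrow> (complex^'n::finite) \<times> (complex^'n)"
  assumes "\<And>k. y k \<in> proj_chart"
  obtains r p q where "strict_mono (r :: nat \<Rightarrow> nat)" "(p, q) \<in> proj_chart"
    "(\<lambda>k. fst (y (r k))) \<longlonglongrightarrow> p" "(\<lambda>k. snd (y (r k))) \<longlonglongrightarrow> q"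
proof -
  obtain l r where l: "l \<in> proj_chart" "strict_mono (r :: nat \<Rightarrow> nat)" "(y \<circ> r) \<longlonglongrightarrow> l"
    using compact_imp_seq_compact[OF compact_proj_chart] assms unfolding seq_compact_def by metis
  show ?thesis
    using that[of r "fst l" "snd l"] l tendsto_fst[OF l(3)] tendsto_snd[OF l(3)] by (simp add: o_def)
qed

lemma proj_chart_affine:
  fixes x :: "complex^'n::finite"
  obtains p q where "(p, q) \<in> proj_chart" "\<And>j. q $ j \<noteq> 0" "\<And>j. x $ j = p $ j / q $ j"
proof -
  obtain s where s: "\<And>j. s j \<noteq> 0" "(\<chi> j. s j * x $ j, \<chi> j. s j * 1) \<in> proj_chart"
    using proj_chart_normalize[of "($) x" "\<lambda>_. 1"] by auto
  then show ?thesis by (intro that[of "\<chi> j. s j * x $ j" "\<chi> j. s j * 1"]) auto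
qed

lemma not_eventually_nhds_sequence:
  fixes t0 :: "'a::metric_space"
  assumes "\<not> (\<forall>\<^sub>F t in nhds t0. P t)"
  obtains \<tau> where "\<tau> \<longlonglongrightarrow> t0" "\<And>k. \<not> P (\<tau> k)"
proof -
  have "\<exists>t. dist t t0 < inverse (real (Suc k)) \<and> \<not> P t" for k
    using assms unfolding eventually_nhds_metric by (metis inverse_positive_iff_positive of_nat_0_less_iff zero_less_Suc)
  then obtain \<tau> where \<tau>: "\<And>k. dist (\<tau> k) t0 < inverse (real (Suc k))" "\<And>k. \<not> P (\<tau> k)" by metis
  have "(\<lambda>k. dist (\<tau> k) t0) \<longlonglongrightarrow> 0"
    by (rule tendsto_sandwich[OF _ _ tendsto_const LIMSEQ_inverse_real_of_nat])
      (use \<tau>(1) in \<open>auto intro!: always_eventually less_imp_le\<close>)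
  then show ?thesis using that \<tau>(2) tendsto_dist_iff by blast
qed

lemma finite_separated:
  fixes S :: "'a::metric_space set"
  assumes "finite S"
  obtains e where "e > 0" "\<And>x y. x \<in> S \<Longrightarrow> y \<in> S \<Longrightarrow> x \<noteq> y \<Longrightarrow> 2 * e \<le> dist x y"
proof -
  have "\<exists>d>0. \<forall>y\<in>S. y \<noteq> x \<longrightarrow> d \<le> dist x y" for x
    using finite_set_avoid[OF assms, of x] by auto
  then obtain d where d: "\<And>x. d x > 0" "\<And>x y. y \<in> S \<Longrightarrow> y \<noteq> x \<Longrightarrow> d x \<le> dist x y" by metis
  let ?e = "Min (insert 1 (d ` S)) / 2"
  have "?e > 0" using assms d(1) by (simp add: Min_gr_iff)
  moreover have "2 * ?e \<le> dist x y" if "x \<in> S" "y \<in> S" "x \<noteq> y" for x y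
  proof -
    have "2 * ?e \<le> d x" using assms that(1) by simp
    also have "\<dots> \<le> dist x y" using d(2)[OF that(2)] that(3) by auto
    finally show ?thesis .
  qed
  ultimately show ?thesis using that by blast
qed

lemma card_le_near:
  fixes S Z :: "'a::metric_space set"
  assumes "finite Z" and sep: "\<And>x y. x \<in> S \<Longrightarrow> y \<in> S \<Longrightarrow> x \<noteq> y \<Longrightarrow> 2 * e \<le> dist x y"
    and near: "\<And>x. x \<in> S \<Longrightarrow> \<exists>z\<in>Z. dist x z < e"
  shows "card S \<le> card Z"
proof -
  obtain g where g: "\<And>x. x \<in> S \<Longrightarrow> g x \<in> Z \<and> dist x (g x) < e" using near by metis
  have "inj_on g S"
  proof (rule inj_onI, rule ccontr)
    fix x y assume xy: "x \<in> S" "y \<in> S" "g x = g y" "x \<noteq> y"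
    have "dist x y < 2 * e" using dist_triangle2[of x y "g x"] g[OF xy(1)] g[OF xy(2)] xy(3) by simp
    then show False using sep[OF xy(1,2,4)] by simp
  qed
  then show ?thesis using g assms(1) by (intro card_inj_on_le[of g]) auto
qed

section \<open>Good parameters and constancy of the number of zeros\<close>

text \<open>Multihomogeneity is expressed as invariance of the zeros under rescaling each pair
  \<open>(p j, q j)\<close>, which makes them well defined on the product of projective lines. In
  the joint variables, \<open>True\<close> marks \<open>p\<close> and \<open>False\<close> marks
  \<open>q\<close>.\<close>

locale multiprojective_family =
  fixes Hh :: "'n::finite \<Rightarrow> complex \<Rightarrow> ('n \<Rightarrow> complex) \<Rightarrow> ('n \<Rightarrow> complex) \<Rightarrow> complex"
  assumes polyfn_Hh: "\<And>i. polyfn UNIV (\<lambda>v. Hh i (v None) (\<lambda>j. v (Some (j, True))) (\<lambda>j. v (Some (j, False))))"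
    and scale: "\<And>i \<tau> p q s. (\<And>j. s j \<noteq> 0) \<Longrightarrow> Hh i \<tau> (\<lambda>j. s j * p j) (\<lambda>j. s j * q j) = 0 \<longleftrightarrow> Hh i \<tau> p q = 0"
begin

definition H :: "'n \<Rightarrow> ('n option \<Rightarrow> complex) \<Rightarrow> complex" where
  "H i v = Hh i (v None) (\<lambda>j. v (Some j)) (\<lambda>_. 1)"

definition zeros :: "complex \<Rightarrow> (complex^'n) set" where
  "zeros \<tau> = {x. \<forall>i. H i (pt \<tau> x) = 0}"

text \<open>All zeros in the product of projective lines are affine, none at infinity, and all are
  simple.\<close>

definition good :: "complex \<Rightarrow> bool" where
  "good \<tau> \<longleftrightarrow> (\<forall>p q. (\<forall>j. p j \<noteq> 0 \<or> q j \<noteq> 0) \<longrightarrow> (\<forall>i. Hh i \<tau> p q = 0) \<longrightarrow> (\<forall>j. q j \<noteq> 0)) \<and>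
     (\<forall>x\<in>zeros \<tau>. det (jac H (pt \<tau> x)) \<noteq> 0)"

lemma polyfn_Hh_subst:
  assumes "polyfn UNIV T" "\<And>j. polyfn UNIV (P j)" "\<And>j. polyfn UNIV (Q j)"
  shows "polyfn UNIV (\<lambda>v. Hh i (T v) (\<lambda>j. P j v) (\<lambda>j. Q j v))"
proof -
  have "polyfn UNIV (\<lambda>v. case w of None \<Rightarrow> T v | Some (j, b) \<Rightarrow> if b then P j v else Q j v)" for w
  proof (cases w)
    case None then show ?thesis using assms by simp
  next
    case (Some jb) then show ?thesis using assms by (cases jb; cases "snd jb") auto
  qed
  from polyfn_subst[OF polyfn_Hh[of i], of "\<lambda>v w. case w of None \<Rightarrow> T v | Some (j, b) \<Rightarrow> if b then P j v else Q j v", OF this]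
  show ?thesis by simp
qed

lemma polyfn_H: "polyfn UNIV (H i)"
  unfolding H_def by (intro polyfn_Hh_subst polyfn_intros)

lemma H_pt: "H i (pt \<tau> x) = Hh i \<tau> (($) x) (\<lambda>_. 1)"
  by (simp add: H_def)

lemma Hh_affine:
  assumes "\<And>j. q j \<noteq> 0"
  shows "Hh i \<tau> p q = 0 \<longleftrightarrow> H i (pt \<tau> (\<chi> j. p j / q j)) = 0"
proof -
  have "Hh i \<tau> (\<lambda>j. q j * (p j / q j)) (\<lambda>j. q j * 1) = 0 \<longleftrightarrow> Hh i \<tau> (\<lambda>j. p j / q j) (\<lambda>j. 1) = 0"
    by (rule scale) (rule assms)
  then show ?thesis using assms by (simp add: H_def)
qed

lemma tendsto_Hh:
  assumes "(\<tau> \<longlongrightarrow> \<tau>0) F" "\<And>j. ((\<lambda>k. p k j) \<longlongrightarrow> p0 j) F" "\<And>j. ((\<lambda>k. q k j) \<longlongrightarrow> q0 j) F"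
  shows "((\<lambda>k. Hh i (\<tau> k) (p k) (q k)) \<longlongrightarrow> Hh i \<tau>0 p0 q0) F"
proof -
  let ?g = "\<lambda>(\<tau>::complex) p q w. case w of None \<Rightarrow> \<tau> | Some (j, b) \<Rightarrow> if b then p j else q j"
  have "((\<lambda>k. ?g (\<tau> k) (p k) (q k) w) \<longlongrightarrow> ?g \<tau>0 p0 q0 w) F" for w
  proof (cases w)
    case None then show ?thesis using assms by simp
  next
    case (Some jb) then show ?thesis using assms by (cases jb; cases "snd jb") auto
  qed
  from tendsto_polyfn[OF polyfn_Hh, of "\<lambda>k. ?g (\<tau> k) (p k) (q k)" "?g \<tau>0 p0 q0", OF this] show ?thesis by simp
qed

lemma tendsto_pt: "(\<tau> \<longlongrightarrow> \<tau>0) F \<Longrightarrow> (x \<longlongrightarrow> x0) F \<Longrightarrow> ((\<lambda>k. pt (\<tau> k) (x k) v) \<longlongrightarrow> pt \<tau>0 x0 v) F"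
  by (cases v) (auto intro: tendsto_vec_nth)

text \<open>Normalised homogeneous coordinates stay in a compact chart, so a subsequence converges
  projectively; goodness of the limit parameter excludes a limit at infinity.\<close>

lemma zeros_subseq:
  assumes "good \<tau>0" "\<tau> \<longlonglongrightarrow> \<tau>0" "\<And>k. x k \<in> zeros (\<tau> k)"
  obtains r x0 where "strict_mono (r :: nat \<Rightarrow> nat)" "(\<lambda>k. x (r k)) \<longlonglongrightarrow> x0" "x0 \<in> zeros \<tau>0"
proof -
  have "\<exists>pq. pq \<in> proj_chart \<and> (\<forall>j. snd pq $ j \<noteq> 0) \<and> (\<forall>j. x k $ j = fst pq $ j / snd pq $ j)" for k
    using proj_chart_affine[of "x k"] by (metis fst_conv snd_conv)
  then obtain y where y: "\<And>k. y k \<in> proj_chart" "\<And>k j. snd (y k) $ j \<noteq> 0"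
    "\<And>k j. x k $ j = fst (y k) $ j / snd (y k) $ j" by metis
  obtain r p q where r: "strict_mono (r :: nat \<Rightarrow> nat)" "(p, q) \<in> proj_chart"
    "(\<lambda>k. fst (y (r k))) \<longlonglongrightarrow> p" "(\<lambda>k. snd (y (r k))) \<longlonglongrightarrow> q"
    by (rule proj_chart_subseq[of y, OF y(1)])
  have "Hh i (\<tau> (r k)) (($) (fst (y (r k)))) (($) (snd (y (r k)))) = 0" for i k
  proof -
    have "(\<chi> j. fst (y (r k)) $ j / snd (y (r k)) $ j) = x (r k)" by (simp add: vec_eq_iff y(3))
    then show ?thesis using assms(3)[of "r k"] Hh_affine[OF y(2)] by (simp add: zeros_def)
  qed
  moreover have "(\<lambda>k. Hh i (\<tau> (r k)) (($) (fst (y (r k)))) (($) (snd (y (r k))))) \<longlonglongrightarrow> Hh i \<tau>0 (($) p) (($) q)" for i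
    by (intro tendsto_Hh tendsto_vec_nth r LIMSEQ_subseq_LIMSEQ[OF assms(2) r(1), unfolded o_def])
  ultimately have zero: "Hh i \<tau>0 (($) p) (($) q) = 0" for i
    by (simp add: LIMSEQ_const_iff)
  then have q: "q $ j \<noteq> 0" for j
    using assms(1) proj_chart_nonzero[OF r(2)] unfolding good_def by blast
  have "(\<lambda>k. \<chi> j. fst (y (r k)) $ j / snd (y (r k)) $ j) \<longlonglongrightarrow> (\<chi> j. p $ j / q $ j)"
    by (intro tendsto_vec_lambda tendsto_divide tendsto_vec_nth r q)
  moreover have "(\<chi> j. fst (y (r k)) $ j / snd (y (r k)) $ j) = x (r k)" for k by (simp add: vec_eq_iff y(3))
  ultimately have "(\<lambda>k. x (r k)) \<longlonglongrightarrow> (\<chi> j. p $ j / q $ j)" by simp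
  moreover have "(\<chi> j. p $ j / q $ j) \<in> zeros \<tau>0"
    using zero Hh_affine[of "($) q" _ \<tau>0 "($) p"] q by (simp add: zeros_def)
  ultimately show ?thesis using that r(1) by blast
qed

lemma not_good_chart:
  assumes "\<not> good \<tau>"
  obtains p q where "(p, q) \<in> proj_chart" "\<And>i. Hh i \<tau> (($) p) (($) q) = 0"
    "(\<forall>j. q $ j \<noteq> 0) \<Longrightarrow> det (jac H (pt \<tau> (\<chi> j. p $ j / q $ j))) = 0"
proof -
  consider p q j where "\<forall>j. p j \<noteq> 0 \<or> q j \<noteq> 0" "\<forall>i. Hh i \<tau> p q = 0" "q j = 0"
    | x where "x \<in> zeros \<tau>" "det (jac H (pt \<tau> x)) = 0"
    using assms unfolding good_def by blast
  then show ?thesis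
  proof cases
    case 1
    then obtain s where s: "\<And>j. s j \<noteq> 0" "(\<chi> j. s j * p j, \<chi> j. s j * q j) \<in> proj_chart"
      using proj_chart_normalize by metis
    have "Hh i \<tau> (\<lambda>j. s j * p j) (\<lambda>j. s j * q j) = 0" for i using scale[of s i \<tau> p q] s(1) 1 by blast
    moreover have "($) (\<chi> j. s j * p j) = (\<lambda>j. s j * p j)" "($) (\<chi> j. s j * q j) = (\<lambda>j. s j * q j)" by auto
    ultimately show ?thesis using that[OF s(2)] 1(3) by auto
  next
    case 2
    obtain p q where pq: "(p, q) \<in> proj_chart" "\<And>j. q $ j \<noteq> 0" "\<And>j. x $ j = p $ j / q $ j"
      using proj_chart_affine by blast
    have x: "(\<chi> j. p $ j / q $ j) = x" by (simp add: vec_eq_iff pq(3))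
    show ?thesis
    proof (rule that[OF pq(1)])
      show "Hh i \<tau> (($) p) (($) q) = 0" for i
        using 2(1) Hh_affine[of "($) q" i \<tau> "($) p"] pq(2) by (simp add: x zeros_def)
    qed (use 2(2) x in simp)
  qed
qed

text \<open>Bad zeros over parameters tending to \<open>\<tau>0\<close> accumulate, by compactness,
  at a zero over \<open>\<tau>0\<close>. It is affine by goodness, hence so are eventually the bad
  zeros, and their vanishing determinants make the limit degenerate.\<close>

lemma eventually_good:
  assumes "good \<tau>0"
  shows "\<forall>\<^sub>F \<tau> in nhds \<tau>0. good \<tau>"
proof (rule ccontr)
  assume "\<not> ?thesis"
  then obtain \<tau> where \<tau>: "\<tau> \<longlonglongrightarrow> \<tau>0" "\<And>k. \<not> good (\<tau> k)"
    using not_eventually_nhds_sequence[of good \<tau>0] by metis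
  have "\<exists>pq. pq \<in> proj_chart \<and> (\<forall>i. Hh i (\<tau> k) (($) (fst pq)) (($) (snd pq)) = 0) \<and>
      ((\<forall>j. snd pq $ j \<noteq> 0) \<longrightarrow> det (jac H (pt (\<tau> k) (\<chi> j. fst pq $ j / snd pq $ j))) = 0)" for k
  proof -
    obtain p q where "(p, q) \<in> proj_chart" "\<And>i. Hh i (\<tau> k) (($) p) (($) q) = 0"
      "(\<forall>j. q $ j \<noteq> 0) \<Longrightarrow> det (jac H (pt (\<tau> k) (\<chi> j. p $ j / q $ j))) = 0"
      using not_good_chart[OF \<tau>(2)[of k]] by blast
    then show ?thesis by (intro exI[of _ "(p, q)"]) simp
  qed
  then have "\<forall>k. \<exists>pq. pq \<in> proj_chart \<and> (\<forall>i. Hh i (\<tau> k) (($) (fst pq)) (($) (snd pq)) = 0) \<and>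
      ((\<forall>j. snd pq $ j \<noteq> 0) \<longrightarrow> det (jac H (pt (\<tau> k) (\<chi> j. fst pq $ j / snd pq $ j))) = 0)" ..
  from choice[OF this] obtain y where y_all: "\<forall>k. y k \<in> proj_chart \<and>
      (\<forall>i. Hh i (\<tau> k) (($) (fst (y k))) (($) (snd (y k))) = 0) \<and>
      ((\<forall>j. snd (y k) $ j \<noteq> 0) \<longrightarrow> det (jac H (pt (\<tau> k) (\<chi> j. fst (y k) $ j / snd (y k) $ j))) = 0)" ..
  then have y: "\<And>k. y k \<in> proj_chart" "\<And>k i. Hh i (\<tau> k) (($) (fst (y k))) (($) (snd (y k))) = 0"
      "\<And>k. (\<forall>j. snd (y k) $ j \<noteq> 0) \<Longrightarrow> det (jac H (pt (\<tau> k) (\<chi> j. fst (y k) $ j / snd (y k) $ j))) = 0"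
    by auto
  obtain r p q where r: "strict_mono (r :: nat \<Rightarrow> nat)" "(p, q) \<in> proj_chart"
    "(\<lambda>k. fst (y (r k))) \<longlonglongrightarrow> p" "(\<lambda>k. snd (y (r k))) \<longlonglongrightarrow> q"
    by (rule proj_chart_subseq[of y, OF y(1)])
  have \<tau>r: "(\<lambda>k. \<tau> (r k)) \<longlonglongrightarrow> \<tau>0" using LIMSEQ_subseq_LIMSEQ[OF \<tau>(1) r(1)] by (simp add: o_def)
  have "(\<lambda>k. Hh i (\<tau> (r k)) (($) (fst (y (r k)))) (($) (snd (y (r k))))) \<longlonglongrightarrow> Hh i \<tau>0 (($) p) (($) q)" for i
    by (intro tendsto_Hh tendsto_vec_nth r \<tau>r)
  then have zero: "Hh i \<tau>0 (($) p) (($) q) = 0" for i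
    by (simp add: LIMSEQ_const_iff y(2))
  then have q: "q $ j \<noteq> 0" for j
    using assms proj_chart_nonzero[OF r(2)] unfolding good_def by blast
  let ?x = "\<lambda>k. \<chi> j. fst (y (r k)) $ j / snd (y (r k)) $ j"
  let ?lim = "\<chi> j. p $ j / q $ j"
  have "\<forall>\<^sub>F k in sequentially. snd (y (r k)) $ j \<noteq> 0" for j
    using tendsto_imp_eventually_ne[OF tendsto_vec_nth[OF r(4)] q[of j]] .
  then have "\<forall>\<^sub>F k in sequentially. \<forall>j. snd (y (r k)) $ j \<noteq> 0" by (simp add: eventually_all_finite)
  then have "\<forall>\<^sub>F k in sequentially. det (jac H (pt (\<tau> (r k)) (?x k))) = 0"
    by eventually_elim (rule y(3))
  moreover have "(\<lambda>k. det (jac H (pt (\<tau> (r k)) (?x k)))) \<longlonglongrightarrow> det (jac H (pt \<tau>0 ?lim))"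
    by (rule tendsto_polyfn[OF polyfn_det_jac[OF polyfn_H]])
      (intro tendsto_pt \<tau>r tendsto_vec_lambda tendsto_divide tendsto_vec_nth r q)
  ultimately have "det (jac H (pt \<tau>0 ?lim)) = 0"
    using LIMSEQ_unique[OF _ tendsto_eventually] by blast
  moreover have "?lim \<in> zeros \<tau>0"
    using zero Hh_affine[of "($) q" _ \<tau>0 "($) p"] q by (simp add: zeros_def)
  ultimately show False using assms by (auto simp: good_def)
qed

text \<open>The bad parameters are the projection of the constructible sets of zeros at infinity and
  of degenerate zeros. Openness of goodness near \<open>\<tau>1\<close> supplies infinitely many
  good parameters and so rules out the cofinite alternative.\<close>

lemma finite_not_good:
  assumes "good \<tau>1"
  shows "finite {\<tau>. \<not> good \<tau>}"
proof -
  define A where "A = {v :: ('n \<times> bool) option \<Rightarrow> complex.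
    (\<forall>j. v (Some (j, True)) \<noteq> 0 \<or> v (Some (j, False)) \<noteq> 0) \<and>
    (\<forall>i. Hh i (v None) (\<lambda>j. v (Some (j, True))) (\<lambda>j. v (Some (j, False))) = 0) \<and>
    (\<exists>j. v (Some (j, False)) = 0)}"
  define p1 where "p1 = (\<lambda>(v :: ('n \<times> bool) option \<Rightarrow> complex) w. case w of None \<Rightarrow> v None | Some j \<Rightarrow> v (Some (j, True)))"
  define B where "B = {v :: ('n \<times> bool) option \<Rightarrow> complex. (\<forall>i. H i (p1 v) = 0) \<and> det (jac H (p1 v)) = 0}"
  have p1: "polyfn UNIV (\<lambda>v. p1 v w)" for w
    by (cases w) (auto simp: p1_def intro: polyfn_intros)
  have "constructible UNIV A" unfolding A_def
    by (intro constructible_Collect_conj constructible_Collect_all_UNIV constructible_Collect_ex_UNIV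
        constructible_Collect_disj constructible_Collect_not constructible_Collect_eq polyfn_Hh polyfn_0 polyfn.var)
  moreover have "constructible UNIV B" unfolding B_def
    by (intro constructible_Collect_conj constructible_Collect_all_UNIV constructible_Collect_eq
        polyfn_subst[OF polyfn_H p1] polyfn_subst[OF polyfn_det_jac[OF polyfn_H] p1] polyfn_0)
  ultimately have "constructible UNIV {v. v \<in> A \<or> v \<in> B}"
    by (intro constructible_Collect_disj) simp_all
  define E where "E = {v :: ('n \<times> bool) option \<Rightarrow> complex. \<exists>y. (\<forall>w. w \<notin> range Some \<longrightarrow> y w = v w) \<and> (y \<in> A \<or> y \<in> B)}"
  have E: "constructible UNIV E"
    unfolding E_def by (rule constructible_Collect_ex_off) (use \<open>constructible UNIV {v. v \<in> A \<or> v \<in> B}\<close> in auto)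
  have E_iff: "v \<in> E \<longleftrightarrow> \<not> good (v None)" for v
  proof
    assume "v \<in> E"
    then obtain y where y: "y None = v None" "y \<in> A \<or> y \<in> B" by (auto simp: E_def)
    from y(2) show "\<not> good (v None)"
    proof
      assume "y \<in> A"
      then have "\<forall>j. y (Some (j, True)) \<noteq> 0 \<or> y (Some (j, False)) \<noteq> 0"
        "\<forall>i. Hh i (v None) (\<lambda>j. y (Some (j, True))) (\<lambda>j. y (Some (j, False))) = 0"
        "\<not> (\<forall>j. y (Some (j, False)) \<noteq> 0)"
        by (auto simp: A_def y(1))
      then show ?thesis unfolding good_def by meson
    next
      assume "y \<in> B"
      moreover have "p1 y = pt (v None) (\<chi> j. y (Some (j, True)))"
        by (auto simp: p1_def fun_eq_iff y(1) split: option.splits)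
      ultimately show ?thesis unfolding good_def B_def zeros_def by auto
    qed
  next
    assume "\<not> good (v None)"
    then consider p q j where "\<forall>j. p j \<noteq> 0 \<or> q j \<noteq> 0" "\<forall>i. Hh i (v None) p q = 0" "q j = 0"
      | x where "x \<in> zeros (v None)" "det (jac H (pt (v None) x)) = 0"
      unfolding good_def by blast
    then show "v \<in> E"
    proof cases
      case 1
      define y where "y = (\<lambda>w. case w of None \<Rightarrow> v None | Some (j, b) \<Rightarrow> if b then p j else q j)"
      have "y \<in> A" using 1 by (auto simp: A_def y_def)
      moreover have "w \<notin> range Some \<Longrightarrow> y w = v w" for w by (cases w) (auto simp: y_def)
      ultimately show ?thesis unfolding E_def by blast
    next
      case 2
      define y :: "('n \<times> bool) option \<Rightarrow> complex" where "y = (\<lambda>w. case w of None \<Rightarrow> v None | Some (j, b) \<Rightarrow> x $ j)"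
      have "p1 y = pt (v None) x" by (auto simp: p1_def y_def fun_eq_iff split: option.splits)
      then have "y \<in> B" using 2 by (simp add: B_def zeros_def)
      moreover have "w \<notin> range Some \<Longrightarrow> y w = v w" for w by (cases w) (auto simp: y_def)
      ultimately show ?thesis unfolding E_def by blast
    qed
  qed
  obtain e where "e > 0" "\<And>\<tau>. dist \<tau> \<tau>1 < e \<Longrightarrow> good \<tau>"
    using eventually_good[OF assms] unfolding eventually_nhds_metric by blast
  then have "ball \<tau>1 e \<subseteq> {\<tau>. good \<tau>}" by (auto simp: dist_commute)
  moreover have "infinite (ball \<tau>1 e)" using \<open>e > 0\<close> uncountable_ball uncountable_infinite by blast
  ultimately have "infinite {\<tau>. good \<tau>}" using finite_subset by blast
  then have "infinite {\<tau>. (\<lambda>_. 0)(None := \<tau>) \<notin> E}" unfolding E_iff by simp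
  from constructible_line_finite[OF E this] show ?thesis unfolding E_iff by simp
qed

text \<open>Each zero continues along its own implicit curve, the curves stay in disjoint balls, and
  compactness forbids zeros elsewhere. Finiteness is the same argument at a fixed parameter: an
  accumulation point would violate local uniqueness.\<close>

lemma eventually_card_zeros:
  assumes "good \<tau>0"
  shows "finite (zeros \<tau>0)" "\<forall>\<^sub>F \<tau> in nhds \<tau>0. card (zeros \<tau>) = card (zeros \<tau>0)"
proof -
  have curve: "\<exists>T X \<xi>. open T \<and> \<tau>0 \<in> T \<and> open X \<and> x \<in> X \<and> X \<subseteq> ball x e \<and> \<xi> \<tau>0 = x \<and>
    (\<forall>t\<in>T. \<xi> t \<in> X \<and> \<xi> t \<in> zeros t \<and> (\<forall>y\<in>X. y \<in> zeros t \<longrightarrow> y = \<xi> t))"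
    if x: "x \<in> zeros \<tau>0" and "e > 0" for x e
  proof -
    have zero: "\<And>i. H i (pt \<tau>0 x) = 0" using x by (simp add: zeros_def)
    have det: "det (jac H (pt \<tau>0 x)) \<noteq> 0" using assms x by (simp add: good_def)
    have "x \<in> ball x e" using \<open>e > 0\<close> by simp
    obtain T X \<xi> where curve:
      "open T" "\<tau>0 \<in> T" "open X" "x \<in> X" "X \<subseteq> ball x e" "\<xi> \<tau>0 = x"
      "\<And>t. t \<in> T \<Longrightarrow> \<xi> t \<in> X" "\<And>t i. t \<in> T \<Longrightarrow> H i (pt t (\<xi> t)) = 0"
      "\<And>t y. t \<in> T \<Longrightarrow> y \<in> X \<Longrightarrow> (\<And>i. H i (pt t y) = 0) \<Longrightarrow> y = \<xi> t"
      "\<And>i. (\<lambda>t. \<xi> t $ i) holomorphic_on T"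
      using implicit_curve[OF polyfn_H zero det open_ball \<open>x \<in> ball x e\<close>] by blast
    show ?thesis
    proof (intro exI conjI ballI impI)
      fix t assume t: "t \<in> T"
      show "\<xi> t \<in> X" by (rule curve(7)[OF t])
      show "\<xi> t \<in> zeros t" using curve(8)[OF t] by (simp add: zeros_def)
      show "y = \<xi> t" if "y \<in> X" "y \<in> zeros t" for y
        using that by (intro curve(9)[OF t]) (simp_all add: zeros_def)
    qed (rule curve)+
  qed
  show fin: "finite (zeros \<tau>0)"
  proof (rule ccontr)
    assume "infinite (zeros \<tau>0)"
    then obtain x :: "nat \<Rightarrow> complex^'n" where x: "inj x" "range x \<subseteq> zeros \<tau>0"
      using infinite_countable_subset by blast
    have xz: "x k \<in> zeros \<tau>0" for k using x(2) by auto
    obtain r x0 where r: "strict_mono (r :: nat \<Rightarrow> nat)" "(\<lambda>k. x (r k)) \<longlonglongrightarrow> x0" "x0 \<in> zeros \<tau>0"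
      by (rule zeros_subseq[OF assms tendsto_const[of \<tau>0] xz])
    obtain T X \<xi> where "open T \<and> \<tau>0 \<in> T \<and> open X \<and> x0 \<in> X \<and> X \<subseteq> ball x0 1 \<and> \<xi> \<tau>0 = x0 \<and>
      (\<forall>t\<in>T. \<xi> t \<in> X \<and> \<xi> t \<in> zeros t \<and> (\<forall>y\<in>X. y \<in> zeros t \<longrightarrow> y = \<xi> t))"
      using curve[OF r(3) zero_less_one] by (elim exE)
    then have T: "\<tau>0 \<in> T" "open X" "x0 \<in> X" "\<xi> \<tau>0 = x0"
      "\<forall>t\<in>T. \<forall>y\<in>X. y \<in> zeros t \<longrightarrow> y = \<xi> t" by blast+
    have "\<forall>\<^sub>F k in sequentially. x (r k) \<in> X" using r(2) T(2,3) by (rule topological_tendstoD)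
    then obtain N where N: "\<And>k. k \<ge> N \<Longrightarrow> x (r k) \<in> X" unfolding eventually_sequentially by blast
    have "x (r k) = x0" if "k \<ge> N" for k using T(1,4,5) N[OF that] xz by blast
    then have "x (r N) = x (r (Suc N))" by simp
    then show False using x(1) r(1) by (auto simp: inj_eq strict_mono_eq)
  qed
  obtain e where e: "e > 0" "\<And>x y. x \<in> zeros \<tau>0 \<Longrightarrow> y \<in> zeros \<tau>0 \<Longrightarrow> x \<noteq> y \<Longrightarrow> 2 * e \<le> dist x y"
    using finite_separated[OF fin] by blast
  obtain T X \<xi> where T: "\<And>x. x \<in> zeros \<tau>0 \<Longrightarrow> open (T x) \<and> \<tau>0 \<in> T x \<and> open (X x) \<and> x \<in> X x \<and> X x \<subseteq> ball x e \<and> \<xi> x \<tau>0 = x \<and>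
    (\<forall>t\<in>T x. \<xi> x t \<in> X x \<and> \<xi> x t \<in> zeros t \<and> (\<forall>y\<in>X x. y \<in> zeros t \<longrightarrow> y = \<xi> x t))"
    using curve[OF _ e(1)] by metis
  have inT: "\<forall>\<^sub>F \<tau> in nhds \<tau>0. \<forall>x\<in>zeros \<tau>0. \<tau> \<in> T x"
    unfolding eventually_ball_finite_distrib[OF fin] using T eventually_nhds_in_open by blast
  have surj: "\<forall>\<^sub>F \<tau> in nhds \<tau>0. zeros \<tau> \<subseteq> (\<lambda>x. \<xi> x \<tau>) ` zeros \<tau>0"
  proof (rule ccontr)
    assume "\<not> ?thesis"
    then obtain \<tau> where \<tau>: "\<tau> \<longlonglongrightarrow> \<tau>0" "\<And>k. \<not> zeros (\<tau> k) \<subseteq> (\<lambda>x. \<xi> x (\<tau> k)) ` zeros \<tau>0"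
      using not_eventually_nhds_sequence[of "\<lambda>\<tau>. zeros \<tau> \<subseteq> (\<lambda>x. \<xi> x \<tau>) ` zeros \<tau>0" \<tau>0] by metis
    then have "\<forall>k. \<exists>z. z \<in> zeros (\<tau> k) \<and> z \<notin> (\<lambda>x. \<xi> x (\<tau> k)) ` zeros \<tau>0" by blast
    then obtain z where z: "\<And>k. z k \<in> zeros (\<tau> k)" "\<And>k. z k \<notin> (\<lambda>x. \<xi> x (\<tau> k)) ` zeros \<tau>0" by metis
    obtain r x0 where r: "strict_mono (r :: nat \<Rightarrow> nat)" "(\<lambda>k. z (r k)) \<longlonglongrightarrow> x0" "x0 \<in> zeros \<tau>0"
      by (rule zeros_subseq[OF assms \<tau>(1) z(1)])
    have X: "open (X x0)" "x0 \<in> X x0" and T0: "open (T x0)" "\<tau>0 \<in> T x0" using T[OF r(3)] by auto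
    have "\<forall>\<^sub>F k in sequentially. z (r k) \<in> X x0" using r(2) X by (rule topological_tendstoD)
    moreover have "\<forall>\<^sub>F k in sequentially. \<tau> (r k) \<in> T x0"
      using LIMSEQ_subseq_LIMSEQ[OF \<tau>(1) r(1), unfolded o_def] T0 by (rule topological_tendstoD)
    ultimately have "\<forall>\<^sub>F k in sequentially. z (r k) = \<xi> x0 (\<tau> (r k))"
      by eventually_elim (use T[OF r(3)] z(1) in blast)
    then obtain k where "z (r k) = \<xi> x0 (\<tau> (r k))" by (auto simp: eventually_sequentially)
    then show False using z(2)[of "r k"] r(3) by blast
  qed
  show "\<forall>\<^sub>F \<tau> in nhds \<tau>0. card (zeros \<tau>) = card (zeros \<tau>0)"
    using inT surj
  proof eventually_elim
    case (elim \<tau>)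
    have "inj_on (\<lambda>x. \<xi> x \<tau>) (zeros \<tau>0)"
    proof (rule inj_onI, rule ccontr)
      fix x y assume xy: "x \<in> zeros \<tau>0" "y \<in> zeros \<tau>0" "\<xi> x \<tau> = \<xi> y \<tau>" "x \<noteq> y"
      have "\<xi> x \<tau> \<in> ball x e" "\<xi> y \<tau> \<in> ball y e"
        using T[OF xy(1)] T[OF xy(2)] elim(1) xy(1,2) by blast+
      then have "dist x y < 2 * e" using dist_triangle2[of x y "\<xi> x \<tau>"] xy(3) by simp
      then show False using e(2)[OF xy(1,2,4)] by simp
    qed
    moreover have "(\<lambda>x. \<xi> x \<tau>) ` zeros \<tau>0 = zeros \<tau>"
      using elim T by blast
    ultimately show ?case by (metis card_image)
  qed
qed

text \<open>The complex plane without the finitely many bad parameters is connected, and the count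
  is locally constant on it.\<close>

lemma card_zeros_good:
  assumes "good \<tau>1" "good \<tau>2"
  shows "card (zeros \<tau>1) = card (zeros \<tau>2)"
proof -
  have "connected (UNIV - {\<tau>. \<not> good \<tau>})"
    by (rule connected_open_diff_countable) (auto intro: countable_finite finite_not_good[OF assms(1)])
  moreover have "UNIV - {\<tau>. \<not> good \<tau>} = {\<tau>. good \<tau>}" by auto
  ultimately have "connected {\<tau>. good \<tau>}" by simp
  then have "(\<lambda>\<tau>. card (zeros \<tau>)) constant_on {\<tau>. good \<tau>}"
  proof (rule locally_constant_imp_constant)
    fix \<tau> assume g: "\<tau> \<in> {\<tau>. good \<tau>}"
    then have "\<exists>S. open S \<and> \<tau> \<in> S \<and> (\<forall>t\<in>S. card (zeros t) = card (zeros \<tau>))"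
      using eventually_card_zeros(2)[of \<tau>] by (simp add: eventually_nhds)
    then obtain S where S: "open S" "\<tau> \<in> S" "\<forall>t\<in>S. card (zeros t) = card (zeros \<tau>)"
      by (elim exE conjE)
    show "\<exists>T. openin (top_of_set {\<tau>. good \<tau>}) T \<and> \<tau> \<in> T \<and> (\<forall>x\<in>T. card (zeros x) = card (zeros \<tau>))"
    proof (intro exI conjI)
      show "openin (top_of_set {\<tau>. good \<tau>}) ({\<tau>. good \<tau>} \<inter> S)" by (rule openin_open_Int[OF S(1)])
      show "\<tau> \<in> {\<tau>. good \<tau>} \<inter> S" using g S(2) by blast
      show "\<forall>x\<in>{\<tau>. good \<tau>} \<inter> S. card (zeros x) = card (zeros \<tau>)" using S(3) by blast
    qed
  qed
  then show ?thesis using assms unfolding constant_on_def by auto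
qed

end

section \<open>A permanent\<close>

text \<open>Expanding the product selects the set \<open>S\<close> of rows that contribute
  \<open>a\<close>; the rows outside \<open>S\<close> contribute the identity and force
  \<open>\<sigma>\<close> to fix them. The (card S)! permutations of \<open>S\<close> all give the
  same product.\<close>

lemma permanent_ones_plus_identity:
  fixes a :: "'n::finite \<Rightarrow> nat"
  shows "(\<Sum>\<sigma> | \<sigma> permutes UNIV. \<Prod>i\<in>UNIV. a (\<sigma> i) + (if i = \<sigma> i then 1 else 0)) =
    (\<Sum>S\<in>UNIV. fact (card S) * (\<Prod>i\<in>S. a i))"
proof -
  have "(\<Sum>\<sigma> | \<sigma> permutes UNIV. \<Prod>i\<in>UNIV. a (\<sigma> i) + (if i = \<sigma> i then 1 else 0)) =
      (\<Sum>\<sigma> | \<sigma> permutes UNIV. \<Sum>S\<in>UNIV. (\<Prod>i\<in>S. a (\<sigma> i)) * (if \<forall>i\<in>-S. i = \<sigma> i then 1 else 0))"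
  proof (rule sum.cong[OF refl])
    fix \<sigma> :: "'n \<Rightarrow> 'n"
    have "(\<Prod>i\<in>UNIV. a (\<sigma> i) + (if i = \<sigma> i then 1 else 0)) =
        (\<Sum>S\<in>Pow UNIV. (\<Prod>i\<in>S. a (\<sigma> i)) * (\<Prod>i\<in>UNIV - S. if i = \<sigma> i then 1 else 0))"
      by (rule prod_add) simp
    moreover have "(\<Prod>i\<in>UNIV - S. if i = \<sigma> i then 1 else (0::nat)) = (if \<forall>i\<in>-S. i = \<sigma> i then 1 else 0)" for S
      by (auto simp: Compl_eq_Diff_UNIV)
    ultimately show "(\<Prod>i\<in>UNIV. a (\<sigma> i) + (if i = \<sigma> i then 1 else 0)) =
        (\<Sum>S\<in>UNIV. (\<Prod>i\<in>S. a (\<sigma> i)) * (if \<forall>i\<in>-S. i = \<sigma> i then 1 else 0))" by simp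
  qed
  also have "\<dots> = (\<Sum>S\<in>UNIV. \<Sum>\<sigma> | \<sigma> permutes UNIV. (\<Prod>i\<in>S. a (\<sigma> i)) * (if \<forall>i\<in>-S. i = \<sigma> i then 1 else 0))"
    by (rule sum.swap)
  also have "\<dots> = (\<Sum>S\<in>UNIV. fact (card S) * (\<Prod>i\<in>S. a i))"
  proof (rule sum.cong[OF refl])
    fix S :: "'n set"
    have fin: "finite {\<sigma>::'n \<Rightarrow> 'n. \<sigma> permutes UNIV}" by (rule finite_permutations) simp
    have "(\<Sum>\<sigma> | \<sigma> permutes UNIV. (\<Prod>i\<in>S. a (\<sigma> i)) * (if \<forall>i\<in>-S. i = \<sigma> i then 1 else 0)) =
        (\<Sum>\<sigma> | \<sigma> permutes S. \<Prod>i\<in>S. a (\<sigma> i))"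
    proof (rule sum.mono_neutral_cong_right[OF fin])
      show "{\<sigma>. \<sigma> permutes S} \<subseteq> {\<sigma>. \<sigma> permutes UNIV}" using permutes_subset by blast
      have "\<sigma> permutes S" if "\<sigma> permutes UNIV" "\<forall>i\<in>-S. i = \<sigma> i" for \<sigma>
        using that by (auto simp: permutes_def)
      then show "\<forall>\<sigma>\<in>{\<sigma>. \<sigma> permutes UNIV} - {\<sigma>. \<sigma> permutes S}. (\<Prod>i\<in>S. a (\<sigma> i)) * (if \<forall>i\<in>-S. i = \<sigma> i then 1 else 0) = 0"
        by auto
      fix \<sigma> assume "\<sigma> \<in> {\<sigma>. \<sigma> permutes S}"
      then show "(\<Prod>i\<in>S. a (\<sigma> i)) * (if \<forall>i\<in>-S. i = \<sigma> i then 1 else 0) = (\<Prod>i\<in>S. a (\<sigma> i))"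
        by (auto simp: permutes_def)
    qed
    also have "\<dots> = (\<Sum>\<sigma> | \<sigma> permutes S. \<Prod>i\<in>S. a i)"
    proof (rule sum.cong[OF refl])
      fix \<sigma> assume "\<sigma> \<in> {\<sigma>. \<sigma> permutes S}"
      then show "(\<Prod>i\<in>S. a (\<sigma> i)) = (\<Prod>i\<in>S. a i)" using prod.permute[of \<sigma> S a] by (simp add: o_def)
    qed
    also have "\<dots> = fact (card S) * (\<Prod>i\<in>S. a i)"
      by (simp add: card_permutations)
    finally show "(\<Sum>\<sigma> | \<sigma> permutes UNIV. (\<Prod>i\<in>S. a (\<sigma> i)) * (if \<forall>i\<in>-S. i = \<sigma> i then 1 else 0)) =
        fact (card S) * (\<Prod>i\<in>S. a i)" .
  qed
  finally show ?thesis .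
qed

text \<open>The summand 1 comes from the empty set; it matches the additional zero near
  \<open>u\<close>.\<close>

lemma sum_fact_elem_sym:
  fixes a :: "nat^'n::finite"
  shows "(\<Sum>S\<in>UNIV. fact (card S) * (\<Prod>i\<in>S. a $ i)) = 1 + (\<Sum>k=1..CARD('n). fact k * elem_sym k a)"
proof -
  have "(\<Sum>S\<in>UNIV. fact (card S) * (\<Prod>i\<in>S. a $ i)) =
      (\<Sum>k\<in>{0..CARD('n)}. \<Sum>S\<in>{S\<in>UNIV. card S = k}. fact (card S) * (\<Prod>i\<in>S. a $ i))"
    by (rule sum.group[symmetric]) (auto simp: card_mono)
  also have "\<dots> = (\<Sum>k\<in>{0..CARD('n)}. fact k * elem_sym k a)"
    unfolding elem_sym_def sum_distrib_left by (intro sum.cong) auto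
  also have "\<dots> = fact 0 * elem_sym 0 a + (\<Sum>k=1..CARD('n). fact k * elem_sym k a)"
    by (simp add: sum.atLeast_Suc_atMost)
  also have "{S::'n set. card S = 0} = {{}}" by auto
  then have "elem_sym 0 a = 1" by (simp add: elem_sym_def)
  finally show ?thesis by simp
qed

section \<open>A deformation of the critical equations\<close>

definition exponents :: "nat^'n \<Rightarrow> ('n \<Rightarrow>\<^sub>0 nat) set" where
  "exponents a = {\<alpha>. \<forall>i. Poly_Mapping.lookup \<alpha> i \<le> a $ i}"

lemma finite_exponents: "finite (exponents (a :: nat^'n::finite))"
proof (rule finite_imageD)
  have "Poly_Mapping.lookup ` exponents a \<subseteq> PiE UNIV (\<lambda>i. {..a $ i})"
    by (auto simp: exponents_def)
  moreover have "finite (PiE UNIV (\<lambda>i. {..a $ i}))" by (rule finite_PiE) auto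
  ultimately show "finite (Poly_Mapping.lookup ` exponents a)" by (rule finite_subset)
  show "inj_on Poly_Mapping.lookup (exponents a)"
    by (rule inj_onI) (simp add: poly_mapping_eqI)
qed

text \<open>The homogenisation of the polynomial with coefficients \<open>c\<close> on \<open>(P\<^sup>1)\<^sup>n\<close>, with multidegree \<open>a\<close>, and
  its derivative with respect to \<open>p i\<close>.\<close>

definition hom_poly :: "nat^'n::finite \<Rightarrow> (('n \<Rightarrow>\<^sub>0 nat) \<Rightarrow> complex) \<Rightarrow> ('n \<Rightarrow> complex) \<Rightarrow> ('n \<Rightarrow> complex) \<Rightarrow> complex" where
  "hom_poly a c p q = (\<Sum>\<alpha>\<in>exponents a. c \<alpha> *
     (\<Prod>j\<in>UNIV. p j ^ Poly_Mapping.lookup \<alpha> j * q j ^ (a $ j - Poly_Mapping.lookup \<alpha> j)))"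

definition hom_deriv :: "nat^'n::finite \<Rightarrow> 'n \<Rightarrow> (('n \<Rightarrow>\<^sub>0 nat) \<Rightarrow> complex) \<Rightarrow> ('n \<Rightarrow> complex) \<Rightarrow> ('n \<Rightarrow> complex) \<Rightarrow> complex" where
  "hom_deriv a i c p q = (\<Sum>\<alpha>\<in>exponents a. c \<alpha> *
     (of_nat (Poly_Mapping.lookup \<alpha> i) * p i ^ (Poly_Mapping.lookup \<alpha> i - 1) * q i ^ (a $ i - Poly_Mapping.lookup \<alpha> i)) *
     (\<Prod>j\<in>-{i}. p j ^ Poly_Mapping.lookup \<alpha> j * q j ^ (a $ j - Poly_Mapping.lookup \<alpha> j)))"

text \<open>An injective numbering of triples makes the roots distinct across all equations,
  variables and factors at once.\<close>

definition grid_root :: "'n::finite \<Rightarrow> 'n \<Rightarrow> nat \<Rightarrow> complex" where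
  "grid_root i j m = of_nat (to_nat (i, j, m))"

definition prod_system :: "nat^'n::finite \<Rightarrow> 'n \<Rightarrow> ('n \<Rightarrow> complex) \<Rightarrow> ('n \<Rightarrow> complex) \<Rightarrow> complex" where
  "prod_system a i p q = (\<Prod>j\<in>UNIV. \<Prod>m<a $ j + (if i = j then 1 else 0). p j - grid_root i j m * q j)"

text \<open>\<open>hom_deriv\<close> has degree one less than \<open>hom_poly\<close> in the i-th
  pair; the factor \<open>(q i)^2\<close> lifts it to the multidegree of the other two
  terms.\<close>

definition ed_family :: "nat^'n::finite \<Rightarrow> (('n \<Rightarrow>\<^sub>0 nat) \<Rightarrow> complex) \<Rightarrow> ('n \<Rightarrow> complex) \<Rightarrow> 'n \<Rightarrow> complex \<Rightarrow>
    ('n \<Rightarrow> complex) \<Rightarrow> ('n \<Rightarrow> complex) \<Rightarrow> complex" where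
  "ed_family a c u i \<tau> p q =
     (1 - \<tau>^2) * (hom_poly a c p q * (p i - u i * q i) + \<tau> * (q i)^2 * hom_deriv a i c p q) + \<tau>^2 * prod_system a i p q"

lemma grid_root_eq_iff [simp]: "grid_root i j m = grid_root i' j' m' \<longleftrightarrow> i = i' \<and> j = j' \<and> m = m'"
  by (simp add: grid_root_def)

lemma hom_poly_scale:
  "hom_poly a c (\<lambda>j. s j * p j) (\<lambda>j. s j * q j) = (\<Prod>j\<in>UNIV. s j ^ a $ j) * hom_poly a c p q"
  unfolding hom_poly_def sum_distrib_left
proof (rule sum.cong[OF refl])
  fix \<alpha> assume \<alpha>: "\<alpha> \<in> exponents a"
  have "(s j * p j) ^ Poly_Mapping.lookup \<alpha> j * (s j * q j) ^ (a $ j - Poly_Mapping.lookup \<alpha> j) =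
      s j ^ (a $ j) * (p j ^ Poly_Mapping.lookup \<alpha> j * q j ^ (a $ j - Poly_Mapping.lookup \<alpha> j))" for j
  proof -
    have "s j ^ (a $ j) = s j ^ Poly_Mapping.lookup \<alpha> j * s j ^ (a $ j - Poly_Mapping.lookup \<alpha> j)"
      using \<alpha> by (simp add: exponents_def flip: power_add)
    then show ?thesis by (simp add: power_mult_distrib)
  qed
  then show "c \<alpha> * (\<Prod>j\<in>UNIV. (s j * p j) ^ Poly_Mapping.lookup \<alpha> j * (s j * q j) ^ (a $ j - Poly_Mapping.lookup \<alpha> j)) =
      (\<Prod>j\<in>UNIV. s j ^ a $ j) * (c \<alpha> * (\<Prod>j\<in>UNIV. p j ^ Poly_Mapping.lookup \<alpha> j * q j ^ (a $ j - Poly_Mapping.lookup \<alpha> j)))"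
    by (simp add: prod.distrib)
qed

text \<open>The factor \<open>s i\<close> on the left accounts for the degree lost by
  differentiation and avoids a division.\<close>

lemma hom_deriv_scale:
  "s i * hom_deriv a i c (\<lambda>j. s j * p j) (\<lambda>j. s j * q j) = (\<Prod>j\<in>UNIV. s j ^ a $ j) * hom_deriv a i c p q"
  unfolding hom_deriv_def sum_distrib_left
proof (rule sum.cong[OF refl])
  fix \<alpha> assume \<alpha>: "\<alpha> \<in> exponents a"
  let ?l = "Poly_Mapping.lookup \<alpha>"
  have split: "s j ^ (a $ j) = s j ^ ?l j * s j ^ (a $ j - ?l j)" for j
    using \<alpha> by (simp add: exponents_def flip: power_add)
  have 1: "(\<Prod>j\<in>-{i}. (s j * p j) ^ ?l j * (s j * q j) ^ (a $ j - ?l j)) =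
      (\<Prod>j\<in>-{i}. s j ^ a $ j) * (\<Prod>j\<in>-{i}. p j ^ ?l j * q j ^ (a $ j - ?l j))"
    unfolding prod.distrib[symmetric] by (intro prod.cong refl) (simp add: split power_mult_distrib)
  have 2: "s i * (of_nat (?l i) * (s i * p i) ^ (?l i - 1) * (s i * q i) ^ (a $ i - ?l i)) =
      s i ^ a $ i * (of_nat (?l i) * p i ^ (?l i - 1) * q i ^ (a $ i - ?l i))"
  proof (cases "?l i")
    case (Suc k)
    have "s i ^ (a $ i) = s i * s i ^ k * s i ^ (a $ i - Suc k)" using split[of i] Suc by simp
    then show ?thesis unfolding Suc by (simp only: power_mult_distrib diff_Suc_1 mult_ac)
  qed simp
  have 3: "(\<Prod>j\<in>UNIV. s j ^ a $ j) = s i ^ a $ i * (\<Prod>j\<in>-{i}. s j ^ a $ j)"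
    by (simp add: prod.remove[of UNIV i] Compl_eq_Diff_UNIV)
  have "s i * (c \<alpha> * A * B) = c \<alpha> * (s i * A) * B" for A B by simp
  then show "s i * (c \<alpha> * (of_nat (?l i) * (s i * p i) ^ (?l i - 1) * (s i * q i) ^ (a $ i - ?l i)) *
      (\<Prod>j\<in>-{i}. (s j * p j) ^ ?l j * (s j * q j) ^ (a $ j - ?l j))) =
    (\<Prod>j\<in>UNIV. s j ^ a $ j) * (c \<alpha> * (of_nat (?l i) * p i ^ (?l i - 1) * q i ^ (a $ i - ?l i)) *
      (\<Prod>j\<in>-{i}. p j ^ ?l j * q j ^ (a $ j - ?l j)))"
    unfolding 1 3 by (simp only: 2) (simp add: mult_ac)
qed

lemma prod_system_scale:
  "prod_system a i (\<lambda>j. s j * p j) (\<lambda>j. s j * q j) = (\<Prod>j\<in>UNIV. s j ^ a $ j) * s i * prod_system a i p q"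
proof -
  have "s j * p j - r * (s j * q j) = s j * (p j - r * q j)" for j r by (simp add: algebra_simps)
  then have "prod_system a i (\<lambda>j. s j * p j) (\<lambda>j. s j * q j) =
      (\<Prod>j\<in>UNIV. s j ^ (a $ j + (if i = j then 1 else 0))) * prod_system a i p q"
    by (simp add: prod_system_def prod.distrib)
  also have "(\<Prod>j\<in>UNIV. s j ^ (a $ j + (if i = j then 1 else 0))) = (\<Prod>j\<in>UNIV. s j ^ a $ j) * s i"
    by (simp add: power_add prod.distrib if_distrib[of "\<lambda>n. _ ^ n"] cong: if_cong)
  finally show ?thesis .
qed

lemma ed_family_scale:
  "ed_family a c u i \<tau> (\<lambda>j. s j * p j) (\<lambda>j. s j * q j) =
    (\<Prod>j\<in>UNIV. s j ^ a $ j) * s i * ed_family a c u i \<tau> p q"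
proof -
  let ?S = "\<Prod>j\<in>UNIV. s j ^ a $ j"
  have "(s i * q i)^2 * hom_deriv a i c (\<lambda>j. s j * p j) (\<lambda>j. s j * q j) =
      s i * (q i)^2 * (s i * hom_deriv a i c (\<lambda>j. s j * p j) (\<lambda>j. s j * q j))"
    by (simp add: power2_eq_square)
  also have "\<dots> = ?S * s i * ((q i)^2 * hom_deriv a i c p q)" unfolding hom_deriv_scale by simp
  finally have d: "\<tau> * (s i * q i)^2 * hom_deriv a i c (\<lambda>j. s j * p j) (\<lambda>j. s j * q j) =
      ?S * s i * (\<tau> * (q i)^2 * hom_deriv a i c p q)" by (simp add: mult_ac)
  show ?thesis unfolding ed_family_def hom_poly_scale prod_system_scale d by (simp add: algebra_simps)
qed

lemma polyfn_hom_poly [polyfn_intros]: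
  assumes "\<And>\<alpha>. polyfn C (\<lambda>v. c v \<alpha>)" "\<And>j. polyfn C (\<lambda>v. p v j)" "\<And>j. polyfn C (\<lambda>v. q v j)"
  shows "polyfn C (\<lambda>v. hom_poly a (c v) (p v) (q v))"
  unfolding hom_poly_def by (intro polyfn_intros assms)

lemma polyfn_hom_deriv [polyfn_intros]:
  assumes "\<And>\<alpha>. polyfn C (\<lambda>v. c v \<alpha>)" "\<And>j. polyfn C (\<lambda>v. p v j)" "\<And>j. polyfn C (\<lambda>v. q v j)"
  shows "polyfn C (\<lambda>v. hom_deriv a i (c v) (p v) (q v))"
  unfolding hom_deriv_def by (intro polyfn_intros assms)

lemma polyfn_prod_system [polyfn_intros]:
  assumes "\<And>j. polyfn C (\<lambda>v. p v j)" "\<And>j. polyfn C (\<lambda>v. q v j)"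
  shows "polyfn C (\<lambda>v. prod_system a i (p v) (q v))"
  unfolding prod_system_def grid_root_def by (intro polyfn_intros assms)

lemma polyfn_ed_family [polyfn_intros]:
  assumes "polyfn UNIV T" "\<And>j. polyfn UNIV (\<lambda>v. p v j)" "\<And>j. polyfn UNIV (\<lambda>v. q v j)"
  shows "polyfn UNIV (\<lambda>v. ed_family a c u i (T v) (p v) (q v))"
  unfolding ed_family_def by (intro polyfn_intros assms)

lemma multiprojective_ed_family: "multiprojective_family (ed_family a c u)"
proof
  show "polyfn UNIV (\<lambda>v. ed_family a c u i (v None) (\<lambda>j. v (Some (j, True))) (\<lambda>j. v (Some (j, False))))" for i
    by (intro polyfn_intros)
  fix i \<tau> p q and s :: "'a \<Rightarrow> complex"
  assume "\<And>j. s j \<noteq> 0"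
  then show "ed_family a c u i \<tau> (\<lambda>j. s j * p j) (\<lambda>j. s j * q j) = 0 \<longleftrightarrow> ed_family a c u i \<tau> p q = 0"
    by (simp add: ed_family_scale)
qed

abbreviation "ed_H a c u \<equiv> multiprojective_family.H (ed_family a c u)"
abbreviation "ed_zeros a c u \<equiv> multiprojective_family.zeros (ed_family a c u)"
abbreviation "ed_good a c u \<equiv> multiprojective_family.good (ed_family a c u)"

lemmas ed_zeros_def = multiprojective_family.zeros_def[OF multiprojective_ed_family]
lemmas ed_H_def = multiprojective_family.H_def[OF multiprojective_ed_family]
lemmas ed_H_pt = multiprojective_family.H_pt[OF multiprojective_ed_family]
lemmas ed_good_def = multiprojective_family.good_def[OF multiprojective_ed_family]

lemma ed_family_1: "ed_family a c u i 1 p q = prod_system a i p q"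
  by (simp add: ed_family_def)

lemma prod_system_eq_0_iff:
  "prod_system a i p q = 0 \<longleftrightarrow> (\<exists>j m. m < a $ j + (if i = j then 1 else 0) \<and> p j = grid_root i j m * q j)"
proof -
  define n where "n = (\<lambda>j. a $ j + (if i = j then 1 else 0))"
  have "prod_system a i p q = (\<Prod>j\<in>UNIV. \<Prod>m<n j. p j - grid_root i j m * q j)"
    by (simp only: prod_system_def n_def)
  also have "\<dots> = 0 \<longleftrightarrow> (\<exists>j m. m < n j \<and> p j = grid_root i j m * q j)" by auto
  finally show ?thesis by (simp only: n_def)
qed

text \<open>Equation \<open>i\<close> vanishes through a factor in some variable \<sigma>(i). A
  point of a projective line cannot equal two distinct finite roots, so \<sigma> is injective; being
  then surjective, it forces every coordinate to be finite.\<close>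

lemma prod_system_zero:
  assumes "\<And>i. prod_system a i p q = 0" "\<And>j. p j \<noteq> 0 \<or> q j \<noteq> 0"
  obtains \<sigma> m where "\<sigma> permutes UNIV" "\<And>i. m i < a $ \<sigma> i + (if i = \<sigma> i then 1 else 0)"
    "\<And>i. p (\<sigma> i) = grid_root i (\<sigma> i) (m i) * q (\<sigma> i)" "\<And>j. q j \<noteq> 0"
proof -
  have "\<exists>j m. m < a $ j + (if i = j then 1 else 0) \<and> p j = grid_root i j m * q j" for i
    using assms(1)[of i] by (simp only: prod_system_eq_0_iff)
  then obtain \<sigma> m where \<sigma>: "\<And>i. m i < a $ \<sigma> i + (if i = \<sigma> i then 1 else 0)"
    "\<And>i. p (\<sigma> i) = grid_root i (\<sigma> i) (m i) * q (\<sigma> i)" by metis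
  have q: "q (\<sigma> i) \<noteq> 0" for i using assms(2)[of "\<sigma> i"] \<sigma>(2)[of i] by auto
  have "inj \<sigma>"
  proof (rule injI)
    fix i i' assume eq: "\<sigma> i = \<sigma> i'"
    have "grid_root i (\<sigma> i) (m i) * q (\<sigma> i) = grid_root i' (\<sigma> i) (m i') * q (\<sigma> i)"
      unfolding eq using \<sigma>(2)[of i, unfolded eq] \<sigma>(2)[of i'] by (rule trans[OF sym])
    then show "i = i'" using q[of i'] by (auto simp: eq)
  qed
  then have bij: "bij \<sigma>" by (simp add: bij_def finite_UNIV_inj_surj)
  then have "\<sigma> permutes UNIV" by (rule bij_imp_permutes) simp
  moreover have "q j \<noteq> 0" for j using q bij by (metis bij_pointE)
  ultimately show ?thesis using that \<sigma> by blast
qed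

lemma zeros_ed_family_1:
  "x \<in> ed_zeros a c u 1 \<longleftrightarrow> (\<forall>i. prod_system a i (($) x) (\<lambda>_. 1) = 0)"
  by (simp add: ed_zeros_def ed_H_pt ed_family_1)

text \<open>At a zero exactly one linear factor of each equation vanishes, in the variable
  \<sigma>(i). So the Jacobian has the shape of a permutation matrix with nonzero entries.\<close>

lemma good_ed_family_1: "ed_good a c u 1"
  unfolding ed_good_def
proof (intro conjI allI impI ballI)
  fix p q j assume "\<forall>j. p j \<noteq> 0 \<or> q j \<noteq> 0" "\<forall>i. ed_family a c u i 1 p q = 0"
  then show "q j \<noteq> 0" using prod_system_zero[of a p q] by (metis ed_family_1)
next
  fix x :: "complex^'a" assume "x \<in> ed_zeros a c u 1"
  then obtain \<sigma> m where \<sigma>: "\<sigma> permutes UNIV" "\<And>i. m i < a $ \<sigma> i + (if i = \<sigma> i then 1 else 0)"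
    and xr: "\<And>i. x $ \<sigma> i = grid_root i (\<sigma> i) (m i)"
    using prod_system_zero[of a "($) x" "\<lambda>_. 1"] by (auto simp: zeros_ed_family_1)
  define B where "B = (\<lambda>i j. a $ j + (if i = j then 1 else 0))"
  define R where "R = (\<lambda>i j. \<Prod>k\<in>-{j}. \<Prod>l<B i k. x $ k - grid_root i k l)"
  have H: "ed_H a c u i ((pt 1 x)(Some j := t)) = (\<Prod>l<B i j. t - grid_root i j l) * R i j" for i j t
  proof -
    have "ed_H a c u i ((pt 1 x)(Some j := t)) = prod_system a i (\<lambda>k. if k = j then t else x $ k) (\<lambda>_. 1)"
      by (simp add: ed_H_def ed_family_1) (simp add: fun_upd_def if_distrib[of "case_option _ _"] cong: if_cong)
    also have "\<dots> = (\<Prod>l<B i j. t - grid_root i j l) * (\<Prod>k\<in>-{j}. \<Prod>l<B i k. (if k = j then t else x $ k) - grid_root i k l)"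
      by (simp add: prod_system_def B_def prod.remove[of UNIV j] Compl_eq_Diff_UNIV)
    also have "(\<Prod>k\<in>-{j}. \<Prod>l<B i k. (if k = j then t else x $ k) - grid_root i k l) = R i j"
      unfolding R_def by (intro prod.cong) auto
    finally show ?thesis .
  qed
  \<comment> \<open>The vanishing factor sits in the variable \<sigma>(i), hence among the factors
    collected in \<open>R i j\<close> when j differs from \<sigma>(i).\<close>
  have off: "pd (Some j) (ed_H a c u i) (pt 1 x) = 0" if "j \<noteq> \<sigma> i" for i j
  proof -
    have "R i j = 0" unfolding R_def
      using that \<sigma>(2)[of i] xr[of i] by (auto intro!: bexI[of _ "\<sigma> i"] bexI[of _ "m i"] simp: B_def)
    then show ?thesis by (simp add: pd_def H)
  qed
  have diag: "pd (Some (\<sigma> i)) (ed_H a c u i) (pt 1 x) \<noteq> 0" for i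
  proof -
    let ?j = "\<sigma> i"
    have "R i ?j \<noteq> 0"
    proof -
      have "x $ k \<noteq> grid_root i k l" if "k \<noteq> ?j" for k l
      proof -
        obtain i' where i': "k = \<sigma> i'" using \<sigma>(1) by (metis permutes_def)
        then show ?thesis using that xr[of i'] by auto
      qed
      then show ?thesis by (auto simp: R_def)
    qed
    have "((\<lambda>t. \<Prod>l<B i ?j. t - grid_root i ?j l) has_field_derivative
        (\<Prod>l\<in>{..<B i ?j} - {m i}. x $ ?j - grid_root i ?j l)) (at (x $ ?j))"
    proof -
      have "(\<Prod>l<B i ?j. t - grid_root i ?j l) =
          (t - x $ ?j) * (\<Prod>l\<in>{..<B i ?j} - {m i}. t - grid_root i ?j l)" for t
        using \<sigma>(2)[of i] by (subst prod.remove[of _ "m i"]) (auto simp: B_def xr)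
      moreover have "(\<lambda>t. \<Prod>l\<in>{..<B i ?j} - {m i}. t - grid_root i ?j l) field_differentiable (at (x $ ?j))"
        by (intro holomorphic_on_imp_differentiable_at[of _ UNIV] holomorphic_intros) auto
      then have "((\<lambda>t. (t - x $ ?j) * (\<Prod>l\<in>{..<B i ?j} - {m i}. t - grid_root i ?j l)) has_field_derivative
         (1 - 0) * (\<Prod>l\<in>{..<B i ?j} - {m i}. x $ ?j - grid_root i ?j l) +
         deriv (\<lambda>t. \<Prod>l\<in>{..<B i ?j} - {m i}. t - grid_root i ?j l) (x $ ?j) * (x $ ?j - x $ ?j)) (at (x $ ?j))"
        by (intro DERIV_mult DERIV_diff DERIV_ident DERIV_const) (simp add: DERIV_deriv_iff_field_differentiable)
      ultimately show ?thesis by simp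
    qed
    from DERIV_mult[OF this DERIV_const[of "R i ?j"]]
    have "pd (Some ?j) (ed_H a c u i) (pt 1 x) = (\<Prod>l\<in>{..<B i ?j} - {m i}. x $ ?j - grid_root i ?j l) * R i ?j"
      by (intro pd_eqI) (simp add: H)
    also have "\<dots> \<noteq> 0" using \<open>R i ?j \<noteq> 0\<close> by (simp add: xr)
    finally show ?thesis .
  qed
  show "det (jac (ed_H a c u) (pt 1 x)) \<noteq> 0"
    unfolding det_nonzero_iff_kernel
  proof (intro allI impI)
    fix h :: "complex^'a"
    assume h: "\<forall>i. (\<Sum>j\<in>UNIV. jac (ed_H a c u) (pt 1 x) $ i $ j * h $ j) = 0"
    have "h $ \<sigma> i = 0" for i
    proof -
      have "0 = (\<Sum>j\<in>UNIV. pd (Some j) (ed_H a c u i) (pt 1 x) * h $ j)" using h by (simp add: jac_def)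
      also have "\<dots> = pd (Some (\<sigma> i)) (ed_H a c u i) (pt 1 x) * h $ \<sigma> i"
        by (subst sum.remove[of _ "\<sigma> i"]) (auto simp: off)
      finally show ?thesis using diag[of i] by simp
    qed
    then show "h = 0" using \<sigma>(1) by (simp add: vec_eq_iff) (metis permutes_def)
  qed
qed

text \<open>Zeros correspond to a permutation with a choice of one factor in each variable it
  selects; counting these pairs gives the permanent.\<close>

lemma card_zeros_ed_family_1:
  "card (ed_zeros a c u 1) = 1 + (\<Sum>k=1..CARD('n). fact k * elem_sym k (a :: nat^'n::finite))"
proof -
  define B where "B = (\<lambda>i j. a $ j + (if i = j then 1 else 0))"
  define A where "A = (SIGMA \<sigma>:{\<sigma>. \<sigma> permutes (UNIV :: 'n set)}. PiE UNIV (\<lambda>i. {..<B i (\<sigma> i)}))"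
  define \<phi> :: "('n \<Rightarrow> 'n) \<times> ('n \<Rightarrow> nat) \<Rightarrow> complex^'n" where
    "\<phi> = (\<lambda>(\<sigma>, m). \<chi> j. grid_root (inv \<sigma> j) j (m (inv \<sigma> j)))"
  have "inj_on \<phi> A"
  proof (rule inj_onI)
    fix y z assume yz: "y \<in> A" "z \<in> A" "\<phi> y = \<phi> z"
    obtain \<sigma> m \<sigma>' m' where eq: "y = (\<sigma>, m)" "z = (\<sigma>', m')" by (cases y, cases z)
    have p: "\<sigma> permutes UNIV" "\<sigma>' permutes UNIV" using yz by (auto simp: A_def eq)
    have e: "inv \<sigma> j = inv \<sigma>' j \<and> m (inv \<sigma> j) = m' (inv \<sigma>' j)" for j
      using arg_cong[OF yz(3), of "\<lambda>v. v $ j"] by (simp add: \<phi>_def eq) metis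
    then have "inv \<sigma> = inv \<sigma>'" by auto
    then have "\<sigma> = \<sigma>'" using p by (metis permutes_inv_inv)
    moreover have "m i = m' i" for i
      using e[of "\<sigma> i"] p \<open>\<sigma> = \<sigma>'\<close> by (simp add: permutes_inverses)
    ultimately show "y = z" by (simp add: eq fun_eq_iff)
  qed
  moreover have "\<phi> ` A = ed_zeros a c u 1"
  proof
    show "\<phi> ` A \<subseteq> ed_zeros a c u 1"
    proof clarify
      fix \<sigma> m assume A: "(\<sigma>, m) \<in> A"
      then have p: "\<sigma> permutes UNIV" and m: "\<And>i. m i < B i (\<sigma> i)" by (auto simp: A_def)
      have "\<phi> (\<sigma>, m) $ \<sigma> i = grid_root i (\<sigma> i) (m i)" for i
        using p by (simp add: \<phi>_def permutes_inverses)
      then have "prod_system a i (($) (\<phi> (\<sigma>, m))) (\<lambda>_. 1) = 0" for i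
        using m[of i] unfolding prod_system_eq_0_iff
        by (intro exI[of _ "\<sigma> i"] exI[of _ "m i"]) (simp add: B_def)
      then show "\<phi> (\<sigma>, m) \<in> ed_zeros a c u 1" by (simp add: zeros_ed_family_1)
    qed
    show "ed_zeros a c u 1 \<subseteq> \<phi> ` A"
    proof
      fix x :: "complex^'n" assume "x \<in> ed_zeros a c u 1"
      then obtain \<sigma> m where \<sigma>: "\<sigma> permutes UNIV" "\<And>i. m i < a $ \<sigma> i + (if i = \<sigma> i then 1 else 0)"
        and xr: "\<And>i. x $ \<sigma> i = grid_root i (\<sigma> i) (m i)"
        using prod_system_zero[of a "($) x" "\<lambda>_. 1"] by (auto simp: zeros_ed_family_1)
      have "(\<sigma>, m) \<in> A" using \<sigma> by (auto simp: A_def B_def)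
      moreover have "x = \<phi> (\<sigma>, m)"
        unfolding \<phi>_def vec_eq_iff using xr[of "inv \<sigma> _"] \<sigma>(1) by (simp add: permutes_inverses)
      ultimately show "x \<in> \<phi> ` A" by blast
    qed
  qed
  ultimately have "card (ed_zeros a c u 1) = card A" by (metis card_image)
  also have "card A = (\<Sum>\<sigma> | \<sigma> permutes UNIV. card (PiE UNIV (\<lambda>i. {..<B i (\<sigma> i)})))"
    unfolding A_def by (rule card_SigmaI) (auto intro: finite_permutations finite_PiE)
  also have "\<dots> = (\<Sum>\<sigma> | \<sigma> permutes UNIV. \<Prod>i\<in>UNIV. a $ \<sigma> i + (if i = \<sigma> i then 1 else 0))"
    by (simp add: card_PiE B_def)
  also have "\<dots> = 1 + (\<Sum>k=1..CARD('n). fact k * elem_sym k a)"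
    using permanent_ones_plus_identity[of "($) a"] sum_fact_elem_sym[of a] by simp
  finally show ?thesis .
qed

lemma card_zeros_ed_family:
  assumes "ed_good a c u \<tau>"
  shows "finite (ed_zeros a c u \<tau>)"
    "card (ed_zeros a c u \<tau>) = 1 + (\<Sum>k=1..CARD('n). fact k * elem_sym k (a :: nat^'n::finite))"
  using multiprojective_family.eventually_card_zeros(1)[OF multiprojective_ed_family assms] multiprojective_family.card_zeros_good[OF multiprojective_ed_family assms good_ed_family_1]
  by (simp_all add: card_zeros_ed_family_1)

text \<open>A finite set of bad parameters does not accumulate at 0. The neighbourhood is punctured
  because 0 itself is in general bad.\<close>

lemma eventually_good_ed_family: "\<forall>\<^sub>F \<tau> in at 0. ed_good a c u \<tau>"
proof -
  have "finite {\<tau>. \<not> ed_good a c u \<tau>}" by (rule multiprojective_family.finite_not_good[OF multiprojective_ed_family good_ed_family_1])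
  then show ?thesis using islimpt_finite[of "{\<tau>. \<not> ed_good a c u \<tau>}" 0]
    by (simp add: islimpt_iff_eventually)
qed

section \<open>Critical points of the distance function\<close>

text \<open>Unknowns: \<open>None\<close> is the parameter \<open>\<tau>\<close>, \<open>Some None\<close> the multiplier and \<open>Some (Some j)\<close> the
  coordinate \<open>x\<^sub>j\<close>. At \<open>\<tau> = 0\<close> this is the Lagrange system; for \<open>\<tau> \<noteq> 0\<close> the first equation eliminates the
  multiplier and leaves \<open>ed_family\<close> divided by \<open>\<tau>\<close>.\<close>

definition lagrange_family :: "nat^'n::finite \<Rightarrow> (('n \<Rightarrow>\<^sub>0 nat) \<Rightarrow> complex) \<Rightarrow> ('n \<Rightarrow> complex) \<Rightarrow> 'n option \<Rightarrow>
    ('n option option \<Rightarrow> complex) \<Rightarrow> complex" where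
  "lagrange_family a c u o' v = (let \<tau> = v None; l = v (Some None); x = (\<lambda>j. v (Some (Some j))) in
     case o' of None \<Rightarrow> hom_poly a c x (\<lambda>_. 1) - \<tau> * l
     | Some i \<Rightarrow> l * (x i - u i) + hom_deriv a i c x (\<lambda>_. 1) +
         \<tau> * (prod_system a i x (\<lambda>_. 1) - (hom_poly a c x (\<lambda>_. 1) * (x i - u i) + \<tau> * hom_deriv a i c x (\<lambda>_. 1))))"

definition lagrange_points :: "nat^'n::finite \<Rightarrow> (('n \<Rightarrow>\<^sub>0 nat) \<Rightarrow> complex) \<Rightarrow> ('n \<Rightarrow> complex) \<Rightarrow> (complex^('n option)) set" where
  "lagrange_points a c u = {z. \<forall>o'. lagrange_family a c u o' (pt 0 z) = 0}"

definition coords :: "complex^('n option) \<Rightarrow> complex^'n" where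
  "coords z = (\<chi> j. z $ Some j)"

definition with_mult :: "complex \<Rightarrow> complex^'n \<Rightarrow> complex^('n option)" where
  "with_mult l x = (\<chi> o'. pt l x o')"

lemma with_mult_simps [simp]: "with_mult l x $ None = l" "with_mult l x $ Some j = x $ j" "coords (with_mult l x) = x"
  by (simp_all add: with_mult_def coords_def vec_eq_iff)

lemma polyfn_lagrange_family: "polyfn UNIV (lagrange_family a c u o')"
  unfolding lagrange_family_def Let_def by (cases o') (auto intro!: polyfn_intros)

lemma lagrange_family_eq_0_iff:
  "(\<forall>o'. lagrange_family a c u o' (pt \<tau> z) = 0) \<longleftrightarrow>
    hom_poly a c (($) (coords z)) (\<lambda>_. 1) = \<tau> * z $ None \<and>
    (\<forall>i. z $ None * (coords z $ i - u i) + hom_deriv a i c (($) (coords z)) (\<lambda>_. 1) +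
         \<tau> * (prod_system a i (($) (coords z)) (\<lambda>_. 1) - (hom_poly a c (($) (coords z)) (\<lambda>_. 1) * (coords z $ i - u i) +
         \<tau> * hom_deriv a i c (($) (coords z)) (\<lambda>_. 1))) = 0)"
proof -
  have "(\<lambda>j. pt \<tau> z (Some (Some j))) = ($) (coords z)" by (simp add: coords_def fun_eq_iff)
  then show ?thesis by (simp add: lagrange_family_def Let_def split_option_all coords_def)
qed

lemma lagrange_points_iff:
  "z \<in> lagrange_points a c u \<longleftrightarrow> hom_poly a c (($) (coords z)) (\<lambda>_. 1) = 0 \<and>
    (\<forall>i. hom_deriv a i c (($) (coords z)) (\<lambda>_. 1) + z $ None * (coords z $ i - u i) = 0)"
  using lagrange_family_eq_0_iff[of a c u 0 z] by (simp add: lagrange_points_def add.commute)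

lemma ed_zeros_iff:
  assumes "\<tau> \<noteq> 0"
  shows "x \<in> ed_zeros a c u \<tau> \<longleftrightarrow>
    (\<forall>o'. lagrange_family a c u o' (pt \<tau> (with_mult (hom_poly a c (($) x) (\<lambda>_. 1) / \<tau>) x)) = 0)"
proof -
  let ?f = "hom_poly a c (($) x) (\<lambda>_. 1)"
  have "ed_H a c u i (pt \<tau> x) = \<tau> * (?f / \<tau> * (x $ i - u i) + hom_deriv a i c (($) x) (\<lambda>_. 1) +
      \<tau> * (prod_system a i (($) x) (\<lambda>_. 1) - (?f * (x $ i - u i) + \<tau> * hom_deriv a i c (($) x) (\<lambda>_. 1))))" for i
    using assms by (simp add: ed_H_pt ed_family_def power2_eq_square field_simps)
  then show ?thesis using assms by (simp add: ed_zeros_def lagrange_family_eq_0_iff)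
qed

lemma lagrange_zero_imp_ed_zeros:
  assumes "\<tau> \<noteq> 0" "\<forall>o'. lagrange_family a c u o' (pt \<tau> z) = 0"
  shows "coords z \<in> ed_zeros a c u \<tau>"
proof -
  have "hom_poly a c (($) (coords z)) (\<lambda>_. 1) / \<tau> = z $ None"
    using assms by (simp add: lagrange_family_eq_0_iff field_simps)
  moreover have "with_mult (z $ None) (coords z) = z"
    by (auto simp: with_mult_def coords_def vec_eq_iff split: option.splits)
  ultimately show ?thesis using assms by (simp add: ed_zeros_iff)
qed

lemma dist_coords:
  fixes y z :: "complex^('n::finite option)"
  shows "dist (coords y) (coords z) \<le> dist y z"
proof -
  have "norm (coords v) \<le> norm v" for v :: "complex^('n option)"
  proof -
    have "(\<Sum>j\<in>UNIV. (norm (v $ Some j))\<^sup>2) = (\<Sum>k\<in>range Some. (norm (v $ k))\<^sup>2)"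
      by (simp add: sum.reindex)
    also have "\<dots> \<le> (\<Sum>k\<in>UNIV. (norm (v $ k))\<^sup>2)" by (rule sum_mono2) auto
    finally show ?thesis unfolding norm_vec_def L2_set_def coords_def by simp
  qed
  from this[of "y - z"] show ?thesis by (simp add: dist_norm coords_def minus_vec_def)
qed

lemma ed_H_0: "v None = 0 \<Longrightarrow> ed_H a c u i v = hom_poly a c (\<lambda>j. v (Some j)) (\<lambda>_. 1) * (v (Some i) - u i)"
  by (simp add: ed_H_def ed_family_def)

lemma polyfn_ed_H: "polyfn UNIV (ed_H a c u i)"
  by (rule multiprojective_family.polyfn_H[OF multiprojective_ed_family])

lemma eventually_nhds_imp_at: "eventually P (nhds x) \<Longrightarrow> eventually P (at x)"
  unfolding eventually_at_filter by (auto elim: eventually_mono)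

lemma tendsto_hom_poly:
  assumes "\<And>j. ((\<lambda>k. p k j) \<longlongrightarrow> p0 j) F" "\<And>j. ((\<lambda>k. q k j) \<longlongrightarrow> q0 j) F"
  shows "((\<lambda>k. hom_poly a c (p k) (q k)) \<longlongrightarrow> hom_poly a c p0 q0) F"
    "((\<lambda>k. hom_deriv a i c (p k) (q k)) \<longlongrightarrow> hom_deriv a i c p0 q0) F"
    "((\<lambda>k. prod_system a i (p k) (q k)) \<longlongrightarrow> prod_system a i p0 q0) F"
  unfolding hom_poly_def hom_deriv_def prod_system_def by (intro tendsto_intros assms)+

text \<open>For small \<tau> \<noteq> 0 every point of \<open>W\<close>, and also \<open>u\<close>,
  has a zero of the family near it. These zeros are different because the points have different
  x-parts: f(u) \<noteq> 0 keeps \<open>u\<close> off the solutions, and then some x_i - u_i is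
  nonzero and determines the multiplier.\<close>

lemma card_isolated_lagrange_points_le:
  fixes a :: "nat^'n::finite" and u :: "complex^'n"
  assumes fu: "hom_poly a c (($) u) (\<lambda>_. 1) \<noteq> 0" and "finite W" and W: "W \<subseteq> lagrange_points a c (($) u)"
    and isolated: "\<And>w. w \<in> W \<Longrightarrow> \<exists>r>0. \<forall>z\<in>cball w r. z \<in> lagrange_points a c (($) u) \<longrightarrow> z = w"
  shows "card W \<le> (\<Sum>k=1..CARD('n). fact k * elem_sym k a)"
proof -
  let ?L = "lagrange_points a c (($) u)"
  have not_u: "coords w \<noteq> u" if "w \<in> ?L" for w
    using that fu by (auto simp: lagrange_points_iff)
  have "inj_on coords W"
  proof (rule inj_onI)
    fix w z assume wz: "w \<in> W" "z \<in> W" "coords w = coords z"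
    obtain i where i: "coords w $ i \<noteq> u $ i" using not_u[of w] wz(1) W by (auto simp: vec_eq_iff)
    have "w \<in> ?L" "z \<in> ?L" using wz W by auto
    then have "w $ None * (coords w $ i - u $ i) = z $ None * (coords w $ i - u $ i)"
      unfolding lagrange_points_iff wz(3) by (metis add_left_cancel)
    then have "w $ None = z $ None" using i by simp
    then show "w = z" using wz(3) by (simp add: vec_eq_iff coords_def split_option_all)
  qed
  define S where "S = insert u (coords ` W)"
  have card_S: "card S = card W + 1"
  proof -
    have "u \<notin> coords ` W" using not_u W by blast
    then show ?thesis using card_image[OF \<open>inj_on coords W\<close>] \<open>finite W\<close> by (simp add: S_def)
  qed
  obtain e where e: "e > 0" "\<And>x y. x \<in> S \<Longrightarrow> y \<in> S \<Longrightarrow> x \<noteq> y \<Longrightarrow> 2 * e \<le> dist x y"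
    using finite_separated[of S] \<open>finite W\<close> unfolding S_def by blast
  have 1: "\<forall>\<^sub>F \<tau> in nhds 0. \<exists>z\<in>ball w e. \<forall>o'. lagrange_family a c (($) u) o' (pt \<tau> z) = 0" if w: "w \<in> W" for w
  proof -
    obtain r where r: "r > 0" "\<And>z. z \<in> cball w r \<Longrightarrow> z \<in> ?L \<Longrightarrow> z = w" using isolated[OF w] by blast
    have "\<forall>\<^sub>F \<tau> in nhds 0. \<exists>z\<in>ball w (min r e). \<forall>o'. lagrange_family a c (($) u) o' (pt \<tau> z) = 0"
    proof (rule isolated_zero_persists[OF polyfn_lagrange_family])
      show "lagrange_family a c (($) u) o' (pt 0 w) = 0" for o' using w W by (auto simp: lagrange_points_def)
      show "0 < min r e" using r(1) e(1) by simp
      show "z = w" if "z \<in> cball w (min r e)" "\<And>o'. lagrange_family a c (($) u) o' (pt 0 z) = 0" for z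
        using that by (intro r(2)) (auto simp: lagrange_points_def)
    qed
    then show ?thesis by eventually_elim auto
  qed
  have 2: "\<forall>\<^sub>F \<tau> in nhds 0. \<exists>x\<in>ball u e. \<forall>i. ed_H a c (($) u) i (pt \<tau> x) = 0"
  proof -
    \<comment> \<open>At \<tau> = 0 the equations read f(x) (x_i - u_i) = 0, and f does not vanish
      near \<open>u\<close>, so \<open>u\<close> is an isolated zero.\<close>
    have "((\<lambda>x. hom_poly a c (($) x) (\<lambda>_. 1)) \<longlongrightarrow> hom_poly a c (($) u) (\<lambda>_. 1)) (nhds u)"
      by (intro tendsto_hom_poly tendsto_const tendsto_vec_nth filterlim_ident)
    then have "\<forall>\<^sub>F x in nhds u. hom_poly a c (($) x) (\<lambda>_. 1) \<noteq> 0" using fu by (rule tendsto_imp_eventually_ne)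
    then obtain d where d: "d > 0" "\<And>x. dist x u < d \<Longrightarrow> hom_poly a c (($) x) (\<lambda>_. 1) \<noteq> 0"
      unfolding eventually_nhds_metric by blast
    have "\<forall>\<^sub>F \<tau> in nhds 0. \<exists>x\<in>ball u (min (d / 2) e). \<forall>i. ed_H a c (($) u) i (pt \<tau> x) = 0"
    proof (rule isolated_zero_persists[OF polyfn_ed_H])
      show "ed_H a c (($) u) i (pt 0 u) = 0" for i by (simp add: ed_H_0)
      show "0 < min (d / 2) e" using d(1) e(1) by simp
      fix x assume x: "x \<in> cball u (min (d / 2) e)" "\<And>i. ed_H a c (($) u) i (pt 0 x) = 0"
      have "dist x u < d" using x(1) d(1) by (simp add: dist_commute)
      then show "x = u" using x(2) d(2) by (simp add: ed_H_0 vec_eq_iff)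
    qed
    then show ?thesis by eventually_elim auto
  qed
  have "\<forall>\<^sub>F \<tau> in nhds 0. \<forall>w\<in>W. \<exists>z\<in>ball w e. \<forall>o'. lagrange_family a c (($) u) o' (pt \<tau> z) = 0"
    unfolding eventually_ball_finite_distrib[OF \<open>finite W\<close>] using 1 by blast
  with 2 have "\<forall>\<^sub>F \<tau> in at 0. (\<forall>w\<in>W. \<exists>z\<in>ball w e. \<forall>o'. lagrange_family a c (($) u) o' (pt \<tau> z) = 0) \<and>
      (\<exists>x\<in>ball u e. \<forall>i. ed_H a c (($) u) i (pt \<tau> x) = 0) \<and> ed_good a c (($) u) \<tau> \<and> \<tau> \<noteq> 0"
    by (intro eventually_conj eventually_good_ed_family eventually_neq_at_within eventually_nhds_imp_at)
  then obtain \<tau> where \<tau>: "\<And>w. w \<in> W \<Longrightarrow> \<exists>z\<in>ball w e. \<forall>o'. lagrange_family a c (($) u) o' (pt \<tau> z) = 0"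
      "\<exists>x\<in>ball u e. \<forall>i. ed_H a c (($) u) i (pt \<tau> x) = 0" "ed_good a c (($) u) \<tau>" "\<tau> \<noteq> 0"
    using eventually_happens'[OF at_neq_bot] by blast
  have "card S \<le> card (ed_zeros a c (($) u) \<tau>)"
  proof (rule card_le_near[OF card_zeros_ed_family(1)[OF \<tau>(3)] e(2)])
    fix x assume "x \<in> S"
    then show "\<exists>z\<in>ed_zeros a c (($) u) \<tau>. dist x z < e"
      unfolding S_def
    proof
      assume "x = u" then show ?thesis using \<tau>(2) by (auto simp: ed_zeros_def)
    next
      assume "x \<in> coords ` W"
      then obtain w where w: "w \<in> W" "x = coords w" by blast
      obtain z where z: "z \<in> ball w e" "\<forall>o'. lagrange_family a c (($) u) o' (pt \<tau> z) = 0" using \<tau>(1)[OF w(1)] by blast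
      have "dist x (coords z) < e" using dist_coords[of w z] z(1) w(2) by simp
      then show ?thesis using lagrange_zero_imp_ed_zeros[OF \<tau>(4) z(2)] by blast
    qed
  qed
  then show ?thesis using card_zeros_ed_family(2)[OF \<tau>(3)] card_S by simp
qed

lemma hom_poly_affine:
  assumes "\<And>j. q j \<noteq> 0"
  shows "hom_poly a c p q = (\<Prod>j\<in>UNIV. q j ^ a $ j) * hom_poly a c (\<lambda>j. p j / q j) (\<lambda>_. 1)"
  using hom_poly_scale[of a c q "\<lambda>j. p j / q j" "\<lambda>_. 1"] assms by simp

text \<open>As \<open>\<tau> \<rightarrow> 0\<close>, a zero of the family tends to \<open>u\<close> or, together with its multiplier, to a critical
  point: smoothness of the closure of the hypersurface in \<open>(P\<^sup>1)\<^sup>n\<close> prevents escape to infinity.\<close>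

lemma ed_zeros_limit:
  fixes a :: "nat^'n::finite" and u :: "complex^'n"
  assumes fu: "hom_poly a c (($) u) (\<lambda>_. 1) \<noteq> 0"
    and smooth: "\<And>p q. (\<And>j. p j \<noteq> 0 \<or> q j \<noteq> 0) \<Longrightarrow> hom_poly a c p q = 0 \<Longrightarrow> \<exists>i. q i \<noteq> 0 \<and> hom_deriv a i c p q \<noteq> 0"
    and \<tau>: "\<tau> \<longlonglongrightarrow> 0" "\<And>k. \<tau> k \<noteq> 0" and x: "\<And>k. x k \<in> ed_zeros a c (($) u) (\<tau> k)"
  obtains r :: "nat \<Rightarrow> nat" where "strict_mono r" "(\<lambda>k. x (r k)) \<longlonglongrightarrow> u"
  | r :: "nat \<Rightarrow> nat" and z where "strict_mono r" "z \<in> lagrange_points a c (($) u)"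
    "(\<lambda>k. with_mult (hom_poly a c (($) (x (r k))) (\<lambda>_. 1) / \<tau> (r k)) (x (r k))) \<longlonglongrightarrow> z"
proof -
  have "\<exists>pq. pq \<in> proj_chart \<and> (\<forall>j. snd pq $ j \<noteq> 0) \<and> (\<forall>j. x k $ j = fst pq $ j / snd pq $ j)" for k
    using proj_chart_affine[of "x k"] by (metis fst_conv snd_conv)
  then obtain y where y: "\<And>k. y k \<in> proj_chart" "\<And>k j. snd (y k) $ j \<noteq> 0"
    "\<And>k j. x k $ j = fst (y k) $ j / snd (y k) $ j" by metis
  obtain r p0 q0 where r: "strict_mono (r :: nat \<Rightarrow> nat)" "(p0, q0) \<in> proj_chart"
    "(\<lambda>k. fst (y (r k))) \<longlonglongrightarrow> p0" "(\<lambda>k. snd (y (r k))) \<longlonglongrightarrow> q0"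
    by (rule proj_chart_subseq[of y, OF y(1)])
  define t where "t = (\<lambda>k. \<tau> (r k))"
  define p where "p = (\<lambda>k. ($) (fst (y (r k))))"
  define q where "q = (\<lambda>k. ($) (snd (y (r k))))"
  have t: "t \<longlonglongrightarrow> 0" "t k \<noteq> 0" for k
    using LIMSEQ_subseq_LIMSEQ[OF \<tau>(1) r(1)] \<tau>(2) by (simp_all add: t_def o_def)
  have lim_p: "(\<lambda>k. p k j) \<longlonglongrightarrow> p0 $ j" and lim_q: "(\<lambda>k. q k j) \<longlonglongrightarrow> q0 $ j" for j
    unfolding p_def q_def by (intro tendsto_vec_nth r)+
  have q: "q k j \<noteq> 0" for k j by (simp add: q_def y(2))
  have xpq: "x (r k) $ j = p k j / q k j" for k j by (simp add: p_def q_def y(3))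
  have chart0: "p0 $ j \<noteq> 0 \<or> q0 $ j \<noteq> 0" for j using proj_chart_nonzero[OF r(2)] .
  have fam: "ed_family a c (($) u) i (t k) (p k) (q k) = 0" for i k
  proof -
    have "(\<chi> j. p k j / q k j) = x (r k)" by (simp add: vec_eq_iff xpq)
    then show ?thesis
      using multiprojective_family.Hh_affine[OF multiprojective_ed_family, where q = "q k" and p = "p k"] x[of "r k"] q
      by (simp add: ed_zeros_def t_def)
  qed
  define f where "f = (\<lambda>k. hom_poly a c (p k) (q k))"
  define d where "d = (\<lambda>i k. hom_deriv a i c (p k) (q k))"
  define f0 where "f0 = hom_poly a c (($) p0) (($) q0)"
  define d0 where "d0 = (\<lambda>i. hom_deriv a i c (($) p0) (($) q0))"
  define g where "g = (\<lambda>i k. prod_system a i (p k) (q k))"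
  \<comment> \<open>Up to the homogenising factor this is the multiplier f / \<tau>.\<close>
  define \<phi> where "\<phi> = (\<lambda>k. f k / t k)"
  have lim_f: "f \<longlonglongrightarrow> f0" and lim_d: "d i \<longlonglongrightarrow> d0 i" for i
    unfolding f_def f0_def d_def d0_def by (intro tendsto_hom_poly lim_p lim_q)+
  have lim_g: "g i \<longlonglongrightarrow> prod_system a i (($) p0) (($) q0)" for i
    unfolding g_def by (intro tendsto_hom_poly lim_p lim_q)
  have lim_pq: "(\<lambda>k. p k i - u $ i * q k i) \<longlonglongrightarrow> p0 $ i - u $ i * q0 $ i" for i
    by (intro tendsto_intros lim_p lim_q)
  have eq: "(1 - (t k)\<^sup>2) * (\<phi> k * (p k i - u $ i * q k i)) = - ((1 - (t k)\<^sup>2) * ((q k i)\<^sup>2 * d i k) + t k * g i k)" for i k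
  proof -
    have "t k * ((1 - (t k)\<^sup>2) * (\<phi> k * (p k i - u $ i * q k i)) + ((1 - (t k)\<^sup>2) * ((q k i)\<^sup>2 * d i k) + t k * g i k)) = 0"
    proof -
      have "f k = t k * \<phi> k" using t(2)[of k] by (simp add: \<phi>_def)
      moreover have "(1 - (t k)\<^sup>2) * (f k * (p k i - u $ i * q k i) + t k * (q k i)\<^sup>2 * d i k) + (t k)\<^sup>2 * g i k = 0"
        using fam[of i k] by (simp add: ed_family_def f_def d_def g_def)
      ultimately show ?thesis by (simp add: power2_eq_square algebra_simps)
    qed
    then have "(1 - (t k)\<^sup>2) * (\<phi> k * (p k i - u $ i * q k i)) + ((1 - (t k)\<^sup>2) * ((q k i)\<^sup>2 * d i k) + t k * g i k) = 0"
      using t(2)[of k] by simp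
    then show ?thesis by (simp only: eq_neg_iff_add_eq_0)
  qed
  \<comment> \<open>The family divided by \<tau> expresses this product through quantities that
    converge, although \<open>\<phi>\<close> itself is not yet known to be bounded.\<close>
  have lim_\<phi>: "(\<lambda>k. \<phi> k * (p k i - u $ i * q k i)) \<longlonglongrightarrow> - ((q0 $ i)\<^sup>2 * d0 i)" for i
  proof -
    have "(\<lambda>k. - ((1 - (t k)\<^sup>2) * ((q k i)\<^sup>2 * d i k) + t k * g i k) / (1 - (t k)\<^sup>2)) \<longlonglongrightarrow>
        - ((1 - 0\<^sup>2) * ((q0 $ i)\<^sup>2 * d0 i) + 0 * prod_system a i (($) p0) (($) q0)) / (1 - 0\<^sup>2)"
      by (intro tendsto_intros t lim_q lim_d lim_g) simp
    moreover have "\<forall>\<^sub>F k in sequentially. 1 - (t k)\<^sup>2 \<noteq> 0"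
    proof -
      have "(\<lambda>k. 1 - (t k)\<^sup>2) \<longlonglongrightarrow> 1 - 0\<^sup>2" by (intro tendsto_intros t)
      then show ?thesis by (rule tendsto_imp_eventually_ne) simp
    qed
    then have "\<forall>\<^sub>F k in sequentially. - ((1 - (t k)\<^sup>2) * ((q k i)\<^sup>2 * d i k) + t k * g i k) / (1 - (t k)\<^sup>2) =
        \<phi> k * (p k i - u $ i * q k i)"
    proof eventually_elim
      case (elim k)
      then show ?case unfolding eq[symmetric] by simp
    qed
    ultimately show ?thesis using Lim_transform_eventually by fastforce
  qed
  have lim_x: "(\<lambda>k. x (r k)) \<longlonglongrightarrow> (\<chi> j. p0 $ j / q0 $ j)" if "\<And>j. q0 $ j \<noteq> 0"
    by (rule vec_tendstoI) (simp add: xpq, intro tendsto_intros lim_p lim_q that)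
  \<comment> \<open>The limit lies on the hypersurface and \<open>u\<close> does not, so some
    coordinate separates them; dividing by its difference makes \<open>\<phi>\<close>
    converge.\<close>
  have u_or: "\<exists>j. p0 $ j \<noteq> u $ j * q0 $ j" if "f0 = 0"
  proof (rule ccontr)
    assume "\<not> ?thesis"
    then have pj: "p0 $ j = u $ j * q0 $ j" for j by blast
    then have nz: "q0 $ j \<noteq> 0" for j using chart0[of j] by auto
    have "(\<lambda>j. p0 $ j / q0 $ j) = ($) u" using pj nz by (simp add: fun_eq_iff)
    then have "f0 = (\<Prod>j\<in>UNIV. (q0 $ j) ^ a $ j) * hom_poly a c (($) u) (\<lambda>_. 1)"
      unfolding f0_def using hom_poly_affine[of "($) q0" a c "($) p0"] nz by simp
    then show False using fu nz that by simp
  qed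
  show ?thesis
  proof (cases "f0 = 0")
    case False
    have "(\<lambda>k. ed_family a c (($) u) i (t k) (p k) (q k)) \<longlonglongrightarrow> ed_family a c (($) u) i 0 (($) p0) (($) q0)" for i
      by (rule multiprojective_family.tendsto_Hh[OF multiprojective_ed_family t(1) lim_p lim_q])
    then have "ed_family a c (($) u) i 0 (($) p0) (($) q0) = 0" for i
      by (simp add: fam LIMSEQ_const_iff)
    then have pj: "p0 $ j = u $ j * q0 $ j" for j
      using False by (simp add: ed_family_def f0_def)
    then have nz: "q0 $ j \<noteq> 0" for j using chart0[of j] by auto
    have "(\<chi> j. p0 $ j / q0 $ j) = u" using pj nz by (simp add: vec_eq_iff)
    then show ?thesis using that(1)[OF r(1)] lim_x nz by simp
  next
    case True
    \<comment> \<open>For a coordinate at infinity the difference tends to p_j \<noteq> 0 while the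
      right-hand side tends to 0, so \<open>\<phi>\<close> tends to 0. Then the remaining equations
      annihilate all derivatives in finite directions, against smoothness.\<close>
    have nz: "q0 $ j \<noteq> 0" for j
    proof
      assume j: "q0 $ j = 0"
      then have pj: "p0 $ j \<noteq> 0" using chart0[of j] by simp
      have "(\<lambda>k. \<phi> k * (p k j - u $ j * q k j) / (p k j - u $ j * q k j)) \<longlonglongrightarrow>
          - ((q0 $ j)\<^sup>2 * d0 j) / (p0 $ j - u $ j * q0 $ j)"
        by (rule tendsto_divide[OF lim_\<phi> lim_pq]) (use j pj in simp)
      moreover have "\<forall>\<^sub>F k in sequentially. p k j - u $ j * q k j \<noteq> 0"
        by (rule tendsto_imp_eventually_ne[OF lim_pq]) (use j pj in simp)
      then have "\<forall>\<^sub>F k in sequentially. \<phi> k * (p k j - u $ j * q k j) / (p k j - u $ j * q k j) = \<phi> k"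
        by eventually_elim simp
      ultimately have "\<phi> \<longlonglongrightarrow> 0" using Lim_transform_eventually[of _ _ _ \<phi>] j by fastforce
      then have "(\<lambda>k. \<phi> k * (p k i - u $ i * q k i)) \<longlonglongrightarrow> 0 * (p0 $ i - u $ i * q0 $ i)" for i
        by (rule tendsto_mult[OF _ lim_pq])
      then have "(q0 $ i)\<^sup>2 * d0 i = 0" for i using LIMSEQ_unique[OF lim_\<phi>[of i]] by fastforce
      moreover have "\<exists>i. q0 $ i \<noteq> 0 \<and> d0 i \<noteq> 0"
        unfolding d0_def by (rule smooth) (use chart0 True in \<open>auto simp: f0_def\<close>)
      ultimately show False by auto
    qed
    obtain j where j: "p0 $ j \<noteq> u $ j * q0 $ j" using u_or[OF True] by blast
    \<comment> \<open>Dividing by \<open>Q\<close> passes from homogeneous to affine values of f;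
      its limit is nonzero because no coordinate is at infinity.\<close>
    define Q where "Q = (\<lambda>k. \<Prod>j\<in>UNIV. q k j ^ a $ j)"
    define l where "l = (- ((q0 $ j)\<^sup>2 * d0 j) / (p0 $ j - u $ j * q0 $ j)) / (\<Prod>j\<in>UNIV. (q0 $ j) ^ a $ j)"
    have "(\<lambda>k. (\<phi> k * (p k j - u $ j * q k j) / (p k j - u $ j * q k j)) / Q k) \<longlonglongrightarrow> l"
      unfolding l_def Q_def
      by (intro tendsto_divide lim_\<phi> lim_pq tendsto_prod tendsto_power lim_q) (use j nz in auto)
    moreover have "\<forall>\<^sub>F k in sequentially. p k j - u $ j * q k j \<noteq> 0"
      by (rule tendsto_imp_eventually_ne[OF lim_pq]) (use j in simp)
    then have "\<forall>\<^sub>F k in sequentially. (\<phi> k * (p k j - u $ j * q k j) / (p k j - u $ j * q k j)) / Q k =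
        hom_poly a c (($) (x (r k))) (\<lambda>_. 1) / t k"
    proof eventually_elim
      case (elim k)
      have "(\<lambda>j. p k j / q k j) = ($) (x (r k))" by (simp add: fun_eq_iff xpq)
      then have "f k = Q k * hom_poly a c (($) (x (r k))) (\<lambda>_. 1)"
        unfolding f_def Q_def using hom_poly_affine[of "q k" a c "p k"] q by simp
      moreover have "Q k \<noteq> 0" by (simp add: Q_def q)
      ultimately show ?case using elim by (simp add: \<phi>_def)
    qed
    ultimately have lim_l: "(\<lambda>k. hom_poly a c (($) (x (r k))) (\<lambda>_. 1) / t k) \<longlonglongrightarrow> l"
      by (rule Lim_transform_eventually)
    define z where "z = with_mult l (\<chi> j. p0 $ j / q0 $ j)"
    define zk where "zk = (\<lambda>k. with_mult (hom_poly a c (($) (x (r k))) (\<lambda>_. 1) / t k) (x (r k)))"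
    have lim_z: "zk \<longlonglongrightarrow> z"
    proof (rule vec_tendstoI)
      show "(\<lambda>k. zk k $ o') \<longlonglongrightarrow> z $ o'" for o'
        using lim_l tendsto_vec_nth[OF lim_x[OF nz]] by (cases o') (auto simp: zk_def z_def)
    qed
    have "lagrange_family a c (($) u) o' (pt (t k) (zk k)) = 0" for o' k
      using x[of "r k"] ed_zeros_iff[OF t(2)[of k], of "x (r k)" a c "($) u"] by (simp add: zk_def t_def)
    moreover have "(\<lambda>k. lagrange_family a c (($) u) o' (pt (t k) (zk k))) \<longlonglongrightarrow> lagrange_family a c (($) u) o' (pt 0 z)" for o'
      by (rule tendsto_polyfn[OF polyfn_lagrange_family])
        (intro multiprojective_family.tendsto_pt[OF multiprojective_ed_family] t lim_z)
    ultimately have "z \<in> lagrange_points a c (($) u)"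
      by (simp add: LIMSEQ_const_iff lagrange_points_def)
    then show ?thesis using that(2)[OF r(1)] lim_z unfolding zk_def t_def by blast
  qed
qed

text \<open>The Jacobian of f(x) (x_i - u_i) at \<open>u\<close> is f(u) times the identity. So
  exactly one zero of the family emanates from \<open>u\<close>.\<close>

lemma det_jac_ed_H_at:
  assumes "hom_poly a c (($) u) (\<lambda>_. 1) \<noteq> 0"
  shows "det (jac (ed_H a c (($) u)) (pt 0 u)) \<noteq> 0"
proof -
  let ?f = "hom_poly a c (($) u) (\<lambda>_. 1)"
  have "pd (Some j) (ed_H a c (($) u) i) (pt 0 u) = (if i = j then ?f else 0)" for i j
  proof (rule pd_eqI)
    let ?g = "\<lambda>v. hom_poly a c (\<lambda>j. v (Some j)) (\<lambda>_. 1)"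
    let ?v = "\<lambda>t. (pt 0 u)(Some j := t)"
    have g: "polyfn UNIV ?g" by (intro polyfn_intros)
    have d: "((\<lambda>t. ?v t (Some i) - u $ i) has_field_derivative (if i = j then 1 else 0)) (at (pt 0 u (Some j)))"
      by (cases "i = j") (auto intro!: derivative_eq_intros)
    have "((\<lambda>t. ?g (?v t) * (?v t (Some i) - u $ i)) has_field_derivative
        pd (Some j) ?g (pt 0 u) * ((?v (pt 0 u (Some j))) (Some i) - u $ i) + (if i = j then 1 else 0) * ?g (?v (pt 0 u (Some j))))
      (at (pt 0 u (Some j)))"
      by (rule DERIV_mult[OF DERIV_pd'[OF g, of "pt 0 u" "Some j"] d])
    moreover have "ed_H a c (($) u) i (?v t) = ?g (?v t) * (?v t (Some i) - u $ i)" for t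
      by (rule ed_H_0) simp
    moreover have "?v (pt 0 u (Some j)) = pt 0 u" by (rule fun_upd_triv)
    ultimately show "((\<lambda>t. ed_H a c (($) u) i (?v t)) has_field_derivative (if i = j then ?f else 0)) (at (pt 0 u (Some j)))"
      by (cases "i = j") (simp_all del: fun_upd_apply)
  qed
  then show ?thesis
    using assms unfolding det_nonzero_iff_kernel
    by (simp add: jac_def vec_eq_iff if_distrib[of "\<lambda>c. c * _"] cong: if_cong)
qed

text \<open>Nondegenerate solutions are isolated, which gives one inequality. For the other, the N +
  1 zeros at a small \<tau> lie near \<open>u\<close> or, with their multipliers, near solutions,
  and local uniqueness allows at most one zero near each.\<close>

theorem card_lagrange_points:
  fixes a :: "nat^'n::finite" and u :: "complex^'n"
  assumes fu: "hom_poly a c (($) u) (\<lambda>_. 1) \<noteq> 0"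
    and smooth: "\<And>p q. (\<And>j. p j \<noteq> 0 \<or> q j \<noteq> 0) \<Longrightarrow> hom_poly a c p q = 0 \<Longrightarrow> \<exists>i. q i \<noteq> 0 \<and> hom_deriv a i c p q \<noteq> 0"
    and nondegenerate: "\<And>z. z \<in> lagrange_points a c (($) u) \<Longrightarrow> det (jac (lagrange_family a c (($) u)) (pt 0 z)) \<noteq> 0"
  shows "finite (lagrange_points a c (($) u))"
    and "card (lagrange_points a c (($) u)) = (\<Sum>k=1..CARD('n). fact k * elem_sym k a)"
proof -
  let ?L = "lagrange_points a c (($) u)"
  let ?F = "lagrange_family a c (($) u)"
  let ?N = "\<Sum>k=1..CARD('n). fact k * elem_sym k a"
  have curve: "\<exists>T X \<xi>. open T \<and> 0 \<in> T \<and> open X \<and> z \<in> X \<and> \<xi> 0 = z \<and>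
      (\<forall>t\<in>T. \<forall>y\<in>X. (\<forall>o'. ?F o' (pt t y) = 0) \<longrightarrow> y = \<xi> t)" if z: "z \<in> ?L" for z
  proof -
    have zero: "\<And>o'. ?F o' (pt 0 z) = 0" using z by (simp add: lagrange_points_def)
    obtain T X \<xi> where "open T" "0 \<in> T" "open X" "z \<in> X" "X \<subseteq> UNIV" "\<xi> 0 = z"
      "\<And>t. t \<in> T \<Longrightarrow> \<xi> t \<in> X" "\<And>t o'. t \<in> T \<Longrightarrow> ?F o' (pt t (\<xi> t)) = 0"
      "\<And>t y. t \<in> T \<Longrightarrow> y \<in> X \<Longrightarrow> (\<And>o'. ?F o' (pt t y) = 0) \<Longrightarrow> y = \<xi> t"
      "\<And>o'. (\<lambda>t. \<xi> t $ o') holomorphic_on T"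
      using implicit_curve[OF polyfn_lagrange_family zero nondegenerate[OF z] open_UNIV UNIV_I] by blast
    then show ?thesis by (intro exI[of _ T] exI[of _ X] exI[of _ \<xi>]) simp
  qed
  \<comment> \<open>Bounding all finite subsets at once yields finiteness together with the
    bound.\<close>
  have "finite ?L \<and> card ?L \<le> ?N"
  proof (rule finite_if_finite_subsets_card_bdd)
    fix W assume W: "W \<subseteq> ?L" "finite W"
    show "card W \<le> ?N"
    proof (rule card_isolated_lagrange_points_le[OF fu W(2,1)])
      fix w assume "w \<in> W"
      then obtain T X \<xi> where X: "0 \<in> T" "open X" "w \<in> X" "\<xi> 0 = w"
        "\<forall>t\<in>T. \<forall>y\<in>X. (\<forall>o'. ?F o' (pt t y) = 0) \<longrightarrow> y = \<xi> t" using curve[of w] W(1) by (auto simp: subset_iff)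
      obtain r where "r > 0" "cball w r \<subseteq> X" using X(2,3) open_contains_cball by blast
      then show "\<exists>r>0. \<forall>z\<in>cball w r. z \<in> ?L \<longrightarrow> z = w"
        using X(1,4,5) by (intro exI[of _ r]) (auto simp: lagrange_points_def subset_iff)
    qed
  qed
  then have fin: "finite ?L" and le: "card ?L \<le> ?N" by auto
  show "finite ?L" by (rule fin)
  obtain T X \<xi> where T: "\<And>z. z \<in> ?L \<Longrightarrow> open (T z) \<and> 0 \<in> T z \<and> open (X z) \<and> z \<in> X z \<and> \<xi> z 0 = z \<and>
      (\<forall>t\<in>T z. \<forall>y\<in>X z. (\<forall>o'. ?F o' (pt t y) = 0) \<longrightarrow> y = \<xi> z t)" using curve by metis
  have zero_u: "\<And>i. ed_H a c (($) u) i (pt 0 u) = 0" by (simp add: ed_H_0)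
  obtain Tu Xu \<xi>u where U: "open Tu" "0 \<in> Tu" "open Xu" "u \<in> Xu" "Xu \<subseteq> UNIV" "\<xi>u 0 = u"
      "\<And>t. t \<in> Tu \<Longrightarrow> \<xi>u t \<in> Xu" "\<And>t i. t \<in> Tu \<Longrightarrow> ed_H a c (($) u) i (pt t (\<xi>u t)) = 0"
      "\<And>t y. t \<in> Tu \<Longrightarrow> y \<in> Xu \<Longrightarrow> (\<And>i. ed_H a c (($) u) i (pt t y) = 0) \<Longrightarrow> y = \<xi>u t"
      "\<And>i. (\<lambda>t. \<xi>u t $ i) holomorphic_on Tu"
    using implicit_curve[OF polyfn_ed_H zero_u det_jac_ed_H_at[OF fu] open_UNIV UNIV_I] by blast
  \<comment> \<open>\<open>x\<close> lies in the uniqueness neighbourhood of \<open>u\<close>, or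
    its lift with multiplier f / \<tau> lies in that of a solution.\<close>
  define B where "B = (\<lambda>\<tau> x. x \<in> Xu \<or> (\<exists>z\<in>?L. with_mult (hom_poly a c (($) x) (\<lambda>_. 1) / \<tau>) x \<in> X z))"
  have near: "\<forall>\<^sub>F \<tau> in nhds 0. \<tau> \<noteq> 0 \<longrightarrow> (\<forall>x\<in>ed_zeros a c (($) u) \<tau>. B \<tau> x)"
  proof (rule ccontr)
    assume "\<not> ?thesis"
    then have "\<exists>\<tau>. \<tau> \<longlonglongrightarrow> 0 \<and> (\<forall>k. \<not> (\<tau> k \<noteq> 0 \<longrightarrow> (\<forall>x\<in>ed_zeros a c (($) u) (\<tau> k). B (\<tau> k) x)))"
      by (rule not_eventually_nhds_sequence) blast
    then obtain \<tau> where \<tau>: "\<tau> \<longlonglongrightarrow> 0" "\<And>k. \<not> (\<tau> k \<noteq> 0 \<longrightarrow> (\<forall>x\<in>ed_zeros a c (($) u) (\<tau> k). B (\<tau> k) x))"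
      by (elim exE conjE) blast
    then have "\<forall>k. \<exists>x. x \<in> ed_zeros a c (($) u) (\<tau> k) \<and> \<not> B (\<tau> k) x" by blast
    from choice[OF this] obtain x where "\<forall>k. x k \<in> ed_zeros a c (($) u) (\<tau> k) \<and> \<not> B (\<tau> k) (x k)" ..
    then have x: "\<And>k. x k \<in> ed_zeros a c (($) u) (\<tau> k)" "\<And>k. \<not> B (\<tau> k) (x k)" by auto
    have nz: "\<tau> k \<noteq> 0" for k using \<tau>(2) by blast
    consider r :: "nat \<Rightarrow> nat" where "strict_mono r" "(\<lambda>k. x (r k)) \<longlonglongrightarrow> u"
      | r :: "nat \<Rightarrow> nat" and z where "strict_mono r" "z \<in> ?L"
        "(\<lambda>k. with_mult (hom_poly a c (($) (x (r k))) (\<lambda>_. 1) / \<tau> (r k)) (x (r k))) \<longlonglongrightarrow> z"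
      by (rule ed_zeros_limit[OF fu smooth \<tau>(1) nz x(1)])
    then show False
    proof cases
      case 1
      have "\<forall>\<^sub>F k in sequentially. x (r k) \<in> Xu" using 1(2) U(3,4) by (rule topological_tendstoD)
      then obtain k where "x (r k) \<in> Xu" by (auto simp: eventually_sequentially)
      then show False using x(2)[of "r k"] by (simp add: B_def)
    next
      case 2
      have "open (X z)" "z \<in> X z" using T[OF 2(2)] by auto
      with 2(3) have "\<forall>\<^sub>F k in sequentially. with_mult (hom_poly a c (($) (x (r k))) (\<lambda>_. 1) / \<tau> (r k)) (x (r k)) \<in> X z"
        by (rule topological_tendstoD)
      then obtain k where "with_mult (hom_poly a c (($) (x (r k))) (\<lambda>_. 1) / \<tau> (r k)) (x (r k)) \<in> X z"
        by (auto simp: eventually_sequentially)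
      then show False using x(2)[of "r k"] 2(2) by (auto simp: B_def)
    qed
  qed
  have inT: "\<forall>\<^sub>F \<tau> in nhds 0. \<forall>z\<in>?L. \<tau> \<in> T z"
    unfolding eventually_ball_finite_distrib[OF fin] using T eventually_nhds_in_open by blast
  have inTu: "\<forall>\<^sub>F \<tau> in nhds 0. \<tau> \<in> Tu" using U(1,2) by (rule eventually_nhds_in_open)
  have "\<forall>\<^sub>F \<tau> in at 0. (\<tau> \<noteq> 0 \<longrightarrow> (\<forall>x\<in>ed_zeros a c (($) u) \<tau>. B \<tau> x)) \<and> (\<forall>z\<in>?L. \<tau> \<in> T z) \<and>
      \<tau> \<in> Tu \<and> ed_good a c (($) u) \<tau> \<and> \<tau> \<noteq> 0"
    using near inT inTu
    by (intro eventually_conj eventually_good_ed_family eventually_neq_at_within eventually_nhds_imp_at)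
  then obtain \<tau> where \<tau>: "\<And>x. x \<in> ed_zeros a c (($) u) \<tau> \<Longrightarrow> B \<tau> x" "\<And>z. z \<in> ?L \<Longrightarrow> \<tau> \<in> T z"
      "\<tau> \<in> Tu" "ed_good a c (($) u) \<tau>" "\<tau> \<noteq> 0"
    using eventually_happens'[OF at_neq_bot] by blast
  have "ed_zeros a c (($) u) \<tau> \<subseteq> insert (\<xi>u \<tau>) ((\<lambda>z. coords (\<xi> z \<tau>)) ` ?L)"
  proof
    fix x assume x: "x \<in> ed_zeros a c (($) u) \<tau>"
    from \<tau>(1)[OF x] show "x \<in> insert (\<xi>u \<tau>) ((\<lambda>z. coords (\<xi> z \<tau>)) ` ?L)"
      unfolding B_def
    proof
      assume "x \<in> Xu"
      then have "x = \<xi>u \<tau>" using x by (intro U(9)[OF \<tau>(3)]) (simp_all add: ed_zeros_def)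
      then show ?thesis by simp
    next
      assume "\<exists>z\<in>?L. with_mult (hom_poly a c (($) x) (\<lambda>_. 1) / \<tau>) x \<in> X z"
      then obtain z where z: "z \<in> ?L" "with_mult (hom_poly a c (($) x) (\<lambda>_. 1) / \<tau>) x \<in> X z" by blast
      then have "with_mult (hom_poly a c (($) x) (\<lambda>_. 1) / \<tau>) x = \<xi> z \<tau>"
        using T[OF z(1)] \<tau>(2)[OF z(1)] x by (simp add: ed_zeros_iff[OF \<tau>(5)])
      then have "x = coords (\<xi> z \<tau>)" by (metis with_mult_simps(3))
      then show ?thesis using z(1) by blast
    qed
  qed
  then have "card (ed_zeros a c (($) u) \<tau>) \<le> card (insert (\<xi>u \<tau>) ((\<lambda>z. coords (\<xi> z \<tau>)) ` ?L))"
    using fin by (intro card_mono) auto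
  also have "\<dots> \<le> card ((\<lambda>z. coords (\<xi> z \<tau>)) ` ?L) + 1" using fin by (simp add: card_insert_if)
  also have "\<dots> \<le> card ?L + 1" using card_image_le[OF fin] by simp
  finally have "?N \<le> card ?L" using card_zeros_ed_family(2)[OF \<tau>(4)] by simp
  with le show "card ?L = ?N" by simp
qed

section \<open>Genericity\<close>

text \<open>The degree bound must be uniform over all lines: it limits how many dilates of a zero
  set can share a point.\<close>

lemma polyfn_line_degree:
  assumes "polyfn C p"
  shows "\<exists>d. \<forall>x y. \<exists>P. degree P \<le> d \<and> (\<forall>t. p (\<lambda>v. x v + t * y v) = poly P t)"
  using assms
proof (induction rule: polyfn.induct)
  case (const c)
  show ?case by (intro exI[of _ 0] allI exI[of _ "[:c:]"]) simp
next
  case (var v)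
  have "degree [:x v, y v:] \<le> 1 \<and> (\<forall>t. x v + t * y v = poly [:x v, y v:] t)" for x y :: "'a \<Rightarrow> complex"
    by (simp add: algebra_simps)
  then show ?case by blast
next
  case (add p q)
  then obtain d e where d: "\<And>x y. \<exists>P. degree P \<le> d \<and> (\<forall>t. p (\<lambda>v. x v + t * y v) = poly P t)"
    and e: "\<And>x y. \<exists>P. degree P \<le> e \<and> (\<forall>t. q (\<lambda>v. x v + t * y v) = poly P t)" by blast
  have "\<exists>R. degree R \<le> max d e \<and> (\<forall>t. p (\<lambda>v. x v + t * y v) + q (\<lambda>v. x v + t * y v) = poly R t)" for x y
  proof -
    obtain P Q where "degree P \<le> d" "\<forall>t. p (\<lambda>v. x v + t * y v) = poly P t"
      "degree Q \<le> e" "\<forall>t. q (\<lambda>v. x v + t * y v) = poly Q t" using d[of x y] e[of x y] by blast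
    then show ?thesis by (intro exI[of _ "P + Q"]) (auto intro: degree_add_le)
  qed
  then show ?case by blast
next
  case (mult p q)
  then obtain d e where d: "\<And>x y. \<exists>P. degree P \<le> d \<and> (\<forall>t. p (\<lambda>v. x v + t * y v) = poly P t)"
    and e: "\<And>x y. \<exists>P. degree P \<le> e \<and> (\<forall>t. q (\<lambda>v. x v + t * y v) = poly P t)" by blast
  have "\<exists>R. degree R \<le> d + e \<and> (\<forall>t. p (\<lambda>v. x v + t * y v) * q (\<lambda>v. x v + t * y v) = poly R t)" for x y
  proof -
    obtain P Q where "degree P \<le> d" "\<forall>t. p (\<lambda>v. x v + t * y v) = poly P t"
      "degree Q \<le> e" "\<forall>t. q (\<lambda>v. x v + t * y v) = poly Q t" using d[of x y] e[of x y] by blast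
    then show ?thesis using degree_mult_le[of P Q] by (intro exI[of _ "P * Q"]) auto
  qed
  then show ?case by blast
qed

text \<open>Otherwise many dilates of a bounded piece of the zero set would have large total measure in a fixed
  ball, although each point lies in a bounded number of them.\<close>

lemma negligible_polyfn_zeros:
  fixes z0 :: "complex^'k"
  assumes d: "polyfn UNIV d" and nz: "d (($) z0) \<noteq> 0"
  shows "negligible {z::complex^'k. d (($) z) = 0}"
proof -
  define p where "p = (\<lambda>x::complex^'k. d (($) (z0 + x)))"
  define A where "A = (\<lambda>R. {x\<in>cball 0 R. p x = 0})"
  have cont: "continuous_on UNIV p" unfolding p_def
    by (rule continuous_on_polyfn[OF d]) (intro continuous_on_component continuous_on_add continuous_on_const continuous_on_id)
  obtain D where D: "\<And>x y. \<exists>P. degree P \<le> D \<and> (\<forall>t. d (\<lambda>v. x v + t * y v) = poly P t)"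
    using polyfn_line_degree[OF d] by blast
  \<comment> \<open>The function is nonzero at the origin, so its restriction to each line through
    the origin is a nonzero polynomial of degree at most \<open>D\<close>.\<close>
  have line: "finite {t. p (t *\<^sub>R x) = 0} \<and> card {t. p (t *\<^sub>R x) = 0} \<le> D" for x
  proof -
    obtain P where P: "degree P \<le> D" "\<And>t. d (\<lambda>v. z0 $ v + t * x $ v) = poly P t" using D by blast
    have pt: "p (t *\<^sub>R x) = poly P (of_real t)" for t
    proof -
      have "($) (z0 + t *\<^sub>R x) = (\<lambda>v. z0 $ v + of_real t * x $ v)" by (simp add: fun_eq_iff) (simp add: scaleR_conv_of_real)
      then show ?thesis by (simp add: p_def P(2))
    qed
    have "P \<noteq> 0" using pt[of 0] nz by (auto simp: p_def)
    then have fin: "finite {c. poly P c = 0}" and le: "card {c. poly P c = 0} \<le> D"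
      using poly_roots_finite card_poly_roots_bound[of P] P(1) by auto
    have img: "complex_of_real ` {t. p (t *\<^sub>R x) = 0} \<subseteq> {c. poly P c = 0}" by (auto simp: pt)
    then have "finite {t. p (t *\<^sub>R x) = 0}"
      using finite_subset[OF img fin] finite_imageD[of complex_of_real] by (auto simp: inj_on_def)
    moreover have "card {t. p (t *\<^sub>R x) = 0} = card (complex_of_real ` {t. p (t *\<^sub>R x) = 0})"
      by (simp add: card_image inj_on_def)
    then have "card {t. p (t *\<^sub>R x) = 0} \<le> D" using card_mono[OF fin img] le by simp
    ultimately show ?thesis by blast
  qed
  have negA: "negligible (A R)" for R
  proof -
    have comp: "compact (A R)"
    proof -
      have "closed {x. p x = 0}" by (intro closed_Collect_eq cont continuous_on_const)
      moreover have "A R = cball 0 R \<inter> {x. p x = 0}" by (auto simp: A_def)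
      ultimately show ?thesis by (simp add: compact_Int_closed)
    qed
    have le: "real m * measure lebesgue (A R) \<le> real D * measure lebesgue (cball (0::complex^'k) (2 * R))" for m
    proof -
      \<comment> \<open>\<open>m\<close> distinct dilation factors in [1, 2]: the dilates have at
        least the measure of \<open>A R\<close> and stay in the ball of radius 2 R. A point
        \<open>x\<close> in the dilate by \<open>s\<close> yields the root 1/s on its line.\<close>
      define F where "F = (\<lambda>k. 1 + inverse (real (Suc k))) ` {..<m}"
      have F: "finite F" "card F = m" "\<And>s. s \<in> F \<Longrightarrow> 1 \<le> s \<and> s \<le> 2"
        by (auto simp: F_def card_image inj_on_def field_simps)
      define S where "S = (\<lambda>s. (\<lambda>x. s *\<^sub>R x) ` A R)"
      have compS: "compact (S s)" for s unfolding S_def by (rule compact_scaling[OF comp])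
      have "((\<lambda>x. \<Sum>s\<in>F. indicator (S s) x :: real) has_integral (\<Sum>s\<in>F. measure lebesgue (S s))) UNIV"
        using compS F(1) by (intro has_integral_sum) (auto simp: lmeasurable_compact simp flip: lmeasurable_iff_has_integral)
      moreover have "((\<lambda>x. real D * indicator (cball (0::complex^'k) (2 * R)) x :: real) has_integral
          real D * measure lebesgue (cball (0::complex^'k) (2 * R))) UNIV"
        by (rule has_integral_mult_right[OF lmeasurable_iff_has_integral[THEN iffD1, OF lmeasurable_cball]])
      moreover have "(\<Sum>s\<in>F. indicator (S s) x :: real) \<le> real D * indicator (cball 0 (2 * R)) x" for x
      proof -
        have "(\<Sum>s\<in>F. indicator (S s) x :: real) = real (card {s\<in>F. x \<in> S s})"
          using F(1) by (simp add: indicator_def sum.If_cases of_bool_def Int_def)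
        also have "\<dots> \<le> real D * indicator (cball 0 (2 * R)) x"
        proof (cases "x \<in> cball 0 (2 * R)")
          case True
          have sub: "(\<lambda>s. 1 / s) ` {s\<in>F. x \<in> S s} \<subseteq> {t. p (t *\<^sub>R x) = 0}"
          proof clarify
            fix s assume s: "s \<in> F" "x \<in> S s"
            then obtain y where "y \<in> A R" "x = s *\<^sub>R y" by (auto simp: S_def)
            then show "p ((1 / s) *\<^sub>R x) = 0" using F(3)[OF s(1)] by (simp add: A_def)
          qed
          have "card ((\<lambda>s. 1 / s) ` {s\<in>F. x \<in> S s}) \<le> D"
            by (rule order_trans[OF card_mono[OF _ sub]]) (use line[of x] in blast)+
          moreover have "inj_on (\<lambda>s. 1 / s) {s\<in>F. x \<in> S s}" by (auto simp: inj_on_def)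
          ultimately show ?thesis using True by (simp add: card_image)
        next
          case False
          have "x \<notin> S s" if "s \<in> F" for s
          proof
            assume "x \<in> S s"
            then obtain y where y: "norm y \<le> R" "x = s *\<^sub>R y" by (auto simp: S_def A_def)
            have "norm x \<le> 2 * R" using F(3)[OF that] y by (simp add: mult_mono)
            then show False using False by simp
          qed
          then have none: "{s\<in>F. x \<in> S s} = {}" by blast
          show ?thesis unfolding none by simp
        qed
        finally show ?thesis .
      qed
      ultimately have "(\<Sum>s\<in>F. measure lebesgue (S s)) \<le> real D * measure lebesgue (cball (0::complex^'k) (2 * R))"
        by (rule has_integral_le)
      moreover have "measure lebesgue (A R) \<le> measure lebesgue (S s)" if "s \<in> F" for s
      proof -
        have "measure lebesgue (S s) = \<bar>s\<bar> ^ DIM(complex^'k) * measure lebesgue (A R)"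
          using measure_lebesgue_affine[of s 0 "A R"] by (simp add: S_def)
        moreover have "1 \<le> \<bar>s\<bar> ^ DIM(complex^'k)" using F(3)[OF that] by (intro one_le_power) auto
        ultimately show ?thesis by (simp add: mult_le_cancel_right1)
      qed
      then have "(\<Sum>s\<in>F. measure lebesgue (A R)) \<le> (\<Sum>s\<in>F. measure lebesgue (S s))" by (rule sum_mono)
      ultimately show ?thesis using F(2) by simp
    qed
    have "measure lebesgue (A R) = 0"
    proof (rule ccontr)
      assume "measure lebesgue (A R) \<noteq> 0"
      then have pos: "measure lebesgue (A R) > 0" by (simp add: zero_less_measure_iff)
      obtain m where "real D * measure lebesgue (cball (0::complex^'k) (2 * R)) < real m * measure lebesgue (A R)"
        using reals_Archimedean3[OF pos] by blast
      then show False using le[of m] by simp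
    qed
    then show ?thesis using comp by (simp add: negligible_iff_measure lmeasurable_compact)
  qed
  have "{x. p x = 0} = (\<Union>n. A (real n))"
    using real_arch_simple by (force simp: A_def)
  then have "negligible {x. p x = 0}" using negligible_Union_nat[of "\<lambda>n. A (real n)"] negA by simp
  from negligible_translation[OF this, of z0] have "negligible ((+) z0 ` {x. p x = 0})" .
  moreover have "{z. d (($) z) = 0} \<subseteq> (+) z0 ` {x. p x = 0}"
  proof
    fix z assume "z \<in> {z. d (($) z) = 0}"
    then show "z \<in> (+) z0 ` {x. p x = 0}" by (intro image_eqI[of _ _ "z - z0"]) (simp_all add: p_def)
  qed
  ultimately show ?thesis by (rule negligible_subset)
qed

section \<open>Generic properties and a criterion on slices\<close>

text \<open>The empty set of additional constants makes \<open>D\<close> a polynomial with real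
  coefficients.\<close>

definition generic :: "(('v \<Rightarrow> complex) \<Rightarrow> bool) \<Rightarrow> bool" where
  "generic P \<longleftrightarrow> (\<exists>D. polyfn {} D \<and> (\<exists>v. D v \<noteq> 0) \<and> (\<forall>v. D v \<noteq> 0 \<longrightarrow> P v))"

lemma generic_conj: "generic P \<Longrightarrow> generic Q \<Longrightarrow> generic (\<lambda>v. P v \<and> Q v)"
  unfolding generic_def
proof (elim exE conjE)
  fix D E x y
  assume "polyfn {} D" "D x \<noteq> 0" "\<forall>v. D v \<noteq> 0 \<longrightarrow> P v" "polyfn {} E" "E y \<noteq> 0" "\<forall>v. E v \<noteq> 0 \<longrightarrow> Q v"
  then show "\<exists>D. polyfn {} D \<and> (\<exists>v. D v \<noteq> 0) \<and> (\<forall>v. D v \<noteq> 0 \<longrightarrow> P v \<and> Q v)"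
    using polyfn_common_nonzero[of "{}" D E x y] polyfn.mult[of "{}" D E]
    by (intro exI[of _ "\<lambda>v. D v * E v"]) auto
qed

lemma generic_True: "generic (\<lambda>v. True)"
  unfolding generic_def by (intro exI[of _ "\<lambda>v. 1"]) (auto intro: polyfn_1)

lemma generic_all: "finite I \<Longrightarrow> (\<And>i. i \<in> I \<Longrightarrow> generic (P i)) \<Longrightarrow> generic (\<lambda>v. \<forall>i\<in>I. P i v)"
proof (induction I rule: finite_induct)
  case empty
  then show ?case using generic_True by simp
next
  case (insert i I)
  then show ?case using generic_conj[of "P i" "\<lambda>v. \<forall>i\<in>I. P i v"] by simp
qed

definition slice :: "('k \<Rightarrow> 'v) \<Rightarrow> ('v \<Rightarrow> complex) \<Rightarrow> complex^'k \<Rightarrow> 'v \<Rightarrow> complex" where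
  "slice s v y w = (if w \<in> range s then y $ inv s w else v w)"

lemma slice_at: "inj s \<Longrightarrow> slice s v y (s k) = y $ k"
  by (simp add: slice_def)

lemma slice_off: "w \<notin> range s \<Longrightarrow> slice s v y w = v w"
  by (simp add: slice_def)

text \<open>If \<open>P\<close> were not generic, it would fail on a nonempty Zariski-open set. A
  slice through a point of that set meets it in a nonempty open set, yet the failures in the slice
  are covered by the image of a negligible set of the same dimension under a smooth map.\<close>

lemma generic_slice:
  fixes s :: "'k::finite \<Rightarrow> 'v"
  assumes "constructible {} {v. P v}" "inj s"
    and bad: "\<And>v. \<exists>(N :: (complex^'k) set) \<psi>. negligible N \<and> (\<forall>k. polyfn UNIV (\<psi> k)) \<and>
       (\<forall>y. \<not> P (slice s v y) \<longrightarrow> (\<exists>z\<in>N. \<forall>k. y $ k = \<psi> k (($) z)))"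
  shows "generic P"
proof (rule ccontr)
  assume not: "\<not> generic P"
  obtain D x where D: "polyfn {} D" "D x \<noteq> 0" "{v. D v \<noteq> 0} \<subseteq> {v. P v} \<or> {v. D v \<noteq> 0} \<subseteq> - {v. P v}"
    using constructible_dichotomy[OF assms(1)] by blast
  then have notP: "\<not> P v" if "D v \<noteq> 0" for v using not that unfolding generic_def by blast
  from bad[of x] obtain N :: "(complex^'k) set" and \<psi> where "negligible N \<and> (\<forall>k. polyfn UNIV (\<psi> k)) \<and>
       (\<forall>y. \<not> P (slice s x y) \<longrightarrow> (\<exists>z\<in>N. \<forall>k. y $ k = \<psi> k (($) z)))" by (elim exE)
  then have N: "negligible N" "\<And>k. polyfn UNIV (\<psi> k)"
    "\<And>y. \<not> P (slice s x y) \<Longrightarrow> \<exists>z\<in>N. \<forall>k. y $ k = \<psi> k (($) z)" by simp_all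
  define \<Psi> where "\<Psi> = (\<lambda>z::complex^'k. \<chi> k. \<psi> k (($) z))"
  have "\<Psi> differentiable_on N" unfolding \<Psi>_def
  proof (rule differentiable_at_imp_differentiable_on)
    fix z :: "complex^'k"
    have "((\<lambda>z::complex^'k. \<chi> k. \<psi> k (($) z)) has_derivative (\<lambda>h. \<chi> k. \<Sum>j\<in>UNIV. pd j (\<psi> k) (($) z) * h $ j)) (at z)"
      by (rule has_derivative_vec_lambda) (rule has_derivative_polyfn[OF N(2)])
    then show "(\<lambda>z::complex^'k. \<chi> k. \<psi> k (($) z)) differentiable (at z)" unfolding differentiable_def by blast
  qed
  then have neg: "negligible (\<Psi> ` N)" by (rule negligible_differentiable_image_negligible[OF order_refl N(1)])
  define O' where "O' = {y. D (slice s x y) \<noteq> 0}"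
  have "continuous_on UNIV (\<lambda>y. D (slice s x y))"
  proof (rule continuous_on_polyfn[OF D(1)])
    fix w show "continuous_on UNIV (\<lambda>y. slice s x y w)"
      by (cases "w \<in> range s") (simp_all add: slice_def continuous_on_component continuous_on_const)
  qed
  then have "open O'" unfolding O'_def by (intro open_Collect_neq continuous_on_const)
  moreover have "(\<chi> k. x (s k)) \<in> O'"
  proof -
    have "slice s x (\<chi> k. x (s k)) = x" using assms(2) by (auto simp: slice_def fun_eq_iff)
    then show ?thesis using D(2) by (simp add: O'_def)
  qed
  moreover have "O' \<subseteq> \<Psi> ` N"
  proof
    fix y assume "y \<in> O'"
    then obtain z where "z \<in> N" "\<forall>k. y $ k = \<psi> k (($) z)" using N(3)[of y] notP by (auto simp: O'_def)
    then show "y \<in> \<Psi> ` N" by (intro image_eqI[of _ _ z]) (simp_all add: \<Psi>_def vec_eq_iff)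
  qed
  ultimately show False using open_not_negligible negligible_subset[OF neg] by blast
qed

section \<open>Coefficients, data point, multiplier and coordinates as joint variables\<close>

datatype 'n edvar = Cf "'n \<Rightarrow>\<^sub>0 nat" | Ud 'n | Lm | Xc 'n

abbreviation cfs :: "('n edvar \<Rightarrow> complex) \<Rightarrow> ('n \<Rightarrow>\<^sub>0 nat) \<Rightarrow> complex" where "cfs v \<equiv> \<lambda>\<alpha>. v (Cf \<alpha>)"
abbreviation uds :: "('n edvar \<Rightarrow> complex) \<Rightarrow> 'n \<Rightarrow> complex" where "uds v \<equiv> \<lambda>i. v (Ud i)"
abbreviation xcs :: "('n edvar \<Rightarrow> complex) \<Rightarrow> 'n \<Rightarrow> complex" where "xcs v \<equiv> \<lambda>i. v (Xc i)"

text \<open>\<open>J\<close> is the set of coordinates at infinity. In affine coordinates on this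
  face the coefficient at \<open>corner a J\<close> is the constant term, and for k outside
  \<open>J\<close> the one at \<open>corner_succ a J k\<close> is the coefficient of the linear term
  in x_k.\<close>

definition corner :: "nat^'n::finite \<Rightarrow> 'n set \<Rightarrow> 'n \<Rightarrow>\<^sub>0 nat" where
  "corner a J = Abs_poly_mapping (\<lambda>i. if i \<in> J then a $ i else 0)"

definition corner_succ :: "nat^'n::finite \<Rightarrow> 'n set \<Rightarrow> 'n \<Rightarrow> 'n \<Rightarrow>\<^sub>0 nat" where
  "corner_succ a J k = Abs_poly_mapping (\<lambda>i. if i = k then 1 else if i \<in> J then a $ i else 0)"

lemma lookup_corner [simp]:
  "Poly_Mapping.lookup (corner a J) i = (if i \<in> J then a $ i else 0)"
  "Poly_Mapping.lookup (corner_succ a J k) i = (if i = k then 1 else if i \<in> J then a $ i else 0)"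
  by (simp_all add: corner_def corner_succ_def Abs_poly_mapping_inverse)

definition off_corner :: "nat^'n::finite \<Rightarrow> 'n set \<Rightarrow> ('n \<Rightarrow>\<^sub>0 nat) set" where
  "off_corner a J = exponents a - insert (corner a J) (corner_succ a J ` (- J))"

text \<open>Normalised homogeneous coordinates on the face \<open>J\<close>: the point at infinity
  in the directions of \<open>J\<close>, affine coordinates elsewhere.\<close>

definition face_p :: "'n set \<Rightarrow> ('n \<Rightarrow> complex) \<Rightarrow> 'n \<Rightarrow> complex" where
  "face_p J x = (\<lambda>i. if i \<in> J then 1 else x i)"

definition face_q :: "'n set \<Rightarrow> 'n \<Rightarrow> complex" where
  "face_q J = (\<lambda>i. if i \<in> J then 0 else 1)"

definition off_poly :: "nat^'n::finite \<Rightarrow> 'n set \<Rightarrow> (('n \<Rightarrow>\<^sub>0 nat) \<Rightarrow> complex) \<Rightarrow> ('n \<Rightarrow> complex) \<Rightarrow> complex" where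
  "off_poly a J c x = (\<Sum>\<alpha>\<in>off_corner a J. c \<alpha> *
     (\<Prod>j\<in>UNIV. face_p J x j ^ Poly_Mapping.lookup \<alpha> j * face_q J j ^ (a $ j - Poly_Mapping.lookup \<alpha> j)))"

definition off_deriv :: "nat^'n::finite \<Rightarrow> 'n set \<Rightarrow> 'n \<Rightarrow> (('n \<Rightarrow>\<^sub>0 nat) \<Rightarrow> complex) \<Rightarrow> ('n \<Rightarrow> complex) \<Rightarrow> complex" where
  "off_deriv a J i c x = (\<Sum>\<alpha>\<in>off_corner a J. c \<alpha> *
     (of_nat (Poly_Mapping.lookup \<alpha> i) * face_p J x i ^ (Poly_Mapping.lookup \<alpha> i - 1) * face_q J i ^ (a $ i - Poly_Mapping.lookup \<alpha> i)) *
     (\<Prod>j\<in>-{i}. face_p J x j ^ Poly_Mapping.lookup \<alpha> j * face_q J j ^ (a $ j - Poly_Mapping.lookup \<alpha> j)))"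

lemma corner_succ_eq_iff [simp]: "i \<notin> J \<Longrightarrow> k \<notin> J \<Longrightarrow> corner_succ a J i = corner_succ a J k \<longleftrightarrow> i = k"
  by (metis lookup_corner(2) zero_neq_one)

lemma corner_succ_neq_corner [simp]: "k \<notin> J \<Longrightarrow> corner_succ a J k \<noteq> corner a J"
  by (metis lookup_corner zero_neq_one)

lemma sum_exponents_corner:
  fixes a :: "nat^'n::finite"
  assumes "\<And>i. 0 < a $ i"
  shows "(\<Sum>\<alpha>\<in>exponents a. f \<alpha>) = f (corner a J) + (\<Sum>i\<in>-J. f (corner_succ a J i)) + (\<Sum>\<alpha>\<in>off_corner a J. (f \<alpha> :: complex))"
proof -
  have sub: "insert (corner a J) (corner_succ a J ` (- J)) \<subseteq> exponents a"
    using assms by (auto simp: exponents_def Suc_le_eq)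
  have "(\<Sum>\<alpha>\<in>exponents a. f \<alpha>) = (\<Sum>\<alpha>\<in>insert (corner a J) (corner_succ a J ` (- J)). f \<alpha>) + (\<Sum>\<alpha>\<in>off_corner a J. f \<alpha>)"
    unfolding off_corner_def using sum.subset_diff[OF sub finite_exponents, of f] by (simp add: add.commute)
  also have "(\<Sum>\<alpha>\<in>insert (corner a J) (corner_succ a J ` (- J)). f \<alpha>) = f (corner a J) + (\<Sum>\<alpha>\<in>corner_succ a J ` (- J). f \<alpha>)"
    by (rule sum.insert) (auto dest: sym)
  also have "(\<Sum>\<alpha>\<in>corner_succ a J ` (- J). f \<alpha>) = (\<Sum>i\<in>-J. f (corner_succ a J i))"
    by (subst sum.reindex) (auto simp: inj_on_def)
  finally show ?thesis .
qed

lemma hom_poly_face: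
  fixes a :: "nat^'n::finite"
  assumes "\<And>i. 0 < a $ i"
  shows "hom_poly a c (face_p J x) (face_q J) =
    c (corner a J) + (\<Sum>i\<in>-J. c (corner_succ a J i) * x i) + off_poly a J c x"
proof -
  have "(\<Prod>j\<in>UNIV. face_p J x j ^ Poly_Mapping.lookup (corner a J) j * face_q J j ^ (a $ j - Poly_Mapping.lookup (corner a J) j)) = 1"
    by (intro prod.neutral) (auto simp: face_p_def face_q_def)
  moreover have "(\<Prod>j\<in>UNIV. face_p J x j ^ Poly_Mapping.lookup (corner_succ a J i) j *
      face_q J j ^ (a $ j - Poly_Mapping.lookup (corner_succ a J i) j)) = x i" if "i \<in> - J" for i
  proof -
    have "face_p J x j ^ Poly_Mapping.lookup (corner_succ a J i) j * face_q J j ^ (a $ j - Poly_Mapping.lookup (corner_succ a J i) j) =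
        (if j = i then x i else 1)" for j
      using that by (auto simp: face_p_def face_q_def)
    then show ?thesis by simp
  qed
  ultimately show ?thesis unfolding hom_poly_def sum_exponents_corner[OF assms, where J = J] off_poly_def by simp
qed

lemma hom_deriv_face:
  fixes a :: "nat^'n::finite"
  assumes "\<And>i. 0 < a $ i" "i \<notin> J"
  shows "hom_deriv a i c (face_p J x) (face_q J) = c (corner_succ a J i) + off_deriv a J i c x"
proof -
  have "(\<Prod>j\<in>-{i}. face_p J x j ^ Poly_Mapping.lookup (corner_succ a J i) j *
      face_q J j ^ (a $ j - Poly_Mapping.lookup (corner_succ a J i) j)) = 1"
    by (intro prod.neutral) (auto simp: face_p_def face_q_def)
  then have 1: "c (corner_succ a J k) * (of_nat (Poly_Mapping.lookup (corner_succ a J k) i) *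
      face_p J x i ^ (Poly_Mapping.lookup (corner_succ a J k) i - 1) * face_q J i ^ (a $ i - Poly_Mapping.lookup (corner_succ a J k) i)) *
     (\<Prod>j\<in>-{i}. face_p J x j ^ Poly_Mapping.lookup (corner_succ a J k) j *
      face_q J j ^ (a $ j - Poly_Mapping.lookup (corner_succ a J k) j)) = (if k = i then c (corner_succ a J i) else 0)"
    if "k \<in> - J" for k using assms(2) by (auto simp: face_q_def)
  have 2: "c (corner a J) * (of_nat (Poly_Mapping.lookup (corner a J) i) *
      face_p J x i ^ (Poly_Mapping.lookup (corner a J) i - 1) * face_q J i ^ (a $ i - Poly_Mapping.lookup (corner a J) i)) *
     (\<Prod>j\<in>-{i}. face_p J x j ^ Poly_Mapping.lookup (corner a J) j *
      face_q J j ^ (a $ j - Poly_Mapping.lookup (corner a J) j)) = 0"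
    using assms(2) by simp
  show ?thesis
    unfolding hom_deriv_def sum_exponents_corner[OF assms(1), where J = J] off_deriv_def 2
    by (subst sum.cong[OF refl 1]) (use assms(2) in \<open>simp_all\<close>)
qed

lemma polyfn_off [polyfn_intros]:
  assumes "\<And>\<alpha>. polyfn C (\<lambda>v. c v \<alpha>)" "\<And>j. polyfn C (\<lambda>v. x v j)"
  shows "polyfn C (\<lambda>v. off_poly a J (c v) (x v))" "polyfn C (\<lambda>v. off_deriv a J i (c v) (x v))"
  unfolding off_poly_def off_deriv_def face_p_def face_q_def by (intro polyfn_intros assms)+

lemma off_cong:
  assumes "\<And>\<alpha>. \<alpha> \<in> off_corner a J \<Longrightarrow> c \<alpha> = c' \<alpha>"
  shows "off_poly a J c x = off_poly a J c' x" "off_deriv a J i c x = off_deriv a J i c' x"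
  unfolding off_poly_def off_deriv_def using assms by (auto intro!: sum.cong)

lemma generic_point_off:
  fixes a :: "nat^'n::finite"
  assumes "\<And>i. 0 < a $ i"
  shows "generic (\<lambda>v. hom_poly a (cfs v) (uds v) (\<lambda>_. 1) \<noteq> 0)"
  unfolding generic_def
proof (intro exI conjI allI impI)
  show "polyfn {} (\<lambda>v. hom_poly a (cfs v) (uds v) (\<lambda>_. 1))" by (intro polyfn_intros)
  \<comment> \<open>The constant polynomial 1 is the witness.\<close>
  let ?v = "\<lambda>w. case w of Cf \<alpha> \<Rightarrow> (if \<alpha> = corner a {} then 1 else (0::complex)) | _ \<Rightarrow> 0"
  have "face_p {} (uds ?v) = uds ?v" "face_q ({} :: 'n set) = (\<lambda>_. 1)" by (auto simp: face_p_def face_q_def)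
  moreover have "off_poly a {} (cfs ?v) (uds ?v) = 0"
    unfolding off_poly_def by (intro sum.neutral) (auto simp: off_corner_def)
  ultimately show "hom_poly a (cfs ?v) (uds ?v) (\<lambda>_. 1) \<noteq> 0"
    using hom_poly_face[OF assms, where J = "{}" and c = "cfs ?v" and x = "uds ?v"] by simp
qed

text \<open>The face \<open>J\<close> at infinity is smooth: otherwise, for some \<open>x\<close>, the coefficients at the corner and its
  neighbours are determined by \<open>x\<close> and the remaining coefficients.\<close>

lemma generic_smooth_face:
  fixes a :: "nat^'n::finite"
  assumes pos: "\<And>i. 0 < a $ i"
  shows "generic (\<lambda>v. \<not> (\<exists>x. hom_poly a (cfs v) (face_p J x) (face_q J) = 0 \<and>
    (\<forall>i\<in>-J. hom_deriv a i (cfs v) (face_p J x) (face_q J) = 0)))"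
proof (rule generic_slice)
  \<comment> \<open>The conditions determine the corner coefficient and one neighbour for each i
    outside \<open>J\<close>. The inert variables \<open>Xc i\<close> with i in \<open>J\<close> pad
    the slice to n + 1 coordinates on every face.\<close>
  define s :: "'n option \<Rightarrow> 'n edvar" where
    "s = (\<lambda>k. case k of None \<Rightarrow> Cf (corner a J) | Some i \<Rightarrow> if i \<in> J then Xc i else Cf (corner_succ a J i))"
  show "inj s"
  proof (rule injI)
    fix k l assume "s k = s l"
    then show "k = l"
      by (cases k; cases l) (auto simp: s_def dest: sym split: if_splits)
  qed
  have "constructible {} {v. \<exists>y. (\<forall>w. w \<notin> range Xc \<longrightarrow> y w = v w) \<and>
      (hom_poly a (cfs y) (face_p J (xcs y)) (face_q J) = 0 \<and>
      (\<forall>i\<in>-J. hom_deriv a i (cfs y) (face_p J (xcs y)) (face_q J) = 0))}"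
    unfolding face_p_def face_q_def
    by (intro constructible_Collect_ex_off) (auto intro!: polyfn_intros)
  moreover have "(\<exists>y. (\<forall>w. w \<notin> range Xc \<longrightarrow> y w = v w) \<and> P (cfs y) (xcs y)) \<longleftrightarrow> (\<exists>x. P (cfs v) x)"
    for v :: "'n edvar \<Rightarrow> complex" and P
  proof
    assume "\<exists>y. (\<forall>w. w \<notin> range Xc \<longrightarrow> y w = v w) \<and> P (cfs y) (xcs y)"
    then obtain y where y: "\<forall>w. w \<notin> range Xc \<longrightarrow> y w = v w" "P (cfs y) (xcs y)" by blast
    then have "cfs y = cfs v" by auto
    then show "\<exists>x. P (cfs v) x" using y(2) by auto
  next
    assume "\<exists>x. P (cfs v) x"
    then obtain x where "P (cfs v) x" ..
    then show "\<exists>y. (\<forall>w. w \<notin> range Xc \<longrightarrow> y w = v w) \<and> P (cfs y) (xcs y)"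
      by (intro exI[of _ "\<lambda>w. case w of Xc i \<Rightarrow> x i | _ \<Rightarrow> v w"]) (auto split: edvar.splits)
  qed
  note this[where P = "\<lambda>c x. hom_poly a c (face_p J x) (face_q J) = 0 \<and> (\<forall>i\<in>-J. hom_deriv a i c (face_p J x) (face_q J) = 0)"]
  ultimately show "constructible {} {v. \<not> (\<exists>x. hom_poly a (cfs v) (face_p J x) (face_q J) = 0 \<and>
    (\<forall>i\<in>-J. hom_deriv a i (cfs v) (face_p J x) (face_q J) = 0))}"
    by (intro constructible_Collect_not) simp
  fix v :: "'n edvar \<Rightarrow> complex"
  \<comment> \<open>There is one condition more than there are affine coordinates, so together with
    the padding only n parameters occur. The surplus coordinate is set to 0, which confines them to
    a hyperplane.\<close>
  define N :: "(complex^('n option)) set" where "N = {z. z $ None = 0}"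
  define \<psi> :: "'n option \<Rightarrow> ('n option \<Rightarrow> complex) \<Rightarrow> complex" where
    "\<psi> = (\<lambda>k z. let x = \<lambda>i. z (Some i) in case k of
       None \<Rightarrow> (\<Sum>i\<in>-J. off_deriv a J i (cfs v) x * x i) - off_poly a J (cfs v) x
     | Some i \<Rightarrow> if i \<in> J then x i else - off_deriv a J i (cfs v) x)"
  have "negligible N"
  proof -
    have "negligible {z::complex^('n option). (\<lambda>z. z None) (($) z) = 0}"
      by (rule negligible_polyfn_zeros[of _ "\<chi> k. 1"]) (simp_all add: polyfn.var)
    then show ?thesis by (simp add: N_def)
  qed
  moreover have "polyfn UNIV (\<psi> k)" for k
    unfolding \<psi>_def Let_def by (cases k) (auto intro!: polyfn_intros)
  moreover have "\<exists>z\<in>N. \<forall>k. y $ k = \<psi> k (($) z)"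
    if "\<not> \<not> (\<exists>x. hom_poly a (cfs (slice s v y)) (face_p J x) (face_q J) = 0 \<and>
      (\<forall>i\<in>-J. hom_deriv a i (cfs (slice s v y)) (face_p J x) (face_q J) = 0))" for y
  proof -
    let ?c = "cfs (slice s v y)"
    from that obtain x where x: "hom_poly a ?c (face_p J x) (face_q J) = 0"
      "\<And>i. i \<notin> J \<Longrightarrow> hom_deriv a i ?c (face_p J x) (face_q J) = 0" by auto
    define z :: "complex^('n option)" where "z = (\<chi> k. case k of None \<Rightarrow> 0 | Some i \<Rightarrow> if i \<in> J then y $ Some i else x i)"
    have off: "?c \<alpha> = cfs v \<alpha>" if "\<alpha> \<in> off_corner a J" for \<alpha>
      using that by (intro slice_off) (auto simp: s_def off_corner_def split: option.splits if_splits)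
    have c: "?c (corner a J) = y $ None" "i \<notin> J \<Longrightarrow> ?c (corner_succ a J i) = y $ Some i" for i
      using slice_at[OF \<open>inj s\<close>, of v y None] slice_at[OF \<open>inj s\<close>, of v y "Some i"] by (simp_all add: s_def)
    have "face_p J (\<lambda>i. z $ Some i) = face_p J x" by (auto simp: face_p_def z_def)
    then have offx: "off_poly a J (cfs v) (\<lambda>i. z $ Some i) = off_poly a J ?c x"
      "off_deriv a J i (cfs v) (\<lambda>i. z $ Some i) = off_deriv a J i ?c x" for i
      using off_cong[where a = a and J = J and c = ?c and c' = "cfs v" and x = x] off
      by (simp_all add: off_poly_def off_deriv_def)
    have d: "i \<notin> J \<Longrightarrow> y $ Some i = - off_deriv a J i ?c x" for i
      using x(2)[of i] hom_deriv_face[OF pos, of i J ?c x] by (simp add: c eq_neg_iff_add_eq_0)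
    have "0 = y $ None + (\<Sum>i\<in>-J. y $ Some i * x i) + off_poly a J ?c x"
      using x(1) hom_poly_face[OF pos, of ?c J x] by (simp add: c)
    also have "(\<Sum>i\<in>-J. y $ Some i * x i) = - (\<Sum>i\<in>-J. off_deriv a J i ?c x * x i)"
      unfolding sum_negf[symmetric] by (intro sum.cong) (auto simp: d)
    finally have e: "y $ None = (\<Sum>i\<in>-J. off_deriv a J i ?c x * x i) - off_poly a J ?c x"
      by (simp add: algebra_simps eq_diff_eq)
    have zx: "(\<Sum>i\<in>-J. off_deriv a J i ?c x * z $ Some i) = (\<Sum>i\<in>-J. off_deriv a J i ?c x * x i)"
      by (intro sum.cong) (auto simp: z_def)
    have "y $ k = \<psi> k (($) z)" for k
    proof (cases k)
      case None
      then show ?thesis by (simp add: \<psi>_def offx zx e)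
    next
      case (Some i)
      then show ?thesis by (simp add: \<psi>_def offx d) (simp add: z_def)
    qed
    moreover have "z \<in> N" by (simp add: N_def z_def)
    ultimately show ?thesis by blast
  qed
  ultimately show "\<exists>(N :: (complex^('n option)) set) \<psi>. negligible N \<and> (\<forall>k. polyfn UNIV (\<psi> k)) \<and>
      (\<forall>y. \<not> \<not> (\<exists>x. hom_poly a (cfs (slice s v y)) (face_p J x) (face_q J) = 0 \<and>
      (\<forall>i\<in>-J. hom_deriv a i (cfs (slice s v y)) (face_p J x) (face_q J) = 0)) \<longrightarrow> (\<exists>z\<in>N. \<forall>k. y $ k = \<psi> k (($) z)))"
    by blast
qed

text \<open>The Lagrange system at \<tau> = 0, now with coefficients and data point as variables
  too, so that the unknowns can be eliminated.\<close>

definition lag_eq :: "nat^'n::finite \<Rightarrow> 'n option \<Rightarrow> ('n edvar \<Rightarrow> complex) \<Rightarrow> complex" where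
  "lag_eq a o' v = (case o' of None \<Rightarrow> hom_poly a (cfs v) (xcs v) (\<lambda>_. 1)
     | Some i \<Rightarrow> v Lm * (v (Xc i) - v (Ud i)) + hom_deriv a i (cfs v) (xcs v) (\<lambda>_. 1))"

definition lag_var :: "'n option \<Rightarrow> 'n edvar" where
  "lag_var o' = (case o' of None \<Rightarrow> Lm | Some j \<Rightarrow> Xc j)"

lemma lag_var_simps [simp]: "lag_var None = Lm" "lag_var (Some j) = Xc j"
  by (simp_all add: lag_var_def)

definition lag_jac :: "nat^'n::finite \<Rightarrow> ('n edvar \<Rightarrow> complex) \<Rightarrow> complex^('n option)^('n option)" where
  "lag_jac a v = (\<chi> o' k. pd (lag_var k) (lag_eq a o') v)"

lemma polyfn_lag_eq: "polyfn C (lag_eq a o')"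
  unfolding lag_eq_def by (cases o') (auto intro!: polyfn_intros)

lemma polyfn_det_lag_jac: "polyfn C (\<lambda>v. det (lag_jac a v))"
  unfolding lag_jac_def by (intro polyfn_intros) (auto intro!: polyfn_intros polyfn_lag_eq)

lemma lagrange_family_lag_eq:
  assumes "w None = 0" "\<And>k. w (Some k) = v (lag_var k)"
  shows "lagrange_family a (cfs v) (uds v) o' w = lag_eq a o' v"
  using assms(1) assms(2)[of None] assms(2)[of "Some _"]
  by (simp add: lagrange_family_def lag_eq_def Let_def split: option.splits)

lemma jac_lagrange_family:
  assumes "\<And>k. z $ k = v (lag_var k)"
  shows "jac (lagrange_family a (cfs v) (uds v)) (pt 0 z) = lag_jac a v"
proof -
  have "pd (Some k) (lagrange_family a (cfs v) (uds v) o') (pt 0 z) = pd (lag_var k) (lag_eq a o') v" for k o'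
  proof -
    have "lagrange_family a (cfs v) (uds v) o' ((pt 0 z)(Some k := t)) = lag_eq a o' (v(lag_var k := t))" for t
    proof -
      let ?v = "v(lag_var k := t)"
      have "cfs ?v = cfs v" "uds ?v = uds v" by (cases k; simp)+
      moreover have "lagrange_family a (cfs ?v) (uds ?v) o' ((pt 0 z)(Some k := t)) = lag_eq a o' ?v"
      proof (rule lagrange_family_lag_eq)
        show "((pt 0 z)(Some k := t)) (Some l) = ?v (lag_var l)" for l
          by (cases k; cases l) (auto simp: assms)
      qed simp
      ultimately show ?thesis by simp
    qed
    then show ?thesis by (simp add: pd_def assms del: fun_upd_apply)
  qed
  then show ?thesis by (simp add: jac_def lag_jac_def)
qed

lemma DERIV_hom_poly:
  fixes a :: "nat^'n::finite"
  shows "((\<lambda>t. hom_poly a c (x(j := t)) q) has_field_derivative hom_deriv a j c x q) (at (x j))"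
  unfolding hom_poly_def hom_deriv_def
proof (rule DERIV_sum)
  fix \<alpha> :: "'n \<Rightarrow>\<^sub>0 nat"
  let ?l = "Poly_Mapping.lookup \<alpha>"
  let ?R = "\<Prod>k\<in>-{j}. x k ^ ?l k * q k ^ (a $ k - ?l k)"
  have "(\<Prod>k\<in>UNIV. (x(j := t)) k ^ ?l k * q k ^ (a $ k - ?l k)) = t ^ ?l j * q j ^ (a $ j - ?l j) * ?R" for t
    by (subst prod.remove[of UNIV j]) (auto simp: Compl_eq_Diff_UNIV intro!: prod.cong)
  then show "((\<lambda>t. c \<alpha> * (\<Prod>k\<in>UNIV. (x(j := t)) k ^ ?l k * q k ^ (a $ k - ?l k))) has_field_derivative
      c \<alpha> * (of_nat (?l j) * x j ^ (?l j - 1) * q j ^ (a $ j - ?l j)) * ?R) (at (x j))"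
    by (auto intro!: derivative_eq_intros)
qed

lemma face_empty: "face_p {} x = x" "face_q {} = (\<lambda>_. 1)"
  by (auto simp: face_p_def face_q_def)

lemma hom_poly_face_empty:
  "(\<And>i. 0 < a $ i) \<Longrightarrow> hom_poly a c x (\<lambda>_. 1) =
    c (corner a {}) + (\<Sum>i\<in>UNIV. c (corner_succ a {} i) * x i) + off_poly a {} c x"
  using hom_poly_face[of a c "{}" x] by (simp add: face_empty)

lemma hom_deriv_face_empty:
  "(\<And>i. 0 < a $ i) \<Longrightarrow> hom_deriv a i c x (\<lambda>_. 1) = c (corner_succ a {} i) + off_deriv a {} i c x"
  using hom_deriv_face[of a i "{}" c x] by (simp add: face_empty)

text \<open>At a solution with \<open>x - u\<close> a unit vector and a large multiplier the Lagrange system is nondegenerate,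
  the diagonal blocks \<open>l\<close> dominating the Hessian.\<close>

lemma lag_jac_large_multiplier:
  fixes a :: "nat^'n::finite"
  assumes pos: "\<And>i. 0 < a $ i" and zero: "\<And>o'. lag_eq a o' v = 0"
    and x: "\<And>i. v (Xc i) = v (Ud i) + (if i = i0 then 1 else 0)"
    and large: "(\<Sum>i\<in>UNIV. \<Sum>j\<in>UNIV. norm (pd (Xc j) (\<lambda>v. off_deriv a {} i (cfs v) (xcs v)) v)) < norm (v Lm)"
  shows "det (lag_jac a v) \<noteq> 0"
  unfolding det_nonzero_iff_kernel
proof (intro allI impI)
  define A :: "complex^'n^'n" where "A = (\<chi> i j. pd (Xc j) (\<lambda>v. off_deriv a {} i (cfs v) (xcs v)) v)"
  have l0: "v Lm \<noteq> 0"
  proof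
    assume "v Lm = 0"
    moreover have "0 \<le> (\<Sum>i\<in>UNIV. \<Sum>j\<in>UNIV. norm (pd (Xc j) (\<lambda>v. off_deriv a {} i (cfs v) (xcs v)) v))"
      by (intro sum_nonneg) simp
    ultimately show False using large by simp
  qed
  have e00: "pd Lm (lag_eq a None) v = 0"
    by (simp add: lag_eq_def pd_def)
  \<comment> \<open>The Lagrange equations express the gradient of f as - l (x - u), here - l times
    a unit vector.\<close>
  have e0: "pd (Xc j) (lag_eq a None) v = (if j = i0 then - v Lm else 0)" for j
  proof -
    have "xcs (v(Xc j := t)) = (xcs v)(j := t)" for t by (auto simp: fun_eq_iff)
    then have "pd (Xc j) (lag_eq a None) v = hom_deriv a j (cfs v) (xcs v) (\<lambda>_. 1)"
      using DERIV_hom_poly[of a "cfs v" "xcs v" j "\<lambda>_. 1"]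
      by (intro pd_eqI) (simp add: lag_eq_def)
    moreover have "lag_eq a (Some j) v = 0" by (rule zero)
    ultimately show ?thesis by (cases "j = i0") (auto simp: lag_eq_def x eq_neg_iff_add_eq_0 add.commute)
  qed
  have lag_Some: "lag_eq a (Some i) = (\<lambda>v. v Lm * (v (Xc i) - v (Ud i)) +
      (v (Cf (corner_succ a {} i)) + off_deriv a {} i (cfs v) (xcs v)))" for i
    by (simp add: lag_eq_def hom_deriv_face_empty[OF pos] fun_eq_iff)
  have off: "polyfn UNIV (\<lambda>v. off_deriv a {} i (cfs v) (xcs v))" for i by (intro polyfn_intros)
  have pd_Some: "pd w (lag_eq a (Some i)) v = (pd w (\<lambda>v. v Lm) v * (v (Xc i) - v (Ud i)) +
      v Lm * (pd w (\<lambda>v. v (Xc i)) v - pd w (\<lambda>v. v (Ud i)) v)) +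
      (pd w (\<lambda>v. v (Cf (corner_succ a {} i))) v + pd w (\<lambda>v. off_deriv a {} i (cfs v) (xcs v)) v)" for w i
  proof -
    have 1: "polyfn UNIV (\<lambda>v. v (Xc i) - v (Ud i))" "polyfn UNIV (\<lambda>v. v Lm * (v (Xc i) - v (Ud i)))"
      "polyfn UNIV (\<lambda>v. v (Cf (corner_succ a {} i)) + off_deriv a {} i (cfs v) (xcs v))"
      by (intro polyfn_intros)+
    show ?thesis
      unfolding lag_Some pd_add[OF 1(2,3)] pd_add[OF polyfn.var off] pd_mult[OF polyfn.var 1(1)]
        pd_diff[OF polyfn.var polyfn.var] ..
  qed
  have e1: "pd Lm (lag_eq a (Some i)) v = (if i = i0 then 1 else 0)" for i
  proof -
    have "pd Lm (\<lambda>v. off_deriv a {} i (cfs v) (xcs v)) v = 0" by (simp add: pd_def)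
    then show ?thesis unfolding pd_Some by (simp add: pd_var x)
  qed
  have e2: "pd (Xc j) (lag_eq a (Some i)) v = A $ i $ j + (if i = j then v Lm else 0)" for i j
    unfolding pd_Some by (simp add: pd_var A_def)
  fix h :: "complex^('n option)"
  assume h: "\<forall>o'. (\<Sum>k\<in>UNIV. lag_jac a v $ o' $ k * h $ k) = 0"
  have row: "pd Lm (lag_eq a o') v * h $ None + (\<Sum>j\<in>UNIV. pd (Xc j) (lag_eq a o') v * h $ Some j) = 0" for o'
  proof -
    have "0 = (\<Sum>k\<in>UNIV. lag_jac a v $ o' $ k * h $ k)" using h by simp
    also have "\<dots> = pd Lm (lag_eq a o') v * h $ None + (\<Sum>j\<in>UNIV. pd (Xc j) (lag_eq a o') v * h $ Some j)"
      by (simp add: lag_jac_def UNIV_option_conv sum.reindex)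
    finally show ?thesis by simp
  qed
  \<comment> \<open>The row of the equation f = 0 kills coordinate i0. Dominance in the rows other
    than i0 kills the remaining coordinates, and row i0 then kills the multiplier component.\<close>
  have "h $ Some i0 = 0"
    using row[of None] l0 by (simp add: e00 e0 if_distrib[of "\<lambda>c. c * _"] cong: if_cong)
  have row_Some: "(if i = i0 then 1 else 0) * h $ None + ((\<Sum>j\<in>UNIV. A $ i $ j * h $ Some j) + v Lm * h $ Some i) = 0" for i
    using row[of "Some i"] by (simp add: e1 e2 distrib_right sum.distrib if_distrib[of "\<lambda>c. c * _"] cong: if_cong)
  have "(\<chi> j. h $ Some j) = 0"
  proof (rule kernel_dominant_diagonal[of A "v Lm"])
    show "(\<Sum>i\<in>UNIV. \<Sum>j\<in>UNIV. norm (A $ i $ j)) < norm (v Lm)" using large by (simp add: A_def)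
    fix i assume "(\<chi> j. h $ Some j) $ i \<noteq> 0"
    then have "i \<noteq> i0" using \<open>h $ Some i0 = 0\<close> by auto
    then show "(\<Sum>j\<in>UNIV. A $ i $ j * (\<chi> j. h $ Some j) $ j) + v Lm * (\<chi> j. h $ Some j) $ i = 0"
      using row_Some[of i] by simp
  qed
  then have hS: "h $ Some j = 0" for j by (simp add: vec_eq_iff)
  then have "h $ None = 0" using row_Some[of i0] by simp
  then show "h = 0" using hS by (simp add: vec_eq_iff split_option_all)
qed

text \<open>With \<open>u\<close> and the other coefficients fixed, any multiplier and point solve
  the Lagrange system for exactly one choice of constant and linear coefficients. So the solutions
  are parametrised by n + 1 free parameters, and the degenerate ones form the zero set of a
  polynomial, shown nonzero by a large multiplier.\<close>

lemma generic_nondegenerate: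
  fixes a :: "nat^'n::finite"
  assumes pos: "\<And>i. 0 < a $ i"
  shows "generic (\<lambda>v. \<not> (\<exists>y. (\<forall>w. w \<notin> insert Lm (range Xc) \<longrightarrow> y w = v w) \<and>
    (\<forall>o'. lag_eq a o' y = 0) \<and> det (lag_jac a y) = 0))"
proof (rule generic_slice)
  define s :: "'n option \<Rightarrow> 'n edvar" where
    "s = (\<lambda>k. case k of None \<Rightarrow> Cf (corner a {}) | Some i \<Rightarrow> Cf (corner_succ a {} i))"
  show "inj s"
  proof (rule injI)
    fix k l assume "s k = s l"
    then show "k = l" by (cases k; cases l) (auto simp: s_def dest: sym)
  qed
  show "constructible {} {v. \<not> (\<exists>y. (\<forall>w. w \<notin> insert Lm (range Xc) \<longrightarrow> y w = v w) \<and>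
    (\<forall>o'. lag_eq a o' y = 0) \<and> det (lag_jac a y) = 0)}"
    by (intro constructible_Collect_not constructible_Collect_ex_off constructible_Collect_conj
        constructible_Collect_all_UNIV constructible_Collect_eq polyfn_lag_eq polyfn_det_lag_jac polyfn_0) simp
  fix v :: "'n edvar \<Rightarrow> complex"
  define x :: "('n option \<Rightarrow> complex) \<Rightarrow> 'n \<Rightarrow> complex" where "x = (\<lambda>z i. z (Some i))"
  define \<psi>S where "\<psi>S = (\<lambda>i z. - (z None * (x z i - v (Ud i)) + off_deriv a {} i (cfs v) (x z)))"
  define \<psi> :: "'n option \<Rightarrow> ('n option \<Rightarrow> complex) \<Rightarrow> complex" where
    "\<psi> = (\<lambda>k z. case k of None \<Rightarrow> - ((\<Sum>i\<in>UNIV. \<psi>S i z * x z i) + off_poly a {} (cfs v) (x z)) | Some i \<Rightarrow> \<psi>S i z)"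
  have px: "polyfn UNIV (\<lambda>z. x z i)" for i unfolding x_def by (rule polyfn.var)
  have p\<psi>S: "polyfn UNIV (\<lambda>z. \<psi>S i z)" for i unfolding \<psi>S_def by (intro polyfn_intros px)
  have p\<psi>: "polyfn UNIV (\<psi> k)" for k
    unfolding \<psi>_def by (cases k) (auto intro!: polyfn_intros p\<psi>S px)
  \<comment> \<open>\<open>\<tau> z\<close> completes a multiplier and a point to the unique system
    on the slice that they solve. It is polynomial in \<open>z\<close>, hence so is the determinant
    along it.\<close>
  define \<tau> :: "('n option \<Rightarrow> complex) \<Rightarrow> 'n edvar \<Rightarrow> complex" where
    "\<tau> = (\<lambda>z w. case w of Lm \<Rightarrow> z None | Xc i \<Rightarrow> x z i
       | _ \<Rightarrow> if w \<in> range s then \<psi> (inv s w) z else v w)"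
  have p\<tau>: "polyfn UNIV (\<lambda>z. \<tau> z w)" for w
    unfolding \<tau>_def by (cases w) (auto intro: polyfn_intros px p\<psi>)
  have \<tau>_Cf: "\<tau> z (Cf (corner a {})) = \<psi> None z" "\<tau> z (Cf (corner_succ a {} i)) = \<psi> (Some i) z" for z i
  proof -
    have "Cf (corner a {}) \<in> range s" "Cf (corner_succ a {} i) \<in> range s"
      by (rule range_eqI[of _ _ None], simp add: s_def) (rule range_eqI[of _ _ "Some i"], simp add: s_def)
    moreover have "inv s (Cf (corner a {})) = None" "inv s (Cf (corner_succ a {} i)) = Some i"
      using inv_f_f[OF \<open>inj s\<close>, of None] inv_f_f[OF \<open>inj s\<close>, of "Some i"] by (simp_all add: s_def)
    ultimately show "\<tau> z (Cf (corner a {})) = \<psi> None z" "\<tau> z (Cf (corner_succ a {} i)) = \<psi> (Some i) z"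
      by (simp_all add: \<tau>_def)
  qed
  have off_s: "Cf \<alpha> \<notin> range s" if "\<alpha> \<in> off_corner a {}" for \<alpha>
    using that by (auto simp: s_def off_corner_def split: option.splits)
  have \<tau>_off: "\<tau> z (Cf \<alpha>) = v (Cf \<alpha>)" if "\<alpha> \<in> off_corner a {}" for z \<alpha>
    using off_s[OF that] by (simp add: \<tau>_def)
  have \<tau>_Ud: "\<tau> z (Ud i) = v (Ud i)" for z i
    by (auto simp: \<tau>_def s_def split: option.splits)
  have \<tau>_x: "xcs (\<tau> z) = x z" "\<tau> z Lm = z None" for z by (simp_all add: \<tau>_def fun_eq_iff)
  have off_\<tau>: "off_poly a {} (cfs (\<tau> z)) y = off_poly a {} (cfs v) y"
    "off_deriv a {} i (cfs (\<tau> z)) y = off_deriv a {} i (cfs v) y" for z y i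
    by (rule off_cong; simp add: \<tau>_off)+
  have lag_\<tau>: "lag_eq a o' (\<tau> z) = 0" for o' z
  proof (cases o')
    case None
    then show ?thesis
      by (simp add: lag_eq_def \<tau>_x hom_poly_face_empty[OF pos] \<tau>_Cf off_\<tau>) (simp add: \<psi>_def)
  next
    case (Some i)
    have "\<tau> z (Xc i) = x z i" by (simp add: \<tau>_def)
    with Some show ?thesis
      by (simp add: lag_eq_def \<tau>_x \<tau>_Ud hom_deriv_face_empty[OF pos] \<tau>_Cf off_\<tau>) (simp add: \<psi>_def \<psi>S_def)
  qed
  define N :: "(complex^('n option)) set" where "N = {z. det (lag_jac a (\<tau> (($) z))) = 0}"
  have "negligible N"
  proof -
    obtain i0 :: 'n where True by blast
    define x1 where "x1 = (\<lambda>i. v (Ud i) + (if i = i0 then 1 else 0))"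
    \<comment> \<open>Entries of the Hessian of f at the chosen point. They involve neither the
      constant and linear coefficients nor the multiplier, so the multiplier can be chosen after
      them.\<close>
    define hs where "hs = (\<lambda>i j. deriv (\<lambda>t. off_deriv a {} i (cfs v) (x1(j := t))) (x1 j))"
    define l where "l = (\<Sum>i\<in>UNIV. \<Sum>j\<in>UNIV. norm (hs i j)) + 1"
    have "0 \<le> (\<Sum>i\<in>UNIV. \<Sum>j\<in>UNIV. norm (hs i j))" by (intro sum_nonneg) simp
    then have "0 < l" by (simp add: l_def)
    define z1 :: "complex^('n option)" where "z1 = (\<chi> k. case k of None \<Rightarrow> of_real l | Some i \<Rightarrow> x1 i)"
    have x1: "x (($) z1) = x1" by (simp add: x_def z1_def fun_eq_iff)
    have "det (lag_jac a (\<tau> (($) z1))) \<noteq> 0"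
    proof (rule lag_jac_large_multiplier[OF pos lag_\<tau>])
      show "\<tau> (($) z1) (Xc i) = \<tau> (($) z1) (Ud i) + (if i = i0 then 1 else 0)" for i
        using \<tau>_x(1)[of "($) z1"] unfolding x1 \<tau>_Ud by (metis x1_def)
      have "pd (Xc j) (\<lambda>v. off_deriv a {} i (cfs v) (xcs v)) (\<tau> (($) z1)) = hs i j" for i j
      proof -
        have "xcs ((\<tau> (($) z1))(Xc j := t)) = x1(j := t)" for t
          using fun_cong[OF \<tau>_x(1)[of "($) z1"]] by (auto simp: fun_eq_iff x1)
        moreover have "\<tau> (($) z1) (Xc j) = x1 j" using fun_cong[OF \<tau>_x(1)[of "($) z1"]] by (simp add: x1)
        ultimately show ?thesis by (simp add: pd_def hs_def off_\<tau>)
      qed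
      moreover have "norm (\<tau> (($) z1) Lm) = l" using \<open>0 < l\<close> by (simp add: \<tau>_x z1_def)
      ultimately show "(\<Sum>i\<in>UNIV. \<Sum>j\<in>UNIV. norm (pd (Xc j) (\<lambda>v. off_deriv a {} i (cfs v) (xcs v)) (\<tau> (($) z1))))
          < norm (\<tau> (($) z1) Lm)" by (simp add: l_def)
    qed
    then show ?thesis unfolding N_def
      by (intro negligible_polyfn_zeros[of "\<lambda>z. det (lag_jac a (\<tau> z))" z1] polyfn_subst[OF polyfn_det_lag_jac p\<tau>])
  qed
  moreover have "\<exists>z\<in>N. \<forall>k. y $ k = \<psi> k (($) z)"
    if "\<not> \<not> (\<exists>v'. (\<forall>w. w \<notin> insert Lm (range Xc) \<longrightarrow> v' w = slice s v y w) \<and>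
      (\<forall>o'. lag_eq a o' v' = 0) \<and> det (lag_jac a v') = 0)" for y
  proof -
    from that obtain v' where v': "\<And>w. w \<notin> insert Lm (range Xc) \<Longrightarrow> v' w = slice s v y w"
      "\<And>o'. lag_eq a o' v' = 0" "det (lag_jac a v') = 0" by auto
    define z :: "complex^('n option)" where "z = (\<chi> k. v' (lag_var k))"
    have xz: "x (($) z) = xcs v'" "z $ None = v' Lm" by (simp_all add: x_def z_def fun_eq_iff)
    have s: "Cf (corner a {}) = s None" "Cf (corner_succ a {} i) = s (Some i)" for i by (simp_all add: s_def)
    have Cf: "v' (Cf \<alpha>) = slice s v y (Cf \<alpha>)" for \<alpha> by (rule v'(1)) auto
    have c: "v' (Cf (corner a {})) = y $ None" "v' (Cf (corner_succ a {} i)) = y $ Some i" for i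
      unfolding Cf unfolding s by (rule slice_at[OF \<open>inj s\<close>])+
    have Ud: "v' (Ud i) = v (Ud i)" for i
    proof -
      have "Ud i \<notin> range s" by (auto simp: s_def split: option.splits)
      moreover have "v' (Ud i) = slice s v y (Ud i)" by (rule v'(1)) auto
      ultimately show ?thesis by (simp add: slice_off)
    qed
    have "v' (Cf \<alpha>) = v (Cf \<alpha>)" if "\<alpha> \<in> off_corner a {}" for \<alpha>
      using v'(1)[of "Cf \<alpha>"] slice_off[OF off_s[OF that], of v y] by auto
    then have off: "off_poly a {} (cfs v') r = off_poly a {} (cfs v) r"
      "off_deriv a {} i (cfs v') r = off_deriv a {} i (cfs v) r" for r i
      by (rule off_cong; simp)+
    have yS: "y $ Some i = \<psi>S i (($) z)" for i
      using v'(2)[of "Some i"]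
      by (simp add: lag_eq_def hom_deriv_face_empty[OF pos] c off Ud \<psi>S_def xz eq_neg_iff_add_eq_0 algebra_simps)
    have "y $ None + ((\<Sum>i\<in>UNIV. y $ Some i * xcs v' i) + off_poly a {} (cfs v) (xcs v')) = 0"
      using v'(2)[of None] by (simp add: lag_eq_def hom_poly_face_empty[OF pos] c off add.assoc)
    then have yN: "y $ None = \<psi> None (($) z)"
      unfolding \<psi>_def option.case xz yS by (simp only: eq_neg_iff_add_eq_0)
    have y\<psi>: "y $ k = \<psi> k (($) z)" for k
      using yN yS by (cases k) (simp_all add: \<psi>_def)
    have "\<tau> (($) z) w = v' w" for w
    proof (cases w)
      case (Cf \<alpha>)
      then have "v' w = slice s v y w" by (intro v'(1)) auto
      then show ?thesis using Cf by (simp add: \<tau>_def slice_def y\<psi>)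
    next
      case (Ud i)
      then show ?thesis using \<open>v' (Ud i) = v (Ud i)\<close> by (simp add: \<tau>_Ud)
    next
      case Lm then show ?thesis by (simp add: \<tau>_def xz)
    next
      case (Xc i) then show ?thesis by (simp add: \<tau>_def xz)
    qed
    then have "\<tau> (($) z) = v'" by auto
    then have "z \<in> N" using v'(3) by (simp add: N_def)
    then show ?thesis using y\<psi> by blast
  qed
  ultimately show "\<exists>(N :: (complex^('n option)) set) \<psi>. negligible N \<and> (\<forall>k. polyfn UNIV (\<psi> k)) \<and>
      (\<forall>y. \<not> \<not> (\<exists>v'. (\<forall>w. w \<notin> insert Lm (range Xc) \<longrightarrow> v' w = slice s v y w) \<and>
      (\<forall>o'. lag_eq a o' v' = 0) \<and> det (lag_jac a v') = 0) \<longrightarrow> (\<exists>z\<in>N. \<forall>k. y $ k = \<psi> k (($) z)))"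
    using p\<psi> by blast
qed

lemma generic_mono: "generic P \<Longrightarrow> (\<And>v. P v \<Longrightarrow> Q v) \<Longrightarrow> generic Q"
  unfolding generic_def by meson

text \<open>Smoothness along the finitely many faces covers the whole product of projective lines,
  because rescaling moves every point to the normal form of its face.\<close>

theorem generic_card_lagrange_points:
  fixes a :: "nat^'n::finite"
  assumes pos: "\<And>i. 0 < a $ i"
  shows "generic (\<lambda>v. finite (lagrange_points a (cfs v) (uds v)) \<and>
    card (lagrange_points a (cfs v) (uds v)) = (\<Sum>k=1..CARD('n). fact k * elem_sym k a))"
proof -
  let ?S = "\<lambda>J v. \<not> (\<exists>x. hom_poly a (cfs v) (face_p J x) (face_q J) = 0 \<and>
    (\<forall>i\<in>-J. hom_deriv a i (cfs v) (face_p J x) (face_q J) = 0))"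
  let ?D = "\<lambda>v. \<not> (\<exists>y. (\<forall>w. w \<notin> insert Lm (range Xc) \<longrightarrow> y w = v w) \<and>
    (\<forall>o'. lag_eq a o' y = 0) \<and> det (lag_jac a y) = 0)"
  have "generic (\<lambda>v. hom_poly a (cfs v) (uds v) (\<lambda>_. 1) \<noteq> 0 \<and> (\<forall>J\<in>UNIV. ?S J v) \<and> ?D v)"
    by (intro generic_conj generic_all generic_point_off generic_smooth_face generic_nondegenerate pos) simp
  then show ?thesis
  proof (rule generic_mono)
    fix v assume v: "hom_poly a (cfs v) (uds v) (\<lambda>_. 1) \<noteq> 0 \<and> (\<forall>J\<in>UNIV. ?S J v) \<and> ?D v"
    define u :: "complex^'n" where "u = (\<chi> i. v (Ud i))"
    have u: "($) u = uds v" by (simp add: u_def fun_eq_iff)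
    have 1: "hom_poly a (cfs v) (($) u) (\<lambda>_. 1) \<noteq> 0" using v by (simp add: u)
    have 2: "\<exists>i. q i \<noteq> 0 \<and> hom_deriv a i (cfs v) p q \<noteq> 0"
      if pq: "\<And>j. p j \<noteq> 0 \<or> q j \<noteq> 0" and zero: "hom_poly a (cfs v) p q = 0" for p q
    proof (rule ccontr)
      assume no: "\<not> ?thesis"
      \<comment> \<open>The face is given by the coordinates at infinity; \<open>s\<close> makes
        \<open>p\<close> equal to 1 on it and \<open>q\<close> equal to 1 off it.\<close>
      define J where "J = {j. q j = 0}"
      define s where "s = (\<lambda>j. if q j = 0 then 1 / p j else 1 / q j)"
      have s: "s j \<noteq> 0" for j using pq[of j] by (auto simp: s_def)
      define x where "x = (\<lambda>j. p j / q j)"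
      have "(\<lambda>j. s j * p j) = face_p J x" "(\<lambda>j. s j * q j) = face_q J"
        using pq by (auto simp: s_def face_p_def face_q_def J_def x_def fun_eq_iff)
      then have "hom_poly a (cfs v) (face_p J x) (face_q J) = 0"
        "\<forall>i\<in>-J. s i * hom_deriv a i (cfs v) (face_p J x) (face_q J) = 0"
        using hom_poly_scale[of a "cfs v" s p q] hom_deriv_scale[of s _ a "cfs v" p q] zero no by (auto simp: J_def)
      then have "hom_poly a (cfs v) (face_p J x) (face_q J) = 0 \<and>
          (\<forall>i\<in>-J. hom_deriv a i (cfs v) (face_p J x) (face_q J) = 0)" using s by simp
      then show False using v by blast
    qed
    have 3: "det (jac (lagrange_family a (cfs v) (($) u)) (pt 0 z)) \<noteq> 0"
      if z: "z \<in> lagrange_points a (cfs v) (($) u)" for z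
    proof
      assume det: "det (jac (lagrange_family a (cfs v) (($) u)) (pt 0 z)) = 0"
      define y where "y = (\<lambda>w. case w of Lm \<Rightarrow> z $ None | Xc i \<Rightarrow> z $ Some i | _ \<Rightarrow> v w)"
      have cu: "cfs y = cfs v" "uds y = uds v" by (simp_all add: y_def)
      have zy: "z $ k = y (lag_var k)" for k by (cases k) (simp_all add: y_def)
      have "lag_eq a o' y = 0" for o'
        using z lagrange_family_lag_eq[of "pt 0 z" y a o'] zy by (simp add: lagrange_points_def u cu)
      moreover have "det (lag_jac a y) = 0"
        using det jac_lagrange_family[of z y a, OF zy] by (simp add: u cu)
      moreover have "y w = v w" if "w \<notin> insert Lm (range Xc)" for w
        using that by (cases w) (auto simp: y_def)
      ultimately show False using v by blast
    qed
    from card_lagrange_points[OF 1 2 3]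
    show "finite (lagrange_points a (cfs v) (uds v)) \<and>
      card (lagrange_points a (cfs v) (uds v)) = (\<Sum>k=1..CARD('n). fact k * elem_sym k a)" by (simp add: u)
  qed
qed

section \<open>Polynomials as finitely supported maps\<close>

lemma eval_rpoly_0: "eval_rpoly 0 x = 0"
  by (simp add: eval_rpoly_def)

lemma eval_rpoly_add: "eval_rpoly (f + g) x = eval_rpoly f x + eval_rpoly g x"
  unfolding eval_rpoly_def
  by (rule setsum_keys_plus_distrib[where f = "\<lambda>\<alpha> c. of_real c * (\<Prod>i\<in>Poly_Mapping.keys \<alpha>. x i ^ Poly_Mapping.lookup \<alpha> i)"])
    (simp_all add: algebra_simps)

lemma eval_rpoly_sum: "eval_rpoly (\<Sum>i\<in>I. f i) x = (\<Sum>i\<in>I. eval_rpoly (f i) x)"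
  by (induction I rule: infinite_finite_induct) (simp_all add: eval_rpoly_0 eval_rpoly_add)

lemma eval_rpoly_single:
  "eval_rpoly (Poly_Mapping.single \<alpha> c) x = of_real c * (\<Prod>i\<in>Poly_Mapping.keys \<alpha>. x i ^ Poly_Mapping.lookup \<alpha> i)"
  by (simp add: eval_rpoly_def)

lemma monomial_add:
  fixes x :: "'v \<Rightarrow> 'a::comm_semiring_1"
  shows "(\<Prod>i\<in>Poly_Mapping.keys (\<alpha> + \<beta>). x i ^ Poly_Mapping.lookup (\<alpha> + \<beta>) i) =
    (\<Prod>i\<in>Poly_Mapping.keys \<alpha>. x i ^ Poly_Mapping.lookup \<alpha> i) * (\<Prod>i\<in>Poly_Mapping.keys \<beta>. x i ^ Poly_Mapping.lookup \<beta> i)"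
proof -
  let ?K = "Poly_Mapping.keys \<alpha> \<union> Poly_Mapping.keys \<beta>"
  have ext: "(\<Prod>i\<in>Poly_Mapping.keys \<gamma>. x i ^ Poly_Mapping.lookup \<gamma> i) = (\<Prod>i\<in>?K. x i ^ Poly_Mapping.lookup \<gamma> i)"
    if "Poly_Mapping.keys \<gamma> \<subseteq> ?K" for \<gamma> :: "'v \<Rightarrow>\<^sub>0 nat"
    by (rule prod.mono_neutral_left) (use that in \<open>auto simp: in_keys_iff\<close>)
  show ?thesis
    using ext[of "\<alpha> + \<beta>"] ext[of \<alpha>] ext[of \<beta>] Poly_Mapping.keys_add[of \<alpha> \<beta>]
    by (simp add: lookup_add power_add prod.distrib)
qed

lemma sum_single_lookup: "(\<Sum>\<alpha>\<in>Poly_Mapping.keys p. Poly_Mapping.single \<alpha> (Poly_Mapping.lookup p \<alpha>)) = p"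
proof (rule poly_mapping_eqI)
  fix \<beta>
  show "Poly_Mapping.lookup (\<Sum>\<alpha>\<in>Poly_Mapping.keys p. Poly_Mapping.single \<alpha> (Poly_Mapping.lookup p \<alpha>)) \<beta> = Poly_Mapping.lookup p \<beta>"
    by (simp add: lookup_sum lookup_single when_def in_keys_iff)
qed

lemma eval_rpoly_mult: "eval_rpoly (f * g) x = eval_rpoly f x * eval_rpoly g x"
proof -
  let ?m = "\<lambda>\<alpha>. \<Prod>i\<in>Poly_Mapping.keys \<alpha>. x i ^ Poly_Mapping.lookup \<alpha> i"
  have "f * g = (\<Sum>\<alpha>\<in>Poly_Mapping.keys f. Poly_Mapping.single \<alpha> (Poly_Mapping.lookup f \<alpha>)) *
      (\<Sum>\<beta>\<in>Poly_Mapping.keys g. Poly_Mapping.single \<beta> (Poly_Mapping.lookup g \<beta>))"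
    by (simp only: sum_single_lookup)
  also have "\<dots> = (\<Sum>\<alpha>\<in>Poly_Mapping.keys f. \<Sum>\<beta>\<in>Poly_Mapping.keys g.
      Poly_Mapping.single (\<alpha> + \<beta>) (Poly_Mapping.lookup f \<alpha> * Poly_Mapping.lookup g \<beta>))"
    by (simp add: sum_product mult_single)
  finally have "eval_rpoly (f * g) x = (\<Sum>\<alpha>\<in>Poly_Mapping.keys f. \<Sum>\<beta>\<in>Poly_Mapping.keys g.
      (of_real (Poly_Mapping.lookup f \<alpha>) * ?m \<alpha>) * (of_real (Poly_Mapping.lookup g \<beta>) * ?m \<beta>))"
    by (simp add: eval_rpoly_sum eval_rpoly_single monomial_add mult_ac)
  then show ?thesis by (simp add: eval_rpoly_def sum_product)
qed

lemma eval_rpoly_of_real: "eval_rpoly p (\<lambda>v. of_real (y v)) = of_real (eval_rpoly p y)"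
  by (simp add: eval_rpoly_def)

lemma polyfn_eval_rpoly [polyfn_intros]: "polyfn C (eval_rpoly p)"
  unfolding eval_rpoly_def by (intro polyfn_intros)

lemma polyfn_imp_rpoly: "polyfn {} D \<Longrightarrow> \<exists>p :: 'v rpoly. \<forall>x. D x = eval_rpoly p x"
proof (induction rule: polyfn.induct)
  case (const c)
  then obtain r where "c = of_real r" by (auto simp: Reals_def)
  then show ?case by (intro exI[of _ "Poly_Mapping.single 0 r"]) (simp add: eval_rpoly_single)
next
  case (var v)
  show ?case by (intro exI[of _ "Poly_Mapping.single (Poly_Mapping.single v 1) 1"]) (simp add: eval_rpoly_single)
next
  case (add p q) then show ?case by (metis eval_rpoly_add)
next
  case (mult p q) then show ?case by (metis eval_rpoly_mult)
qed

lemma eval_rpoly_hom_poly: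
  fixes x :: "'n::finite \<Rightarrow> complex"
  assumes "Poly_Mapping.keys f \<subseteq> exponents a"
  shows "eval_rpoly f x = hom_poly a (\<lambda>\<alpha>. of_real (Poly_Mapping.lookup f \<alpha>)) x (\<lambda>_. 1)"
proof -
  have "(\<Prod>i\<in>Poly_Mapping.keys \<alpha>. x i ^ Poly_Mapping.lookup \<alpha> i) = (\<Prod>i\<in>UNIV. x i ^ Poly_Mapping.lookup \<alpha> i)" for \<alpha>
    by (rule prod.mono_neutral_left) (auto simp: in_keys_iff)
  then have "eval_rpoly f x = (\<Sum>\<alpha>\<in>Poly_Mapping.keys f. of_real (Poly_Mapping.lookup f \<alpha>) * (\<Prod>i\<in>UNIV. x i ^ Poly_Mapping.lookup \<alpha> i))"
    by (simp add: eval_rpoly_def)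
  also have "\<dots> = (\<Sum>\<alpha>\<in>exponents a. of_real (Poly_Mapping.lookup f \<alpha>) * (\<Prod>i\<in>UNIV. x i ^ Poly_Mapping.lookup \<alpha> i))"
    by (rule sum.mono_neutral_left[OF finite_exponents assms]) (auto simp: in_keys_iff)
  finally show ?thesis by (simp add: hom_poly_def)
qed

lemma eval_partial_deriv_hom_deriv:
  fixes x :: "'n::finite \<Rightarrow> complex"
  assumes "Poly_Mapping.keys f \<subseteq> exponents a"
  shows "eval_rpoly (partial_deriv i f) x = hom_deriv a i (\<lambda>\<alpha>. of_real (Poly_Mapping.lookup f \<alpha>)) x (\<lambda>_. 1)"
proof -
  let ?l = "Poly_Mapping.lookup"
  let ?t = "\<lambda>\<alpha>. of_real (?l f \<alpha>) * (of_nat (?l \<alpha> i) * x i ^ (?l \<alpha> i - 1)) * (\<Prod>j\<in>-{i}. x j ^ ?l \<alpha> j)"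
  have term_eq: "eval_rpoly (Poly_Mapping.single (\<alpha> - Poly_Mapping.single i 1) (real (?l \<alpha> i) * ?l f \<alpha>)) x = ?t \<alpha>" for \<alpha>
  proof -
    let ?b = "\<alpha> - Poly_Mapping.single i 1"
    have "(\<Prod>j\<in>Poly_Mapping.keys ?b. x j ^ ?l ?b j) = (\<Prod>j\<in>UNIV. x j ^ ?l ?b j)"
      by (rule prod.mono_neutral_left) (auto simp: in_keys_iff)
    also have "\<dots> = x i ^ ?l ?b i * (\<Prod>j\<in>-{i}. x j ^ ?l ?b j)"
      by (simp add: prod.remove[of UNIV i] Compl_eq_Diff_UNIV)
    also have "(\<Prod>j\<in>-{i}. x j ^ ?l ?b j) = (\<Prod>j\<in>-{i}. x j ^ ?l \<alpha> j)"
      by (intro prod.cong) (auto simp: lookup_minus lookup_single when_def)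
    finally show ?thesis by (simp add: eval_rpoly_single lookup_minus)
  qed
  have "eval_rpoly (partial_deriv i f) x = (\<Sum>\<alpha>\<in>Poly_Mapping.keys f. ?t \<alpha>)"
    by (simp only: partial_deriv_def eval_rpoly_sum term_eq)
  also have "\<dots> = (\<Sum>\<alpha>\<in>exponents a. ?t \<alpha>)"
    by (rule sum.mono_neutral_left[OF finite_exponents assms]) (auto simp: in_keys_iff)
  finally show ?thesis by (simp add: hom_deriv_def)
qed

lemma lagrange_zeros_bij:
  fixes u :: "real^'n::finite"
  assumes "Poly_Mapping.keys f \<subseteq> exponents a"
  shows "bij_betw (\<lambda>z. (z $ None, coords z))
    (lagrange_points a (\<lambda>\<alpha>. of_real (Poly_Mapping.lookup f \<alpha>)) (\<lambda>i. of_real (u $ i))) {z. lagrange f u z = 0}"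
proof (rule bij_betw_byWitness[where f' = "\<lambda>(l, x). with_mult l x"])
  have lag: "lagrange f u (l, x) = 0 \<longleftrightarrow> with_mult l x \<in>
      lagrange_points a (\<lambda>\<alpha>. of_real (Poly_Mapping.lookup f \<alpha>)) (\<lambda>i. of_real (u $ i))" for l x
    by (simp add: lagrange_def lagrange_points_iff eval_rpoly_hom_poly[OF assms] eval_partial_deriv_hom_deriv[OF assms]
        zero_prod_def vec_eq_iff algebra_simps)
  have wm: "with_mult (z $ None) (coords z) = z" for z :: "complex^('n option)"
    by (simp add: vec_eq_iff split_option_all coords_def)
  show "(\<lambda>z. (z $ None, coords z)) ` lagrange_points a (\<lambda>\<alpha>. of_real (Poly_Mapping.lookup f \<alpha>)) (\<lambda>i. of_real (u $ i))
      \<subseteq> {z. lagrange f u z = 0}"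
    by (auto simp: lag wm)
  show "(\<lambda>(l, x). with_mult l x) ` {z. lagrange f u z = 0} \<subseteq>
      lagrange_points a (\<lambda>\<alpha>. of_real (Poly_Mapping.lookup f \<alpha>)) (\<lambda>i. of_real (u $ i))"
    by (auto simp: lag)
qed (auto simp: vec_eq_iff split_option_all coords_def)

section \<open>Newton polytopes equal to a box, and the upper bound\<close>

lemma newton_polytope_keys:
  assumes "newton_polytope f = box_polytope a"
  shows "Poly_Mapping.keys f \<subseteq> exponents a"
proof
  fix \<alpha> assume "\<alpha> \<in> Poly_Mapping.keys f"
  then have "(\<chi> i. real (Poly_Mapping.lookup \<alpha> i)) \<in> newton_polytope f"
    unfolding newton_polytope_def by (intro hull_inc imageI)
  then show "\<alpha> \<in> exponents a" unfolding assms by (simp add: box_polytope_def exponents_def)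
qed

text \<open>New exponents inside the box leave the hull unchanged, so small perturbations of the
  coefficients stay in the same space of polynomials.\<close>

lemma newton_polytope_eqI:
  assumes "newton_polytope f = box_polytope a"
    and "Poly_Mapping.keys f \<subseteq> Poly_Mapping.keys g" "Poly_Mapping.keys g \<subseteq> exponents a"
  shows "newton_polytope g = box_polytope a"
proof
  show "box_polytope a \<subseteq> newton_polytope g"
    unfolding assms(1)[symmetric] newton_polytope_def using assms(2) by (intro hull_mono image_mono)
  have "convex (box_polytope a)"
    unfolding box_polytope_def convex_def by (auto intro: convex_bound_le)
  then show "newton_polytope g \<subseteq> box_polytope a"
    unfolding newton_polytope_def using assms(3)
    by (intro hull_minimal) (auto simp: box_polytope_def exponents_def)
qed

text \<open>The origin is a vertex of the box, and an extreme point of a convex hull belongs to the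
  generating set. So the constant term is present, and f is not identically zero.\<close>

lemma eval_0_nonzero:
  fixes a :: "nat^'n::finite"
  assumes "newton_polytope f = box_polytope a"
  shows "eval_rpoly f (\<lambda>_. 0) \<noteq> (0::complex)"
proof -
  have "(0::real^'n) extreme_point_of box_polytope a"
    unfolding extreme_point_of_def
  proof (intro conjI ballI notI)
    show "0 \<in> box_polytope a" by (simp add: box_polytope_def)
    fix x y assume xy: "x \<in> box_polytope a" "y \<in> box_polytope a" "0 \<in> open_segment x y"
    then obtain t where t: "x \<noteq> y" "0 < t" "t < 1" "0 = (1 - t) *\<^sub>R x + t *\<^sub>R y" by (auto simp: in_segment)
    have "x $ i = 0 \<and> y $ i = 0" for i
    proof -
      have "0 = (1 - t) * x $ i + t * y $ i" using arg_cong[OF t(4), of "\<lambda>v. v $ i"] by simp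
      moreover have "0 \<le> x $ i" "0 \<le> y $ i" using xy by (auto simp: box_polytope_def)
      ultimately show ?thesis using t by (auto simp: add_nonneg_eq_0_iff dest: sym)
    qed
    then show False using t(1) by (simp add: vec_eq_iff)
  qed
  then have "(0::real^'n) \<in> (\<lambda>\<alpha>. \<chi> i. real (Poly_Mapping.lookup \<alpha> i)) ` Poly_Mapping.keys f"
    unfolding assms[symmetric] newton_polytope_def by (rule extreme_point_of_convex_hull)
  then obtain \<alpha> where \<alpha>: "\<alpha> \<in> Poly_Mapping.keys f" "\<And>i. Poly_Mapping.lookup \<alpha> i = 0"
    by (auto simp: vec_eq_iff)
  then have "\<alpha> = 0" by (intro poly_mapping_eqI) simp
  have "eval_rpoly f (\<lambda>_. 0) = (\<Sum>\<beta>\<in>Poly_Mapping.keys f. if \<beta> = 0 then of_real (Poly_Mapping.lookup f 0) else (0::complex))"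
    unfolding eval_rpoly_def
  proof (rule sum.cong[OF refl])
    fix \<beta>
    show "of_real (Poly_Mapping.lookup f \<beta>) * (\<Prod>i\<in>Poly_Mapping.keys \<beta>. 0 ^ Poly_Mapping.lookup \<beta> i) =
        (if \<beta> = 0 then of_real (Poly_Mapping.lookup f 0) else (0::complex))"
    proof (cases "\<beta> = 0")
      case False
      then obtain i where "i \<in> Poly_Mapping.keys \<beta>" by (metis keys_eq_empty all_not_in_conv)
      then have "\<exists>i\<in>Poly_Mapping.keys \<beta>. (0::complex) ^ Poly_Mapping.lookup \<beta> i = 0"
        by (intro bexI[of _ i]) (simp_all add: in_keys_iff)
      then have "(\<Prod>i\<in>Poly_Mapping.keys \<beta>. (0::complex) ^ Poly_Mapping.lookup \<beta> i) = 0"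
        by (simp only: prod_zero_iff[OF finite_keys])
      then show ?thesis using False by simp
    qed simp
  qed
  also have "\<dots> = of_real (Poly_Mapping.lookup f 0)" using \<alpha>(1) \<open>\<alpha> = 0\<close> by simp
  finally show ?thesis using \<alpha>(1) \<open>\<alpha> = 0\<close> by (simp add: in_keys_iff)
qed

text \<open>Both a polynomial witnessing that \<open>V\<close> is proper and f are nonzero, so some
  real \<open>u\<close> avoids the zeros of both. For this \<open>u\<close> the solution set is
  finite, hence all its points are isolated.\<close>

lemma has_EDD_le:
  fixes a :: "nat^'n::finite"
  assumes f: "newton_polytope f = box_polytope a" and d: "has_EDD f d"
  shows "d \<le> (\<Sum>k=1..CARD('n). fact k * elem_sym k a)"
proof -
  note keys = newton_polytope_keys[OF f]
  from d obtain V where V: "algebraic_subvariety V" "V \<noteq> UNIV"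
    "\<And>u. u \<notin> V \<Longrightarrow> finite {z. lagrange f u z = 0} \<and> card {z. lagrange f u z = 0} = d"
    unfolding has_EDD_def by blast
  obtain P where P: "V = {u. \<forall>p\<in>P. eval_rpoly p (\<lambda>j. u $ j) = 0}"
    using V(1) unfolding algebraic_subvariety_def by blast
  obtain p u0 where p: "p \<in> P" "eval_rpoly p (\<lambda>j. (u0::real^'n) $ j) \<noteq> 0" using P V(2) by blast
  have "eval_rpoly p (\<lambda>j. of_real (u0 $ j)) \<noteq> (0::complex)" using p(2) by (simp add: eval_rpoly_of_real)
  then obtain y where "eval_rpoly p y * eval_rpoly f y \<noteq> (0::complex)"
    using polyfn_common_nonzero[OF polyfn_eval_rpoly polyfn_eval_rpoly _ eval_0_nonzero[OF f]] by blast
  then obtain u1 :: "'n \<Rightarrow> real" where u1: "eval_rpoly p (\<lambda>v. of_real (u1 v)) * eval_rpoly f (\<lambda>v. of_real (u1 v)) \<noteq> (0::complex)"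
    using polyfn_real_nonzero[OF polyfn.mult[OF polyfn_eval_rpoly[of "{}"] polyfn_eval_rpoly[of "{}"]], where x = y] by blast
  define u where "u = (\<chi> i. u1 i)"
  let ?c = "\<lambda>\<alpha>. complex_of_real (Poly_Mapping.lookup f \<alpha>)"
  define w :: "complex^'n" where "w = (\<chi> i. of_real (u1 i))"
  have w: "($) w = (\<lambda>i. of_real (u $ i))" by (simp add: w_def u_def fun_eq_iff)
  let ?L = "lagrange_points a ?c (($) w)"
  have "u \<notin> V"
    using p(1) u1 by (auto simp: P u_def eval_rpoly_of_real vec_lambda_inverse intro!: bexI[of _ p])
  from V(3)[OF this] have L: "finite ?L" "card ?L = d"
    using bij_betw_finite[OF lagrange_zeros_bij[OF keys]] bij_betw_same_card[OF lagrange_zeros_bij[OF keys]] by (simp_all add: w)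
  have "card ?L \<le> (\<Sum>k=1..CARD('n). fact k * elem_sym k a)"
  proof (rule card_isolated_lagrange_points_le[OF _ L(1) order_refl])
    show "hom_poly a ?c (($) w) (\<lambda>_. 1) \<noteq> 0"
      using u1 by (simp add: w u_def flip: eval_rpoly_hom_poly[OF keys])
    fix z assume "z \<in> ?L"
    obtain r where "r > 0" "\<forall>y\<in>?L. y \<noteq> z \<longrightarrow> r \<le> dist z y" using finite_set_avoid[OF L(1), of z] by blast
    then show "\<exists>r>0. \<forall>y\<in>cball z r. y \<in> ?L \<longrightarrow> y = z"
      by (intro exI[of _ "r / 2"]) force
  qed
  then show ?thesis using L(2) by simp
qed

section \<open>The dense open set\<close>

lemma open_eval_rpoly_nonzero: "open {c. eval_rpoly p c \<noteq> (0::real)}"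
proof -
  have "continuous_on UNIV (eval_rpoly p :: _ \<Rightarrow> real)"
    unfolding eval_rpoly_def
    by (intro continuous_on_sum continuous_on_mult continuous_on_const continuous_on_prod continuous_on_power
        continuous_on_product_coordinates)
  then show ?thesis by (intro open_Collect_neq continuous_on_const)
qed

lemma zariski_imp_euclidean_open:
  assumes "openin (zariski_coeff_topology a) U"
  shows "openin (euclidean_coeff_topology a) U"
proof -
  obtain V where V: "openin (topology_generated_by (range (\<lambda>p :: ('a \<Rightarrow>\<^sub>0 nat) rpoly. {c. eval_rpoly p c \<noteq> 0}))) V"
    "U = Poly_Mapping.lookup -` V \<inter> polys_with_polytope a"
    using assms unfolding zariski_coeff_topology_def openin_pullback_topology by blast
  have "openin euclidean V"
    by (rule generate_topology_on_coarsest[OF _ _ openin_topology_generated_by[OF V(1)]])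
      (auto simp: open_eval_rpoly_nonzero)
  then show ?thesis
    unfolding euclidean_coeff_topology_def openin_pullback_topology using V(2) by blast
qed

lemma topspace_coeff_topology:
  "topspace (euclidean_coeff_topology a) = polys_with_polytope a"
  "topspace (zariski_coeff_topology a) = polys_with_polytope a"
proof -
  show "topspace (euclidean_coeff_topology a) = polys_with_polytope a"
    by (simp add: euclidean_coeff_topology_def topspace_pullback_topology)
  \<comment> \<open>The constant polynomial 1 has the full space as nonvanishing locus, so the
    generated topology covers it.\<close>
  have "c \<in> {c. eval_rpoly 1 c \<noteq> (0::real)}" for c :: "('a \<Rightarrow>\<^sub>0 nat) \<Rightarrow> real"
    by (simp add: eval_rpoly_def)
  then have "(\<Union>p :: ('a \<Rightarrow>\<^sub>0 nat) rpoly. {c. eval_rpoly p c \<noteq> (0::real)}) = UNIV" by blast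
  then show "topspace (zariski_coeff_topology a) = polys_with_polytope a"
    by (simp add: zariski_coeff_topology_def topspace_pullback_topology)
qed

text \<open>Zariski-open sets are Euclidean-open, so meeting every nonempty Euclidean-open set gives
  density in both topologies.\<close>

lemma dense_open_inI:
  assumes "openin (zariski_coeff_topology a) U"
    and "\<And>f T. newton_polytope f = box_polytope a \<Longrightarrow> open T \<Longrightarrow> Poly_Mapping.lookup f \<in> T \<Longrightarrow>
      \<exists>g\<in>U. Poly_Mapping.lookup g \<in> T"
  shows "dense_open_in (zariski_coeff_topology a) U" "dense_open_in (euclidean_coeff_topology a) U"
proof -
  have U: "U \<subseteq> polys_with_polytope a"
    using openin_subset[OF assms(1)] by (simp add: topspace_coeff_topology)
  have meet: "\<exists>g. g \<in> U \<and> g \<in> W" if "openin (euclidean_coeff_topology a) W" "f \<in> W" for W f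
  proof -
    have "\<exists>T. open T \<and> W = Poly_Mapping.lookup -` T \<inter> polys_with_polytope a"
      using that(1) by (simp only: euclidean_coeff_topology_def openin_pullback_topology open_openin)
    then obtain T where "open T" and W: "W = Poly_Mapping.lookup -` T \<inter> polys_with_polytope a" by (elim exE conjE)
    with that(2) obtain g where "g \<in> U" "Poly_Mapping.lookup g \<in> T"
      using assms(2)[of f T] by (auto simp: polys_with_polytope_def)
    then show ?thesis using W U by auto
  qed
  have "euclidean_coeff_topology a closure_of U = topspace (euclidean_coeff_topology a)"
    using meet by (auto simp: in_closure_of)
  then show "dense_open_in (euclidean_coeff_topology a) U"
    by (simp add: dense_open_in_def zariski_imp_euclidean_open[OF assms(1)])
  have "zariski_coeff_topology a closure_of U = topspace (zariski_coeff_topology a)"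
    using meet[OF zariski_imp_euclidean_open] by (auto simp: in_closure_of)
  then show "dense_open_in (zariski_coeff_topology a) U"
    by (simp add: dense_open_in_def assms(1))
qed

lemma lagrange_points_cong:
  assumes "\<And>\<alpha>. \<alpha> \<in> exponents a \<Longrightarrow> c \<alpha> = c' \<alpha>"
  shows "lagrange_points a c u = lagrange_points a c' u"
proof -
  have "hom_poly a c p q = hom_poly a c' p q" "hom_deriv a i c p q = hom_deriv a i c' p q" for p q i
    unfolding hom_poly_def hom_deriv_def using assms by (auto intro!: sum.cong)
  then show ?thesis by (auto simp: lagrange_points_iff)
qed

lemma algebraic_subvariety_polyfn_zeros:
  assumes "polyfn {} (D :: ('n::finite \<Rightarrow> complex) \<Rightarrow> complex)"
  shows "algebraic_subvariety {u. D (\<lambda>i. of_real (u $ i)) = 0}"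
proof -
  obtain p where "\<And>x. D x = eval_rpoly p x" using polyfn_imp_rpoly[OF assms] by blast
  then have "{u. D (\<lambda>i. of_real (u $ i)) = 0} = {u::real^'n. \<forall>q\<in>{p}. eval_rpoly q (\<lambda>j. u $ j) = 0}"
    by (simp add: eval_rpoly_of_real)
  then show ?thesis unfolding algebraic_subvariety_def by blast
qed

lemma zariski_open_polyfn_nonzero:
  assumes "\<And>i. polyfn {} (D i :: (('n::finite \<Rightarrow>\<^sub>0 nat) \<Rightarrow> complex) \<Rightarrow> complex)"
  shows "openin (zariski_coeff_topology a)
    {f \<in> polys_with_polytope a. \<exists>i. D i (\<lambda>\<alpha>. of_real (Poly_Mapping.lookup f \<alpha>)) \<noteq> 0}"
proof -
  let ?T = "topology_generated_by (range (\<lambda>p :: ('n \<Rightarrow>\<^sub>0 nat) rpoly. {c. eval_rpoly p c \<noteq> (0::real)}))"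
  have "openin ?T {c. D i (\<lambda>\<alpha>. of_real (c \<alpha>)) \<noteq> 0}" for i
  proof -
    obtain p where "\<And>x. D i x = eval_rpoly p x" using polyfn_imp_rpoly[OF assms] by blast
    then have "{c. D i (\<lambda>\<alpha>. of_real (c \<alpha>)) \<noteq> 0} = {c. eval_rpoly p c \<noteq> (0::real)}"
      by (simp add: eval_rpoly_of_real)
    then show ?thesis
      unfolding openin_topology_generated_by_iff by (auto intro: generate_topology_on.Basis)
  qed
  then have "openin ?T (\<Union>i. {c. D i (\<lambda>\<alpha>. of_real (c \<alpha>)) \<noteq> 0})" by (intro openin_Union) auto
  moreover have "{f \<in> polys_with_polytope a. \<exists>i. D i (\<lambda>\<alpha>. of_real (Poly_Mapping.lookup f \<alpha>)) \<noteq> 0} =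
      Poly_Mapping.lookup -` (\<Union>i. {c. D i (\<lambda>\<alpha>. of_real (c \<alpha>)) \<noteq> 0}) \<inter> polys_with_polytope a" by auto
  ultimately show ?thesis unfolding zariski_coeff_topology_def openin_pullback_topology by blast
qed

text \<open>\<open>U\<close> consists of the f for which the generic polynomial in coefficients and
  data point is nonzero at some real data point. For such f its zeros in \<open>u\<close> are the
  proper subvariety off which the count holds.\<close>

lemma generic_has_EDD:
  fixes a :: "nat^'n::finite"
  assumes pos: "\<And>i. 0 < a $ i"
  shows "\<exists>U. dense_open_in (zariski_coeff_topology a) U \<and> dense_open_in (euclidean_coeff_topology a) U \<and>
    (\<forall>f\<in>U. has_EDD f (\<Sum>k=1..CARD('n). fact k * elem_sym k a))"
proof -
  let ?N = "\<Sum>k=1..CARD('n). fact k * elem_sym k a"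
  obtain D x where D: "polyfn {} D" "D x \<noteq> 0" and count: "\<And>v. D v \<noteq> 0 \<Longrightarrow>
      finite (lagrange_points a (cfs v) (uds v)) \<and> card (lagrange_points a (cfs v) (uds v)) = ?N"
    using generic_card_lagrange_points[OF pos] unfolding generic_def by blast
  obtain y where y: "D (\<lambda>v. of_real (y v)) \<noteq> 0" using polyfn_real_nonzero[OF D] by blast
  \<comment> \<open>The variables other than \<open>u\<close> and the coefficients in the box are
    frozen at a real point where \<open>D\<close> is nonzero; they do not affect the Lagrange
    points.\<close>
  define w where "w = (\<lambda>c u v. case v of Cf \<alpha> \<Rightarrow> if \<alpha> \<in> exponents a then c \<alpha> else complex_of_real (y v)
    | Ud i \<Rightarrow> u i | _ \<Rightarrow> of_real (y v))"
  define E where "E = (\<lambda>c u. D (w c u))"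
  have E: "finite (lagrange_points a c u) \<and> card (lagrange_points a c u) = ?N" if "E c u \<noteq> 0" for c u
  proof -
    have "uds (w c u) = u" by (simp add: w_def)
    moreover have "lagrange_points a (cfs (w c u)) u = lagrange_points a c u"
      by (rule lagrange_points_cong) (simp add: w_def)
    ultimately show ?thesis using count[of "w c u"] that by (simp add: E_def)
  qed
  let ?c = "\<lambda>f \<alpha>. complex_of_real (Poly_Mapping.lookup f \<alpha>)"
  define U where "U = {f \<in> polys_with_polytope a. \<exists>u::'n \<Rightarrow> real. E (?c f) (\<lambda>i. of_real (u i)) \<noteq> 0}"
  have "polyfn {} (\<lambda>c. E c (\<lambda>i. of_real (u i)))" for u :: "'n \<Rightarrow> real"
    unfolding E_def
  proof (rule polyfn_subst[OF D(1)])
    show "polyfn {} (\<lambda>c. w c (\<lambda>i. of_real (u i)) v)" for v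
      by (cases v) (auto simp: w_def intro: polyfn_intros)
  qed
  then have open_U: "openin (zariski_coeff_topology a) U"
    unfolding U_def by (rule zariski_open_polyfn_nonzero)
  have EDD: "has_EDD f ?N" if "f \<in> U" for f
  proof -
    have keys: "Poly_Mapping.keys f \<subseteq> exponents a"
      using that newton_polytope_keys by (auto simp: U_def polys_with_polytope_def)
    let ?V = "{u::real^'n. E (?c f) (\<lambda>i. of_real (u $ i)) = 0}"
    have "polyfn {} (\<lambda>u. E (?c f) u)"
      unfolding E_def
    proof (rule polyfn_subst[OF D(1)])
      show "polyfn {} (\<lambda>u. w (?c f) u v)" for v
        by (cases v) (auto simp: w_def intro: polyfn_intros)
    qed
    then have "algebraic_subvariety ?V" by (rule algebraic_subvariety_polyfn_zeros)
    moreover have "?V \<noteq> UNIV"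
    proof -
      obtain u where "E (?c f) (\<lambda>i. of_real (u i)) \<noteq> 0" using \<open>f \<in> U\<close> by (auto simp: U_def)
      then have "(\<chi> i. u i) \<notin> ?V" by simp
      then show ?thesis by blast
    qed
    moreover have "finite {z. lagrange f u z = 0} \<and> card {z. lagrange f u z = 0} = ?N" if "u \<notin> ?V" for u
      using E[of "?c f" "\<lambda>i. of_real (u $ i)"] that bij_betw_finite[OF lagrange_zeros_bij[OF keys, of u]]
        bij_betw_same_card[OF lagrange_zeros_bij[OF keys, of u]] by simp
    ultimately show ?thesis unfolding has_EDD_def by blast
  qed
  have dense: "\<exists>g\<in>U. Poly_Mapping.lookup g \<in> T"
    if f: "newton_polytope f = box_polytope a" and T: "open T" "Poly_Mapping.lookup f \<in> T" for f T
  proof -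
    have keys: "Poly_Mapping.keys f \<subseteq> exponents a" by (rule newton_polytope_keys[OF f])
    \<comment> \<open>The segment from f towards the coefficients of \<open>y\<close>, cut off
      outside the box. Near t = 0 it stays in \<open>T\<close> and keeps every exponent of
      f.\<close>
    define h where "h = (\<lambda>t \<alpha>. if \<alpha> \<in> exponents a then Poly_Mapping.lookup f \<alpha> + t * (y (Cf \<alpha>) - Poly_Mapping.lookup f \<alpha>) else 0)"
    define g where "g = (\<lambda>t. Abs_poly_mapping (h t))"
    have lookup_g: "Poly_Mapping.lookup (g t) = h t" for t
      unfolding g_def
      by (rule Abs_poly_mapping_inverse) (auto simp: h_def intro: finite_subset[OF _ finite_exponents[of a]])
    have h0: "h 0 = Poly_Mapping.lookup f"
      using keys by (auto simp: h_def fun_eq_iff in_keys_iff)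
    have cont: "continuous_on UNIV h"
    proof (rule continuous_on_coordinatewise_then_product)
      show "continuous_on UNIV (\<lambda>t. h t \<alpha>)" for \<alpha>
        by (cases "\<alpha> \<in> exponents a") (simp_all add: h_def continuous_intros)
    qed
    have lim: "(\<lambda>t. h t \<alpha>) \<midarrow>0\<rightarrow> h 0 \<alpha>" for \<alpha>
      using continuous_on_product_then_coordinatewise[OF cont, of \<alpha>] by (simp add: continuous_on_def)
    have "(h \<longlongrightarrow> h 0) (at 0)" using cont by (simp add: continuous_on_def)
    then have 1: "\<forall>\<^sub>F t in at 0. h t \<in> T"
      using T(1) by (rule topological_tendstoD) (use T(2) h0 in simp)
    have "\<forall>\<^sub>F t in at 0. h t \<alpha> \<noteq> 0" if "\<alpha> \<in> Poly_Mapping.keys f" for \<alpha>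
      by (rule tendsto_imp_eventually_ne[OF lim]) (use that h0 in \<open>simp add: in_keys_iff\<close>)
    then have 2: "\<forall>\<^sub>F t in at 0. \<forall>\<alpha>\<in>Poly_Mapping.keys f. h t \<alpha> \<noteq> 0"
      by (simp add: eventually_ball_finite_distrib)
    define u where "u = (\<lambda>i::'n. y (Ud i))"
    define v1 where "v1 = w (?c f) (\<lambda>i. of_real (u i))"
    \<comment> \<open>\<open>D\<close> along the segment, with data point taken from
      \<open>y\<close>; at t = 1 the line reaches \<open>y\<close>, so this polynomial is not zero
      and small t avoid its roots.\<close>
    obtain P where P: "\<And>t. D (\<lambda>v. v1 v + t * (of_real (y v) - v1 v)) = poly P t"
      using polyfn_line[OF D(1), of v1 "\<lambda>v. of_real (y v) - v1 v"] by blast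
    have wP: "E (?c (g t)) (\<lambda>i. of_real (u i)) = poly P (of_real t)" for t
    proof -
      have "w (?c (g t)) (\<lambda>i. of_real (u i)) = (\<lambda>v. v1 v + of_real t * (of_real (y v) - v1 v))"
        by (auto simp: fun_eq_iff w_def v1_def lookup_g h_def u_def split: edvar.splits)
      then show ?thesis by (simp add: E_def P)
    qed
    have "poly P 1 \<noteq> 0" using P[of 1] y by simp
    then have "P \<noteq> 0" by auto
    then have "finite (complex_of_real -` {t. poly P t = 0})"
      by (intro finite_vimageI poly_roots_finite) (simp_all add: inj_on_def)
    then have 3: "\<forall>\<^sub>F t in at (0::real). poly P (of_real t) \<noteq> 0"
      using islimpt_finite[of "complex_of_real -` {t. poly P t = 0}" 0] by (simp add: islimpt_iff_eventually)
    obtain t where t: "h t \<in> T" "\<forall>\<alpha>\<in>Poly_Mapping.keys f. h t \<alpha> \<noteq> 0" "poly P (of_real t) \<noteq> 0"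
      using eventually_happens'[OF at_neq_bot eventually_conj[OF 1 eventually_conj[OF 2 3]]] by blast
    have "newton_polytope (g t) = box_polytope a"
    proof (rule newton_polytope_eqI[OF f])
      show "Poly_Mapping.keys f \<subseteq> Poly_Mapping.keys (g t)" using t(2) by (auto simp: in_keys_iff lookup_g)
      show "Poly_Mapping.keys (g t) \<subseteq> exponents a" by (auto simp: in_keys_iff lookup_g h_def split: if_splits)
    qed
    then have "g t \<in> U"
      unfolding U_def polys_with_polytope_def using t(3) wP[of t] by (intro CollectI conjI exI[of _ u]) simp_all
    with t(1) show ?thesis by (intro bexI[of _ "g t"]) (simp_all add: lookup_g)
  qed
  show ?thesis
    by (intro exI[of _ U] conjI ballI dense_open_inI[OF open_U] dense EDD)
qed

theorem theorem2:
  fixes a :: "nat ^ 'n::finite"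
  assumes "\<And>i. 0 < a $ i"
  shows "(\<forall>f d. newton_polytope f = box_polytope a \<longrightarrow> has_EDD f d \<longrightarrow>
             d \<le> (\<Sum>k=1..CARD('n). fact k * elem_sym k a)) \<and>
         (\<exists>U. dense_open_in (zariski_coeff_topology a) U \<and>
              dense_open_in (euclidean_coeff_topology a) U \<and>
              (\<forall>f\<in>U. has_EDD f (\<Sum>k=1..CARD('n). fact k * elem_sym k a)))"
  using has_EDD_le generic_has_EDD[OF assms] by (intro conjI allI impI) (assumption | blast)+

end
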